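(* Let $\pi:E\to W$ be a proper dominant map between normal $F$-finite integral schemes of characteristic $p>0$ with $\pi_*\mathcal O_E=\mathcal O_W$. Let $\Delta_E$ be a $\mathbb Q$-divisor on $E$ such that $\mathcal O_E((1-p^e)(K_E+\Delta_E))\cong\pi^*\mathcal L_W$ for some $e>0$ and some line bundle $\mathcal L_W$ on $W$ (so $(p^e-1)(K_E+\Delta_E)$ is Cartier and linearly equivalent to a Cartier divisor pulled back from $W$). Suppose that every horizontal component of $\Delta_E$ (i.e. every component which dominates $W$) is effective, that is, has nonnegative coefficient. If the generic fiber $(E_\eta,\Delta_{E,\eta})$ is globally $F$-split relative to $\pi$, then there exists a canonically determined divisor $\Delta_W$ on $W$ (the divisor corresponding to $\pi_*\phi_{\Delta_E}$; see context) such that $$\pi^*(K_W+\Delta_W)\sim_{\mathbb Q}K_E+\Delta_E .$$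
   Context: Schemes are separated and excellent. Let $Y$ be normal integral $F$-finite of characteristic $p$, $\mathcal L$ a line bundle, $K(Y)$ the function field (constant sheaf). A nonzero $\phi:F^e_*\mathcal L\to\mathcal O_Y$ corresponds, via $\mathcal Hom(F^e_*\mathcal L,\mathcal O_Y)\cong F^e_*(\mathcal L^{-1}\otimes\mathcal O_Y((1-p^e)K_Y))$, to an effective Weil divisor $D_\phi$; put $\Delta_\phi=\frac1{p^e-1}D_\phi$, so $\mathcal O_Y((1-p^e)(K_Y+\Delta_\phi))\cong\mathcal L$. For a nonzero $\phi:F^e_*\mathcal L\to K(Y)$ choose (locally) an effective Cartier divisor $G_0$ with $\phi(F^e_*\mathcal L((1-p^e)G_0))\subseteq\mathcal O_Y$, let $\Delta'$ be the divisor of the restricted map, and set $\Delta_\phi=\Delta'-G_0$. Conversely a $\mathbb Q$-divisor $\Delta$ with $(p^e-1)(K_Y+\Delta)$ Cartier determines, uniquely up to units of $\Gamma(Y,\mathcal O_Y)$, a map $\phi_\Delta=\phi^e_\Delta:F^e_*\mathcal O_Y((1-p^e)(K_Y+\Delta))\to K(Y)$ with divisor $\Delta$. Canonical choice of $\Delta_W$: locally on $W$ there is an effective Cartier divisor $D$ on $W$ with $\mathrm{Image}(\phi_{\Delta_E})\subseteq\mathcal O_E(\pi^*D)$; pushing forward and using the projection formula gives $\phi_W=\pi_*\phi_{\Delta_E}:F^e_*\mathcal L_W\to\mathcal O_W(D)\subseteq K(W)$, and $\Delta_W$ is the divisor corresponding to $\phi_W$. A pair $(Y,\Delta)$ with $\Delta\ge0$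 is globally $F$-split if for some $e>0$ with $(p^e-1)(K_Y+\Delta)$ Cartier the map $H^0(Y,F^e_*\mathcal O_Y((1-p^e)(K_Y+\Delta)))\to H^0(Y,\mathcal O_Y)$ induced by $\phi^e_\Delta$ is surjective; it is globally $F$-split relative to a morphism $Y\to Z$ if this holds over each member of some open cover of $Z$. Here $\eta$ is the generic point of $W$, $E_\eta$ the generic fiber, $\Delta_{E,\eta}=\Delta_E|_{E_\eta}$. *)

theory Defs
  imports
    "HOL-Analysis.Abstract_Topology"
    "HOL-Algebra.Subrings"
    "HOL-Algebra.Generated_Rings"
    "HOL-Algebra.Ring_Divisibility"
    "HOL-Computational_Algebra.Polynomial"
    "HOL-Computational_Algebra.Primes"
begin

section \<open>Integral schemes\<close>

definition ring_on :: "'k::field set \<Rightarrow> 'k ring" where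
  "ring_on A = \<lparr>carrier = A, monoid.mult = (*), one = 1, ring.zero = 0, add = (+)\<rparr>"

text \<open>
  On an integral scheme $Y$ the restriction maps between nonempty open sets are injective, and
  all sections embed compatibly into the stalk at the generic point, the function field
  $K(Y)$.  So the structure sheaf is a subsheaf of the constant sheaf $K(Y)$.  We use this normal
  form: the function field is a type \<open>'k\<close> of class \<open>field\<close>, \<open>reg Y U\<close> is
  $\mathcal O_Y(U)$ as a subring of it, and the restriction maps are inclusions.  The value of
  \<open>reg Y\<close> at the empty set, or at a set that is not open, carries no meaning and is never
  used.
\<close>

record ('a, 'k) int_scheme =
  pts :: "'a topology"
  reg :: "'a set \<Rightarrow> 'k set"

definition nopen :: "('a, 'k) int_scheme \<Rightarrow> 'a set \<Rightarrow> bool" where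
  "nopen Y U \<longleftrightarrow> openin (pts Y) U \<and> U \<noteq> {}"

definition stalk :: "('a, 'k) int_scheme \<Rightarrow> 'a \<Rightarrow> 'k set" where
  "stalk Y y = \<Union> {reg Y U | U. openin (pts Y) U \<and> y \<in> U}"

definition nonunits :: "'k::field set \<Rightarrow> 'k set" where
  "nonunits A = {a \<in> A. a = 0 \<or> inverse a \<notin> A}"

definition basic_open :: "'k::field set \<Rightarrow> 'k \<Rightarrow> 'k set set" where
  "basic_open A f = {P. primeideal P (ring_on A) \<and> f \<notin> P}"

definition Spec_top :: "'k::field set \<Rightarrow> 'k set topology" where
  "Spec_top A = topology_generated_by {basic_open A f | f. f \<in> A}"

text \<open>
  $U$ is affine if the canonical morphism from $U$ to the spectrum of $A = \mathcal O_Y(U)$ is an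
  isomorphism: it sends $y$ to the prime ideal of all $f \in A$ that are not units at $y$, and the
  sheaf on the spectrum is determined by its values $A_f$ on basic open sets.
\<close>

definition affine_open :: "('a, 'k::field) int_scheme \<Rightarrow> 'a set \<Rightarrow> bool" where
  "affine_open Y U \<longleftrightarrow> nopen Y U \<and>
     homeomorphic_map (subtopology (pts Y) U) (Spec_top (reg Y U))
       (\<lambda>y. reg Y U \<inter> nonunits (stalk Y y)) \<and>
     (\<forall>f \<in> reg Y U - {0}.
        reg Y {y \<in> U. f \<notin> nonunits (stalk Y y)} = {a / f ^ n | a n. a \<in> reg Y U})"

text \<open>
  Irreducibility makes any two nonempty open sets meet, so for a subsheaf of a constant sheaf
  gluing says that a function that is regular on each member of a cover is regular on the union.
\<close>

definition integral_scheme :: "('a, 'k::field) int_scheme \<Rightarrow> bool" where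
  "integral_scheme Y \<longleftrightarrow>
     topspace (pts Y) \<noteq> {} \<and>
     (\<forall>U V. nopen Y U \<and> nopen Y V \<longrightarrow> U \<inter> V \<noteq> {}) \<and>
     (\<forall>U. nopen Y U \<longrightarrow> subring (reg Y U) (ring_on UNIV)) \<and>
     (\<forall>U V. nopen Y U \<and> nopen Y V \<and> U \<subseteq> V \<longrightarrow> reg Y V \<subseteq> reg Y U) \<and>
     (\<forall>C. C \<noteq> {} \<and> (\<forall>U \<in> C. nopen Y U) \<longrightarrow> (\<Inter>U\<in>C. reg Y U) \<subseteq> reg Y (\<Union>C)) \<and>
     (\<Union>{reg Y U | U. nopen Y U}) = UNIV \<and>
     (\<forall>y \<in> topspace (pts Y). \<exists>U. affine_open Y U \<and> y \<in> U)"

text \<open>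
  The diagonal is a closed immersion, tested over the affine open subschemes $U \times V$ of
  $Y \times Y$, whose preimages under the diagonal are the sets $U \cap V$: these are affine, and
  $\mathcal O(U) \otimes \mathcal O(V) \to \mathcal O(U \cap V)$ is surjective.
\<close>

definition separated :: "('a, 'k::field) int_scheme \<Rightarrow> bool" where
  "separated Y \<longleftrightarrow> (\<forall>U V. affine_open Y U \<and> affine_open Y V \<longrightarrow>
     affine_open Y (U \<inter> V) \<and>
     reg Y (U \<inter> V) = generate_ring (ring_on UNIV) (reg Y U \<union> reg Y V))"

definition locally_noetherian :: "('a, 'k::field) int_scheme \<Rightarrow> bool" where
  "locally_noetherian Y \<longleftrightarrow> (\<forall>U. affine_open Y U \<longrightarrow> noetherian_ring (ring_on (reg Y U)))"

definition integrally_closed :: "'k::field set \<Rightarrow> bool" where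
  "integrally_closed A \<longleftrightarrow>
     (\<forall>q k. lead_coeff q = 1 \<and> (\<forall>i. coeff q i \<in> A) \<and> poly q k = 0 \<longrightarrow> k \<in> A)"

definition normal_scheme :: "('a, 'k::field) int_scheme \<Rightarrow> bool" where
  "normal_scheme Y \<longleftrightarrow> (\<forall>y \<in> topspace (pts Y). integrally_closed (stalk Y y))"

definition F_finite :: "nat \<Rightarrow> ('a, 'k::field) int_scheme \<Rightarrow> bool" where
  "F_finite p Y \<longleftrightarrow> (\<forall>U. affine_open Y U \<longrightarrow>
     (\<exists>S. finite S \<and> S \<subseteq> reg Y U \<and>
        reg Y U = {\<Sum>s\<in>S. c s ^ p * s | c. \<forall>s\<in>S. c s \<in> reg Y U}))"

text \<open>
  Excellence is not listed separately: by a theorem of Kunz, a Noetherian \<open>F\<close>-finite ring is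
  excellent.
\<close>

definition standing :: "nat \<Rightarrow> ('a, 'k::field) int_scheme \<Rightarrow> bool" where
  "standing p Y \<longleftrightarrow> CHAR('k) = p \<and> integral_scheme Y \<and> separated Y \<and> locally_noetherian Y \<and>
     normal_scheme Y \<and> F_finite p Y"

text \<open>
  \<open>subscheme Y S\<close> carries the sheaf whose sections over $U$ are the functions regular at all
  points of $U$.  For open $S$ this is the open subscheme.  For $S$ the fibre of a dominant morphism
  over the generic point it is the generic fibre, whose local rings are those of $Y$.
\<close>

definition subscheme :: "('a, 'k) int_scheme \<Rightarrow> 'a set \<Rightarrow> ('a, 'k) int_scheme" where
  "subscheme Y S = \<lparr>pts = subtopology (pts Y) S, reg = (\<lambda>U. \<Inter>y\<in>U. stalk Y y)\<rparr>"

definition generic_point :: "('a, 'k) int_scheme \<Rightarrow> 'a" where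
  "generic_point Y =
     (THE y. y \<in> topspace (pts Y) \<and> (pts Y) closure_of {y} = topspace (pts Y))"


section \<open>Dominant and proper morphisms\<close>

definition preim :: "('a, 'k) int_scheme \<Rightarrow> ('a \<Rightarrow> 'b) \<Rightarrow> 'b set \<Rightarrow> 'a set" where
  "preim E f V = {x \<in> topspace (pts E). f x \<in> V}"

text \<open>
  A dominant morphism of integral schemes is a continuous map \<open>f\<close> of points together with the
  field extension \<open>h\<close> of function fields that induces the comorphisms
  $\mathcal O_W(V) \to \mathcal O_E(f^{-1}V)$, these being local on stalks.
\<close>

definition dominant_morphism ::
  "('a, 'k::field) int_scheme \<Rightarrow> ('b, 'l::field) int_scheme \<Rightarrow> ('a \<Rightarrow> 'b) \<Rightarrow> ('l \<Rightarrow> 'k) \<Rightarrow> bool" where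
  "dominant_morphism E W f h \<longleftrightarrow>
     continuous_map (pts E) (pts W) f \<and>
     (pts W) closure_of (f ` topspace (pts E)) = topspace (pts W) \<and>
     h \<in> ring_hom (ring_on UNIV) (ring_on UNIV) \<and>
     (\<forall>V. nopen W V \<longrightarrow> h ` reg W V \<subseteq> reg E (preim E f V)) \<and>
     (\<forall>x \<in> topspace (pts E). h ` nonunits (stalk W (f x)) \<subseteq> nonunits (stalk E x))"

definition finite_type ::
  "('a, 'k::field) int_scheme \<Rightarrow> ('b, 'l::field) int_scheme \<Rightarrow> ('a \<Rightarrow> 'b) \<Rightarrow> ('l \<Rightarrow> 'k) \<Rightarrow> bool" where
  "finite_type E W f h \<longleftrightarrow> (\<forall>V. affine_open W V \<longrightarrow>
     compactin (pts E) (preim E f V) \<and>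
     (\<forall>U. affine_open E U \<and> U \<subseteq> preim E f V \<longrightarrow>
        (\<exists>S. finite S \<and> reg E U = generate_ring (ring_on UNIV) (h ` reg W V \<union> S))))"

definition valuation_ring :: "'k::field set \<Rightarrow> bool" where
  "valuation_ring R \<longleftrightarrow> subring R (ring_on UNIV) \<and> (\<forall>a. a \<in> R \<or> inverse a \<in> R)"

definition dominates :: "'k::field set \<Rightarrow> 'k set \<Rightarrow> bool" where
  "dominates R A \<longleftrightarrow> A \<subseteq> R \<and> nonunits A \<subseteq> nonunits R"

text \<open>
  Separated, of finite type and universally closed.  Universal closedness (together with
  separatedness) is expressed by the valuative criterion.  As $E$ is integral, it is enough to
  consider valuation rings of the function field of $E$: each one that has a centre on $W$ has a
  unique centre on $E$ above it.
\<close>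

definition proper_morphism ::
  "('a, 'k::field) int_scheme \<Rightarrow> ('b, 'l::field) int_scheme \<Rightarrow> ('a \<Rightarrow> 'b) \<Rightarrow> ('l \<Rightarrow> 'k) \<Rightarrow> bool" where
  "proper_morphism E W f h \<longleftrightarrow> finite_type E W f h \<and>
     (\<forall>R w. valuation_ring R \<and> w \<in> topspace (pts W) \<and> dominates {a. h a \<in> R} (stalk W w) \<longrightarrow>
        (\<exists>!x. x \<in> topspace (pts E) \<and> f x = w \<and> dominates R (stalk E x)))"


section \<open>Divisors\<close>

text \<open>Points of codimension one, that is, generic points of prime divisors.\<close>

definition prime_divs :: "('a, 'k) int_scheme \<Rightarrow> 'a set" where
  "prime_divs Y = {y \<in> topspace (pts Y). y \<noteq> generic_point Y \<and>
     (\<forall>z \<in> topspace (pts Y). y \<in> (pts Y) closure_of {z} \<longrightarrow> z = y \<or> z = generic_point Y)}"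

text \<open>The valuation of the discrete valuation ring at a point of codimension one, for \<open>g \<noteq> 0\<close>.\<close>

definition ord_at :: "('a, 'k::field) int_scheme \<Rightarrow> 'a \<Rightarrow> 'k \<Rightarrow> int" where
  "ord_at Y y g = (THE n. \<exists>t u. nonunits (stalk Y y) = (*) t ` stalk Y y \<and>
     u \<in> stalk Y y - nonunits (stalk Y y) \<and> g = u * t powi n)"

definition Q_divisor :: "('a, 'k) int_scheme \<Rightarrow> ('a \<Rightarrow> rat) \<Rightarrow> bool" where
  "Q_divisor Y D \<longleftrightarrow> (\<forall>y. y \<notin> prime_divs Y \<longrightarrow> D y = 0) \<and>
     (\<forall>y \<in> topspace (pts Y). \<exists>U. openin (pts Y) U \<and> y \<in> U \<and> finite {x \<in> U. D x \<noteq> 0})"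

definition Weil_divisor :: "('a, 'k) int_scheme \<Rightarrow> ('a \<Rightarrow> rat) \<Rightarrow> bool" where
  "Weil_divisor Y D \<longleftrightarrow> Q_divisor Y D \<and> (\<forall>y. D y \<in> \<int>)"

definition principal :: "('a, 'k::field) int_scheme \<Rightarrow> 'k \<Rightarrow> 'a \<Rightarrow> rat" where
  "principal Y g = (\<lambda>y. if y \<in> prime_divs Y then of_int (ord_at Y y g) else 0)"

definition local_equation ::
  "('a, 'k::field) int_scheme \<Rightarrow> ('a \<Rightarrow> rat) \<Rightarrow> 'a \<Rightarrow> 'k \<Rightarrow> bool" where
  "local_equation Y D y g \<longleftrightarrow> g \<noteq> 0 \<and>
     (\<exists>U. openin (pts Y) U \<and> y \<in> U \<and> (\<forall>x \<in> U \<inter> prime_divs Y. D x = principal Y g x))"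

text \<open>On a normal scheme Cartier divisors are the locally principal Weil divisors.\<close>

definition Cartier_on :: "('a, 'k::field) int_scheme \<Rightarrow> 'a set \<Rightarrow> ('a \<Rightarrow> rat) \<Rightarrow> bool" where
  "Cartier_on Y U D \<longleftrightarrow> (\<forall>y \<in> U. \<exists>g. local_equation Y D y g)"

definition eff_Cartier_on :: "('a, 'k::field) int_scheme \<Rightarrow> 'a set \<Rightarrow> ('a \<Rightarrow> rat) \<Rightarrow> bool" where
  "eff_Cartier_on Y U D \<longleftrightarrow> Cartier_on Y U D \<and> (\<forall>y \<in> U \<inter> prime_divs Y. D y \<ge> 0)"

definition Cartier_divisor :: "('a, 'k::field) int_scheme \<Rightarrow> ('a \<Rightarrow> rat) \<Rightarrow> bool" where
  "Cartier_divisor Y D \<longleftrightarrow> Weil_divisor Y D \<and> Cartier_on Y (topspace (pts Y)) D"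

text \<open>
  The sections of $\mathcal O_Y(D)$ over a nonempty open set.  Every line bundle on an integral
  scheme is isomorphic to $\mathcal O_Y(D)$ for some Cartier divisor $D$.
\<close>

definition div_sheaf :: "('a, 'k::field) int_scheme \<Rightarrow> ('a \<Rightarrow> rat) \<Rightarrow> 'a set \<Rightarrow> 'k set" where
  "div_sheaf Y D U = {g. g = 0 \<or> (\<forall>y \<in> U \<inter> prime_divs Y. of_int (ord_at Y y g) + D y \<ge> 0)}"

text \<open>
  An isomorphism $\mathcal O_Y(D) \cong \mathcal O_Y(D')$ of $\mathcal O_Y$-modules, which is
  always multiplication by a nonzero rational function.
\<close>

definition div_sheaf_iso ::
  "('a, 'k::field) int_scheme \<Rightarrow> 'k \<Rightarrow> ('a \<Rightarrow> rat) \<Rightarrow> ('a \<Rightarrow> rat) \<Rightarrow> bool" where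
  "div_sheaf_iso Y s D D' \<longleftrightarrow> s \<noteq> 0 \<and> (\<forall>U. nopen Y U \<longrightarrow> (*) s ` div_sheaf Y D U = div_sheaf Y D' U)"

definition pullback ::
  "('a, 'k::field) int_scheme \<Rightarrow> ('b, 'l::field) int_scheme \<Rightarrow> ('a \<Rightarrow> 'b) \<Rightarrow> ('l \<Rightarrow> 'k) \<Rightarrow>
     ('b \<Rightarrow> rat) \<Rightarrow> 'a \<Rightarrow> rat" where
  "pullback E W f h D = (\<lambda>x. principal E (h (SOME g. local_equation W D (f x) g)) x)"

definition Q_Cartier :: "('a, 'k::field) int_scheme \<Rightarrow> ('a \<Rightarrow> rat) \<Rightarrow> bool" where
  "Q_Cartier Y D \<longleftrightarrow> (\<exists>n>0. Cartier_divisor Y (\<lambda>y. of_nat n * D y))"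

definition Q_pullback ::
  "('a, 'k::field) int_scheme \<Rightarrow> ('b, 'l::field) int_scheme \<Rightarrow> ('a \<Rightarrow> 'b) \<Rightarrow> ('l \<Rightarrow> 'k) \<Rightarrow>
     ('b \<Rightarrow> rat) \<Rightarrow> 'a \<Rightarrow> rat" where
  "Q_pullback E W f h D =
     (let n = (SOME n::nat. n > 0 \<and> Cartier_divisor W (\<lambda>w. of_nat n * D w))
      in (\<lambda>x. pullback E W f h (\<lambda>w. of_nat n * D w) x / of_nat n))"

definition Q_lin_equiv ::
  "('a, 'k::field) int_scheme \<Rightarrow> ('a \<Rightarrow> rat) \<Rightarrow> ('a \<Rightarrow> rat) \<Rightarrow> bool" where
  "Q_lin_equiv Y D D' \<longleftrightarrow> (\<exists>n::nat. n > 0 \<and>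
     Weil_divisor Y (\<lambda>y. of_nat n * D y) \<and> Weil_divisor Y (\<lambda>y. of_nat n * D' y) \<and>
     (\<exists>g. g \<noteq> 0 \<and> (\<forall>y. of_nat n * D y - of_nat n * D' y = principal Y g y)))"

definition restrict_div :: "'a set \<Rightarrow> ('a \<Rightarrow> rat) \<Rightarrow> 'a \<Rightarrow> rat" where
  "restrict_div S D = (\<lambda>x. if x \<in> S then D x else 0)"

definition horizontal ::
  "('a, 'k) int_scheme \<Rightarrow> ('b, 'l) int_scheme \<Rightarrow> ('a \<Rightarrow> 'b) \<Rightarrow> 'a \<Rightarrow> bool" where
  "horizontal E W f x \<longleftrightarrow> (pts W) closure_of (f ` ((pts E) closure_of {x})) = topspace (pts W)"


section \<open>Maps from Frobenius push-forwards, and their divisors\<close>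

definition frob_linear :: "nat \<Rightarrow> nat \<Rightarrow> ('k::field \<Rightarrow> 'k) \<Rightarrow> bool" where
  "frob_linear p e \<phi> \<longleftrightarrow> (\<forall>x y. \<phi> (x + y) = \<phi> x + \<phi> y) \<and> (\<forall>a x. \<phi> (a ^ (p ^ e) * x) = a * \<phi> x)"

text \<open>
  A map $F^e_*\mathcal O_Y(L) \to K(Y)$ extends uniquely to the generic stalk, so it is the same
  as a map $F^e_*K(Y) \to K(Y)$.  \<open>frob_hom p e Y L U\<close> are the sections over $U$ of
  $\mathcal Hom(F^e_*\mathcal O_Y(L), \mathcal O_Y)$ in this form.
\<close>

definition frob_hom ::
  "nat \<Rightarrow> nat \<Rightarrow> ('a, 'k::field) int_scheme \<Rightarrow> ('a \<Rightarrow> rat) \<Rightarrow> 'a set \<Rightarrow> ('k \<Rightarrow> 'k) set" where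
  "frob_hom p e Y L U = {\<phi>. frob_linear p e \<phi> \<and>
     (\<forall>V. nopen Y V \<and> V \<subseteq> U \<longrightarrow> \<phi> ` div_sheaf Y L V \<subseteq> reg Y V)}"

text \<open>
  \<open>T\<close> is an isomorphism of $F^e_*\mathcal O_Y$-modules from
  $F^e_*\mathcal O_Y((1-p^e)K_Y)$ to $\mathcal Hom(F^e_*\mathcal O_Y, \mathcal O_Y)$, extended to
  the generic stalk.
\<close>

definition frob_duality ::
  "nat \<Rightarrow> nat \<Rightarrow> ('a, 'k::field) int_scheme \<Rightarrow> ('a \<Rightarrow> rat) \<Rightarrow> ('k \<Rightarrow> 'k \<Rightarrow> 'k) \<Rightarrow> bool" where
  "frob_duality p e Y K T \<longleftrightarrow>
     (\<forall>g g'. T (g + g') = (\<lambda>x. T g x + T g' x)) \<and>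
     (\<forall>a g. T (a * g) = (\<lambda>x. T g (a * x))) \<and>
     (\<forall>U. nopen Y U \<longrightarrow>
        bij_betw T (div_sheaf Y (\<lambda>y. (1 - of_nat p ^ e) * K y) U) (frob_hom p e Y (\<lambda>_. 0) U))"

text \<open>
  The duality isomorphisms are the only property of $K_Y$ that enters.  A divisor $K_Y$ with
  $\mathcal O_Y(K_Y) \cong \omega_Y$ for a dualizing sheaf that Frobenius duality preserves has
  it, and conversely it determines $(1-p^e)K_Y$ up to linear equivalence.
\<close>

definition canonical_divisor :: "nat \<Rightarrow> ('a, 'k::field) int_scheme \<Rightarrow> ('a \<Rightarrow> rat) \<Rightarrow> bool" where
  "canonical_divisor p Y K \<longleftrightarrow> Weil_divisor Y K \<and> (\<forall>e>0. \<exists>T. frob_duality p e Y K T)"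

text \<open>
  \<open>has_divisor p e Y K L \<phi> \<Delta>\<close>: the nonzero map $\phi : F^e_*\mathcal O_Y(L) \to K(Y)$ has
  $\Delta_\phi = \Delta$.  After twisting the duality isomorphism by $L$, the map $\phi = T(g)$,
  restricted to $F^e_*\mathcal O_Y(M)$ with $M = L + (1-p^e)G$ and $G$ the auxiliary local
  divisor $G_0$, is the section $g$ of $\mathcal O_Y((1-p^e)K_Y - M)$.  The zero divisor of that
  section is the divisor $D_\phi$ of the restricted map.
\<close>

definition has_divisor ::
  "nat \<Rightarrow> nat \<Rightarrow> ('a, 'k::field) int_scheme \<Rightarrow> ('a \<Rightarrow> rat) \<Rightarrow> ('a \<Rightarrow> rat) \<Rightarrow> ('k \<Rightarrow> 'k) \<Rightarrow>
     ('a \<Rightarrow> rat) \<Rightarrow> bool" where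
  "has_divisor p e Y K L \<phi> \<Delta> \<longleftrightarrow> Q_divisor Y \<Delta> \<and>
     (\<exists>T g. frob_duality p e Y K T \<and> g \<noteq> 0 \<and> \<phi> = T g \<and>
       (\<forall>y \<in> topspace (pts Y). \<exists>U G. openin (pts Y) U \<and> y \<in> U \<and> eff_Cartier_on Y U G \<and>
          (let M = (\<lambda>x. L x + (1 - of_nat p ^ e) * G x);
               D = (\<lambda>x. principal Y g x + (1 - of_nat p ^ e) * K x - M x)
           in \<phi> \<in> frob_hom p e Y M U \<and>
              (\<forall>x \<in> U \<inter> prime_divs Y. \<Delta> x = D x / (of_nat p ^ e - 1) - G x))))"

definition log_bundle :: "nat \<Rightarrow> nat \<Rightarrow> ('a \<Rightarrow> rat) \<Rightarrow> ('a \<Rightarrow> rat) \<Rightarrow> 'a \<Rightarrow> rat" where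
  "log_bundle p e K \<Delta> = (\<lambda>y. (1 - of_nat p ^ e) * (K y + \<Delta> y))"

text \<open>\<open>\<phi>\<close> is a choice of $\phi^e_\Delta$, which is unique up to units of $\Gamma(Y, \mathcal O_Y)$.\<close>

definition phi_Delta ::
  "nat \<Rightarrow> nat \<Rightarrow> ('a, 'k::field) int_scheme \<Rightarrow> ('a \<Rightarrow> rat) \<Rightarrow> ('a \<Rightarrow> rat) \<Rightarrow> ('k \<Rightarrow> 'k) \<Rightarrow> bool" where
  "phi_Delta p e Y K \<Delta> \<phi> \<longleftrightarrow> Cartier_divisor Y (log_bundle p e K \<Delta>) \<and>
     has_divisor p e Y K (log_bundle p e K \<Delta>) \<phi> \<Delta>"

definition globally_F_split ::
  "nat \<Rightarrow> ('a, 'k::field) int_scheme \<Rightarrow> ('a \<Rightarrow> rat) \<Rightarrow> ('a \<Rightarrow> rat) \<Rightarrow> bool" where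
  "globally_F_split p Y K \<Delta> \<longleftrightarrow> (\<forall>y. \<Delta> y \<ge> 0) \<and>
     (\<exists>e \<phi>. e > 0 \<and> phi_Delta p e Y K \<Delta> \<phi> \<and>
        \<phi> ` div_sheaf Y (log_bundle p e K \<Delta>) (topspace (pts Y)) = reg Y (topspace (pts Y)))"

definition globally_F_split_rel ::
  "nat \<Rightarrow> ('a, 'k::field) int_scheme \<Rightarrow> ('a \<Rightarrow> rat) \<Rightarrow> ('a \<Rightarrow> rat) \<Rightarrow>
     ('b, 'l) int_scheme \<Rightarrow> ('a \<Rightarrow> 'b) \<Rightarrow> bool" where
  "globally_F_split_rel p Y K \<Delta> Z f \<longleftrightarrow>
     (\<exists>C. (\<forall>V \<in> C. nopen Z V) \<and> \<Union>C = topspace (pts Z) \<and>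
        (\<forall>V \<in> C. let S = preim Y f V
           in globally_F_split p (subscheme Y S) (restrict_div S K) (restrict_div S \<Delta>)))"


section \<open>The canonical choice of the divisor on the base\<close>

text \<open>
  $\phi_W = \pi_*\phi_{\Delta_E}$ with respect to an isomorphism
  $\mathcal O_E((1-p^e)(K_E+\Delta_E)) \cong \pi^*\mathcal O_W(L)$, given by multiplication by $s$.
  The projection formula identifies a section $a$ of $\mathcal O_W(L)$ with the section
  $s\,h(a)$, and the local divisors $D$ make $\phi_W$ land in $\mathcal O_W(D)$.
\<close>

definition pushforward_map ::
  "nat \<Rightarrow> nat \<Rightarrow> ('a, 'k::field) int_scheme \<Rightarrow> ('b, 'l::field) int_scheme \<Rightarrow> ('a \<Rightarrow> 'b) \<Rightarrow>
     ('l \<Rightarrow> 'k) \<Rightarrow> ('a \<Rightarrow> rat) \<Rightarrow> ('a \<Rightarrow> rat) \<Rightarrow> ('b \<Rightarrow> rat) \<Rightarrow> ('l \<Rightarrow> 'l) \<Rightarrow> bool" where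
  "pushforward_map p e E W f h K\<^sub>E \<Delta>\<^sub>E L \<phi>\<^sub>W \<longleftrightarrow>
     (\<exists>\<phi> s. phi_Delta p e E K\<^sub>E \<Delta>\<^sub>E \<phi> \<and>
        div_sheaf_iso E s (pullback E W f h L) (log_bundle p e K\<^sub>E \<Delta>\<^sub>E) \<and>
        (\<forall>w \<in> topspace (pts W). \<exists>V D. openin (pts W) V \<and> w \<in> V \<and> eff_Cartier_on W V D \<and>
           (\<forall>U. nopen E U \<and> U \<subseteq> preim E f V \<longrightarrow>
              \<phi> ` div_sheaf E (log_bundle p e K\<^sub>E \<Delta>\<^sub>E) U \<subseteq> div_sheaf E (pullback E W f h D) U) \<and>
           (\<forall>V'. nopen W V' \<and> V' \<subseteq> V \<longrightarrow> \<phi>\<^sub>W ` div_sheaf W L V' \<subseteq> div_sheaf W D V')) \<and>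
        (\<forall>a. h (\<phi>\<^sub>W a) = \<phi> (s * h a)))"

text \<open>
  All choices ($e$, the line bundle, the isomorphism, $\phi_{\Delta_E}$) are existentially
  quantified, so that uniqueness of \<open>\<Delta>\<^sub>W\<close> expresses that it does not depend on them.
\<close>

definition canonical_choice ::
  "nat \<Rightarrow> ('a, 'k::field) int_scheme \<Rightarrow> ('b, 'l::field) int_scheme \<Rightarrow> ('a \<Rightarrow> 'b) \<Rightarrow>
     ('l \<Rightarrow> 'k) \<Rightarrow> ('a \<Rightarrow> rat) \<Rightarrow> ('b \<Rightarrow> rat) \<Rightarrow> ('a \<Rightarrow> rat) \<Rightarrow> ('b \<Rightarrow> rat) \<Rightarrow> bool" where
  "canonical_choice p E W f h K\<^sub>E K\<^sub>W \<Delta>\<^sub>E \<Delta>\<^sub>W \<longleftrightarrow>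
     (\<exists>e L \<phi>\<^sub>W. e > 0 \<and> Cartier_divisor W L \<and> pushforward_map p e E W f h K\<^sub>E \<Delta>\<^sub>E L \<phi>\<^sub>W \<and>
        has_divisor p e W K\<^sub>W L \<phi>\<^sub>W \<Delta>\<^sub>W)"

end

theory Submission
  imports Defs
begin

text \<open>
  Let $x$ be a prime divisor with uniformizer $t$ and let $\psi$ be a nonzero $p^{-e}$-linear map on
  the function field.  The largest $r$ with $\psi(t^{-r}\mathcal O_x) \subseteq \mathcal O_x$ is called
  the order of $\psi$ at $x$ (the relation \<open>vord\<close>).  Duality shows that the order of $T(g)$ is
  $\mathrm{ord}_x(g) + (1-p^e)K_Y$, so a map $\psi$ on $\mathcal O_Y(L)$ has divisor $\Delta$ if and
  only if its order is $(p^e-1)\Delta + L$ everywhere.  Orders satisfy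
  $v(\phi\circ\phi') = p^{e'} v(\phi) + v(\phi')$, hence iterates of $\phi_\Delta$ are
  again maps of the form $\phi_\Delta$, and two choices of $\phi_\Delta$ become equal up to a unit
  after iteration.

  A splitting of the generic fibre, iterated and compared with an iterate of
  $\phi_{\Delta_E}$, produces a rational function on $W$ that an iterate of $\pi_*\phi_{\Delta_E}$ sends
  to $1$.  So $\pi_*\phi_{\Delta_E} = T(g)$ for some $g \neq 0$, and
  $(p^e-1)(K_W+\Delta_W) = \mathrm{div}(g) - L$ pulls back to $(p^e-1)(K_E+\Delta_E)$ up to a
  principal divisor.
\<close>

section \<open>Noetherian subrings of a field\<close>

text \<open>The obstacle is that a splitting of the generic fibre comes with its own exponent e' and
  its own map \<phi>', unrelated to the chosen e and \<phi>. But p^-e-linear maps of K(E) form a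
  space of dimension one over F^e_* K(E), so the e-th iterate of \<phi>' and the e'-th iterate of
  \<phi>, both of exponent e e', differ by premultiplication with a rational function c. The order
  of \<phi>_\<Delta> does not depend on \<Delta>, which cancels against the twist by
  (1-p^e)(K+\<Delta>); this is what controls the order of c. What must descend to W is then a
  rational function regular on the generic fibre, and pi_* O_E = O_W puts it into K(W).

  Nonnegativity of the horizontal coefficients makes the push-forward meaningful: locally over W the
  poles of \<phi>_\<Delta> lie over a proper closed subset, and a function pulled back from W clears
  them.

  All sheaves are tested in codimension one. The commutative algebra therefore aims at two facts
  about normal Noetherian domains: a function regular in codimension one is regular, and a nonzero
  function has locally finitely many zeros and poles.\<close>

locale field_subring =
  fixes A :: "'k::field set"
  assumes zero_in [simp]: "0 \<in> A" and one_in [simp]: "1 \<in> A"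
    and add_in: "x \<in> A \<Longrightarrow> y \<in> A \<Longrightarrow> x + y \<in> A"
    and mult_in: "x \<in> A \<Longrightarrow> y \<in> A \<Longrightarrow> x * y \<in> A"
    and minus_in: "x \<in> A \<Longrightarrow> - x \<in> A"
begin

lemma power_in: "x \<in> A \<Longrightarrow> x ^ n \<in> A"
  by (induction n) (auto intro: mult_in)

lemma sum_in: "(\<And>i. i \<in> I \<Longrightarrow> f i \<in> A) \<Longrightarrow> sum f I \<in> A"
  by (induction I rule: infinite_finite_induct) (auto intro: add_in)

lemma prod_in: "(\<And>i. i \<in> I \<Longrightarrow> f i \<in> A) \<Longrightarrow> prod f I \<in> A"
  by (induction I rule: infinite_finite_induct) (auto intro: mult_in)

text \<open>A product of powers of elements that have positive value at the finitely many bad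
  points. The family \<open>v\<close> is abstract because two instances occur: orders on the scheme
  itself (\<open>ex_effective\<close>) and orders on E of functions pulled back from W
  (\<open>vertical_cover\<close>).\<close>

lemma ex_bounded_below:
  fixes v :: "'x \<Rightarrow> 'k \<Rightarrow> int" and D :: "'x \<Rightarrow> rat"
  assumes F: "finite F" "F \<subseteq> B" and D: "\<And>x. x \<in> B \<Longrightarrow> x \<notin> F \<Longrightarrow> D x \<ge> 0"
    and mult: "\<And>x a b. x \<in> B \<Longrightarrow> a \<noteq> 0 \<Longrightarrow> b \<noteq> 0 \<Longrightarrow> v x (a * b) = v x a + v x b"
    and nonneg: "\<And>x a. x \<in> B \<Longrightarrow> a \<in> A \<Longrightarrow> a \<noteq> 0 \<Longrightarrow> v x a \<ge> 0"
    and pos: "\<And>x. x \<in> F \<Longrightarrow> \<exists>c. c \<in> A \<and> c \<noteq> 0 \<and> v x c \<ge> 1"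
  obtains b where "b \<in> A" "b \<noteq> 0" "\<forall>x\<in>B. v x b \<ge> 0 \<and> of_int (v x b) \<ge> - D x"
proof -
  obtain c where c: "c x \<in> A" "c x \<noteq> 0" "v x (c x) \<ge> 1" if "x \<in> F" for x
    using pos by metis
  have power: "v x (a ^ n) = int n * v x a" if "x \<in> B" "a \<noteq> 0" for x a n
    using mult[OF that(1), of 1 1] by (induction n) (simp_all add: mult that algebra_simps)
  \<comment> \<open>The least natural number that is at least \<open>- D x\<close>.\<close>
  define n where "n = (\<lambda>x. nat \<lceil>- D x\<rceil>)"
  define b where "b = (\<Prod>x\<in>F. c x ^ n x)"
  have b: "b \<in> A" "b \<noteq> 0" unfolding b_def using c F(1) by (auto intro!: prod_in power_in)
  have "of_int (v x b) \<ge> - D x" if x: "x \<in> B" for x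
  proof (cases "x \<in> F")
    case False
    then show ?thesis using D[OF x] nonneg[OF x b] by linarith
  next
    case True
    define b' where "b' = (\<Prod>x\<in>F - {x}. c x ^ n x)"
    have b': "b' \<in> A" "b' \<noteq> 0" unfolding b'_def using F(1) c by (auto intro!: prod_in power_in)
    have "b = c x ^ n x * b'" unfolding b_def b'_def by (rule prod.remove[OF F(1) True])
    then have "v x b = int (n x) * v x (c x) + v x b'"
      using x c(2)[OF True] b'(2) by (simp add: mult power)
    moreover have "int (n x) * v x (c x) \<ge> int (n x) * 1"
      using c(3)[OF True] by (intro mult_left_mono) auto
    ultimately have "v x b \<ge> int (n x)" using nonneg[OF x b'] by linarith
    moreover have "rat_of_int (int (n x)) \<ge> - D x" unfolding n_def by linarith
    ultimately show ?thesis by linarith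
  qed
  then show thesis using nonneg[OF _ b] by (intro that[OF b]) blast
qed

lemma cring_ring_on: "cring (ring_on A)"
proof (rule cringI)
  show "abelian_group (ring_on A)"
    by (rule abelian_groupI)
      (auto simp: ring_on_def add_in algebra_simps intro!: bexI[where x = "- _"] minus_in)
  show "comm_monoid (ring_on A)"
    by (rule comm_monoidI) (auto simp: ring_on_def mult_in algebra_simps)
qed (auto simp: ring_on_def algebra_simps)

end

lemma field_subringI:
  assumes "subring A (ring_on UNIV)"
  shows "field_subring A"
proof -
  interpret field_subring "UNIV :: 'a set"
    by unfold_locales auto
  interpret U: cring "ring_on (UNIV :: 'a set)"
    by (rule cring_ring_on)
  have min: "\<ominus>\<^bsub>ring_on UNIV\<^esub> x = - x" for x :: 'a
    using U.minus_equality[of "- x" x] by (simp add: ring_on_def)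
  note E = subringE[OF assms, unfolded min]
  show ?thesis
    by unfold_locales (use E in \<open>auto simp: ring_on_def\<close>)
qed

section \<open>Ideals, primes and localisation at a prime inside a field\<close>

definition is_ideal :: "'k::field set \<Rightarrow> 'k set \<Rightarrow> bool" where
  "is_ideal A I \<longleftrightarrow> I \<subseteq> A \<and> 0 \<in> I \<and> (\<forall>x\<in>I. \<forall>y\<in>I. x + y \<in> I) \<and> (\<forall>a\<in>A. \<forall>x\<in>I. a * x \<in> I)"

definition is_prime :: "'k::field set \<Rightarrow> 'k set \<Rightarrow> bool" where
  "is_prime A P \<longleftrightarrow> is_ideal A P \<and> 1 \<notin> P \<and> (\<forall>a\<in>A. \<forall>b\<in>A. a * b \<in> P \<longrightarrow> a \<in> P \<or> b \<in> P)"

text \<open>The maximal condition on families of ideals; the ascending chain condition is derived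
  from it in \<open>chain_stabilizes\<close>.\<close>

definition noeth :: "'k::field set \<Rightarrow> bool" where
  "noeth A \<longleftrightarrow> (\<forall>F. F \<noteq> {} \<and> (\<forall>I\<in>F. is_ideal A I) \<longrightarrow> (\<exists>M\<in>F. \<forall>I\<in>F. M \<subseteq> I \<longrightarrow> I = M))"

definition loc :: "'k::field set \<Rightarrow> 'k set \<Rightarrow> 'k set" where
  "loc A P = {a / b | a b. a \<in> A \<and> b \<in> A \<and> b \<notin> P}"

context field_subring
begin

lemma ideal_ring_on: "ideal I (ring_on A) \<longleftrightarrow> is_ideal A I"
proof -
  interpret R: cring "ring_on A" by (rule cring_ring_on)
  have min: "\<ominus>\<^bsub>ring_on A\<^esub> x = - x" if "x \<in> A" for x
    using R.minus_equality[of "- x" x] that by (simp add: ring_on_def minus_in)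
  show ?thesis
  proof
    assume "ideal I (ring_on A)"
    then interpret ideal I "ring_on A" .
    show "is_ideal A I"
      using a_subset zero_closed a_closed I_l_closed
      by (auto simp: is_ideal_def ring_on_def)
  next
    assume I: "is_ideal A I"
    \<comment> \<open>\<open>is_ideal\<close> speaks of sums and multiples only; negatives come from
      -1 \<in> A.\<close>
    have mI: "- x \<in> I" if "x \<in> I" for x
    proof -
      have "- 1 * x \<in> I"
        using I that minus_in[OF one_in] unfolding is_ideal_def by blast
      then show ?thesis by simp
    qed
    show "ideal I (ring_on A)"
    proof (rule idealI)
      show "ring (ring_on A)" by (rule R.ring_axioms)
      show "subgroup I (add_monoid (ring_on A))"
      proof (rule R.add.subgroupI)
        fix a assume a: "a \<in> I"
        then have "a \<in> A" using I by (auto simp: is_ideal_def)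
        then show "\<ominus>\<^bsub>ring_on A\<^esub> a \<in> I" using min mI a by simp
      qed (use I in \<open>auto simp: is_ideal_def ring_on_def\<close>)
    next
      fix a x assume "a \<in> I" "x \<in> carrier (ring_on A)"
      then have "x * a \<in> I" using I by (auto simp: is_ideal_def ring_on_def)
      then show "x \<otimes>\<^bsub>ring_on A\<^esub> a \<in> I" "a \<otimes>\<^bsub>ring_on A\<^esub> x \<in> I"
        by (simp_all add: ring_on_def mult.commute)
    qed
  qed
qed

lemma is_ideal_one: "is_ideal A I \<Longrightarrow> 1 \<in> I \<Longrightarrow> I = A"
  unfolding is_ideal_def by (metis mult.right_neutral subsetI subset_antisym)

lemma primeideal_ring_on: "primeideal P (ring_on A) \<longleftrightarrow> is_prime A P"
proof
  assume "primeideal P (ring_on A)"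
  then interpret primeideal P "ring_on A" .
  have "is_ideal A P" using ideal_ring_on ideal_axioms by blast
  then show "is_prime A P"
    unfolding is_prime_def using I_notcarr I_prime is_ideal_one by (auto simp: ring_on_def)
next
  assume P: "is_prime A P"
  then have "ideal P (ring_on A)" by (simp add: is_prime_def ideal_ring_on)
  then show "primeideal P (ring_on A)"
    by (rule primeidealI[OF _ cring_ring_on])
      (use P one_in in \<open>auto simp: is_prime_def ring_on_def\<close>)
qed

text \<open>Zorn's lemma applies because a nonempty chain of ideals of a Noetherian ring contains
  its own union.\<close>

lemma noethI:
  assumes "noetherian_ring (ring_on A)"
  shows "noeth A"
  unfolding noeth_def
proof (intro allI impI, elim conjE)
  fix F assume F: "F \<noteq> {}" "\<forall>I\<in>F. is_ideal A I"
  interpret noetherian_ring "ring_on A" by fact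
  have "\<exists>M\<in>F. \<forall>X\<in>F. M \<subseteq> X \<longrightarrow> X = M"
  proof (rule subset_Zorn)
    fix C assume C: "subset.chain F C"
    show "\<exists>U\<in>F. \<forall>X\<in>C. X \<subseteq> U"
    proof (cases "C = {}")
      case False
      have "subset.chain {I. ideal I (ring_on A)} C"
        using C F(2) by (auto simp: subset.chain_def ideal_ring_on)
      then have "\<Union>C \<in> C" using ideal_chain_is_trivial False by blast
      then show ?thesis using C by (auto simp: subset.chain_def)
    qed (use F in auto)
  qed
  then show "\<exists>M\<in>F. \<forall>I\<in>F. M \<subseteq> I \<longrightarrow> I = M" .
qed

end

lemma loc_intro: "a \<in> A \<Longrightarrow> b \<in> A \<Longrightarrow> b \<notin> P \<Longrightarrow> a / b \<in> loc A P"
  by (auto simp: loc_def)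

lemma noethE:
  assumes "noeth A" "F \<noteq> {}" "\<And>I. I \<in> F \<Longrightarrow> is_ideal A I"
  obtains M where "M \<in> F" "\<And>I. I \<in> F \<Longrightarrow> M \<subseteq> I \<Longrightarrow> I = M"
  using assms unfolding noeth_def by (metis)

lemma chain_stabilizes:
  fixes I :: "nat \<Rightarrow> 'k::field set"
  assumes "noeth A" "\<And>n. is_ideal A (I n)" "\<And>n. I n \<subseteq> I (Suc n)"
  obtains n where "I (Suc n) = I n"
proof -
  obtain M where "M \<in> range I" "\<And>J. J \<in> range I \<Longrightarrow> M \<subseteq> J \<Longrightarrow> J = M"
    using noethE[OF assms(1), of "range I"] assms(2) by blast
  then show thesis using that assms(3) by (metis rangeE rangeI)
qed

lemma prime_ideal: "is_prime A P \<Longrightarrow> is_ideal A P"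
  by (simp add: is_prime_def)

lemma ideal_mult: "is_ideal A I \<Longrightarrow> a \<in> A \<Longrightarrow> x \<in> I \<Longrightarrow> a * x \<in> I"
  by (simp add: is_ideal_def)

lemma ideal_add: "is_ideal A I \<Longrightarrow> x \<in> I \<Longrightarrow> y \<in> I \<Longrightarrow> x + y \<in> I"
  by (simp add: is_ideal_def)

lemma not_in_prime_nonzero: "is_prime A P \<Longrightarrow> b \<notin> P \<Longrightarrow> b \<noteq> 0"
  by (auto simp: is_prime_def is_ideal_def)

context field_subring
begin

lemma prime_compl_mult:
  "is_prime A P \<Longrightarrow> a \<in> A \<Longrightarrow> b \<in> A \<Longrightarrow> a \<notin> P \<Longrightarrow> b \<notin> P \<Longrightarrow> a * b \<notin> P"
  by (auto simp: is_prime_def)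

lemma prime_power:
  "is_prime A P \<Longrightarrow> a \<in> A \<Longrightarrow> a \<notin> P \<Longrightarrow> a ^ n \<notin> P"
  by (induction n) (auto simp: is_prime_def power_in)

lemma is_prime_zero: "is_prime A {0}"
  by (auto simp: is_prime_def is_ideal_def)

lemma subset_loc: "is_prime A P \<Longrightarrow> A \<subseteq> loc A P"
  using loc_intro[of _ A 1 P] by (auto simp: is_prime_def)

lemma field_subring_loc:
  assumes P: "is_prime A P"
  shows "field_subring (loc A P)"
proof
  note nz = not_in_prime_nonzero[OF P]
  show "0 \<in> loc A P" "1 \<in> loc A P"
    using subset_loc[OF P] by auto
  fix x y assume "x \<in> loc A P" "y \<in> loc A P"
  then obtain a b c d where ab: "a \<in> A" "b \<in> A" "b \<notin> P" "x = a / b"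
    and cd: "c \<in> A" "d \<in> A" "d \<notin> P" "y = c / d"
    by (auto simp: loc_def)
  have bd: "b * d \<in> A" "b * d \<notin> P" "b \<noteq> 0" "d \<noteq> 0"
    using ab cd prime_compl_mult[OF P] mult_in nz by auto
  have "x + y = (a * d + c * b) / (b * d)"
    using bd ab cd by (simp add: field_simps)
  then show "x + y \<in> loc A P"
    unfolding loc_def using bd ab cd by (blast intro: mult_in add_in)
  have "x * y = (a * c) / (b * d)"
    using bd ab cd by (simp add: field_simps)
  then show "x * y \<in> loc A P"
    unfolding loc_def using bd ab cd by (blast intro: mult_in add_in)
  have "- x = (- a) / b"
    using ab by simp
  then show "- x \<in> loc A P"
    unfolding loc_def using ab by (blast intro: minus_in)
qed

text \<open>Clearing the denominator of an element of I lands in I \<inter> A, so I is recovered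
  from its contraction. This injectivity carries Noetherianity and primes between A and its
  localisation.\<close>

lemma loc_contract:
  assumes P: "is_prime A P" and I: "is_ideal (loc A P) I"
  shows "is_ideal A (I \<inter> A)" "I = {a / b | a b. a \<in> I \<inter> A \<and> b \<in> A \<and> b \<notin> P}"
proof -
  note nz = not_in_prime_nonzero[OF P]
  have sub: "A \<subseteq> loc A P" by (rule subset_loc[OF P])
  show "is_ideal A (I \<inter> A)"
    using ideal_add[OF I] ideal_mult[OF I subsetD[OF sub]] I
    by (auto simp: is_ideal_def intro: add_in mult_in)
  show "I = {a / b | a b. a \<in> I \<inter> A \<and> b \<in> A \<and> b \<notin> P}" (is "_ = ?J")
  proof
    show "I \<subseteq> ?J"
    proof
      fix x assume x: "x \<in> I"
      then have "x \<in> loc A P" using I by (auto simp: is_ideal_def)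
      then obtain a b where ab: "a \<in> A" "b \<in> A" "b \<notin> P" "x = a / b"
        by (auto simp: loc_def)
      have "b * x \<in> I" using I x ab sub unfolding is_ideal_def by blast
      then have "a \<in> I" using ab nz by simp
      then show "x \<in> ?J" using ab by blast
    qed
    show "?J \<subseteq> I"
    proof
      fix x assume "x \<in> ?J"
      then obtain a b where ab: "a \<in> I" "b \<in> A" "b \<notin> P" "x = a / b"
        by blast
      have "1 / b \<in> loc A P" using ab one_in by (intro loc_intro)
      then have "1 / b * a \<in> I" using I ab unfolding is_ideal_def by blast
      then show "x \<in> I" using ab by simp
    qed
  qed
qed

text \<open>Contraction to A is monotone and injective on ideals, so an ideal with maximal
  contraction is itself maximal.\<close>

lemma noeth_loc:
  assumes "noeth A" and P: "is_prime A P"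
  shows "noeth (loc A P)"
  unfolding noeth_def
proof (intro allI impI, elim conjE)
  fix F assume F: "F \<noteq> {}" "\<forall>I\<in>F. is_ideal (loc A P) I"
  obtain M where M: "M \<in> (\<lambda>I. I \<inter> A) ` F"
      "\<And>J. J \<in> (\<lambda>I. I \<inter> A) ` F \<Longrightarrow> M \<subseteq> J \<Longrightarrow> J = M"
    using noethE[OF assms(1), of "(\<lambda>I. I \<inter> A) ` F"] F loc_contract(1)[OF P] by blast
  then obtain I0 where I0: "I0 \<in> F" "M = I0 \<inter> A" by blast
  have "I = I0" if "I \<in> F" "I0 \<subseteq> I" for I
  proof -
    have "I \<inter> A = I0 \<inter> A" using M(2)[of "I \<inter> A"] that I0 by blast
    then show ?thesis
      using loc_contract(2)[OF P, of I] loc_contract(2)[OF P, of I0] F that I0 by simp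
  qed
  then show "\<exists>M\<in>F. \<forall>I\<in>F. M \<subseteq> I \<longrightarrow> I = M" using I0 by blast
qed

text \<open>A localisation of a localisation is a localisation of A. \<open>ex_dvr\<close> uses this
  to recognise a valuation ring found over one stalk as the stalk at another point of the
  chart.\<close>

lemma prime_contract:
  assumes P: "is_prime A P" and Q: "is_prime (loc A P) Q"
  shows "is_prime A (Q \<inter> A)" "Q \<inter> A \<subseteq> P" "loc A (Q \<inter> A) = loc (loc A P) Q"
proof -
  note nz = not_in_prime_nonzero[OF P]
  have sub: "A \<subseteq> loc A P" by (rule subset_loc[OF P])
  have QI: "is_ideal (loc A P) Q" using Q by (auto simp: is_prime_def)
  show pr: "is_prime A (Q \<inter> A)"
    using Q sub loc_contract(1)[OF P QI] mult_in unfolding is_prime_def by blast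
  show QP: "Q \<inter> A \<subseteq> P"
  proof (rule ccontr)
    assume "\<not> Q \<inter> A \<subseteq> P"
    then obtain b where b: "b \<in> Q" "b \<in> A" "b \<notin> P" by auto
    then have "1 / b \<in> loc A P" using one_in by (intro loc_intro)
    then have "1 / b * b \<in> Q" using QI b unfolding is_ideal_def by blast
    then show False using nz b Q by (auto simp: is_prime_def)
  qed
  show "loc A (Q \<inter> A) = loc (loc A P) Q"
  proof
    show "loc A (Q \<inter> A) \<subseteq> loc (loc A P) Q"
      using sub by (auto simp: loc_def[of A "Q \<inter> A"] loc_def[of "loc A P"])
    show "loc (loc A P) Q \<subseteq> loc A (Q \<inter> A)"
    proof
      fix x assume "x \<in> loc (loc A P) Q"
      then obtain u v where uv: "u \<in> loc A P" "v \<in> loc A P" "v \<notin> Q" "x = u / v"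
        by (auto simp: loc_def[of "loc A P"])
      then obtain a b c d where ab: "a \<in> A" "b \<in> A" "b \<notin> P" "u = a / b"
        and cd: "c \<in> A" "d \<in> A" "d \<notin> P" "v = c / d"
        by (auto simp: loc_def)
      have "c \<notin> Q"
        using loc_contract(2)[OF P QI] uv cd by blast
      then have "b * c \<notin> Q \<inter> A"
        using prime_compl_mult[OF pr, of b c] ab cd QP by auto
      moreover have "x = (a * d) / (b * c)"
        using ab cd uv nz by simp
      ultimately show "x \<in> loc A (Q \<inter> A)"
        unfolding loc_def using ab cd mult_in by blast
    qed
  qed
qed

lemma nonunits_loc:
  assumes P: "is_prime A P"
  shows "nonunits (loc A P) = {a / b | a b. a \<in> P \<and> b \<in> A \<and> b \<notin> P}"
proof -
  note nz = not_in_prime_nonzero[OF P]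
  have PA: "P \<subseteq> A" using P by (auto simp: is_prime_def is_ideal_def)
  have 1: "a \<in> P" if "a \<in> A" "b \<in> A" "b \<notin> P" "inverse (a / b) \<notin> loc A P" for a b
  proof (rule ccontr)
    assume "a \<notin> P"
    then have "b / a \<in> loc A P" using that by (intro loc_intro)
    then show False using that by simp
  qed
  have 2: "inverse (a / b) \<notin> loc A P" if "a \<in> P" "b \<in> A" "b \<notin> P" "a \<noteq> 0" for a b
  proof
    assume "inverse (a / b) \<in> loc A P"
    then obtain c d where cd: "c \<in> A" "d \<in> A" "d \<notin> P" "b / a = c / d"
      by (auto simp: loc_def)
    then have "b * d = c * a"
      using nz that by (simp add: field_simps)
    moreover have "b * d \<notin> P" using prime_compl_mult[OF P] that cd by blast
    moreover have "c * a \<in> P" using P cd that by (auto simp: is_prime_def is_ideal_def)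
    ultimately show False by simp
  qed
  have 3: "0 \<in> P" "1 \<in> A" "1 \<notin> P" using P by (auto simp: is_prime_def is_ideal_def)
  show ?thesis
    unfolding nonunits_def
  proof (intro equalityI subsetI)
    fix x assume x: "x \<in> {a \<in> loc A P. a = 0 \<or> inverse a \<notin> loc A P}"
    then obtain a b where ab: "a \<in> A" "b \<in> A" "b \<notin> P" "x = a / b"
      by (auto simp: loc_def)
    have "a \<in> P"
    proof (cases "x = 0")
      case True
      then show ?thesis using ab nz 3 by auto
    next
      case False
      then show ?thesis using 1[of a b] ab x by simp
    qed
    then show "x \<in> {a / b | a b. a \<in> P \<and> b \<in> A \<and> b \<notin> P}" using ab by blast
  next
    fix x assume "x \<in> {a / b | a b. a \<in> P \<and> b \<in> A \<and> b \<notin> P}"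
    then obtain a b where ab: "a \<in> P" "b \<in> A" "b \<notin> P" "x = a / b" by blast
    then have "x \<in> loc A P" using PA loc_intro by blast
    moreover have "inverse x \<notin> loc A P" if "x \<noteq> 0"
      using 2[of a b] ab that by simp
    ultimately show "x \<in> {a \<in> loc A P. a = 0 \<or> inverse a \<notin> loc A P}" by blast
  qed
qed

end

section \<open>Discrete valuation rings\<close>

text \<open>Since g ranges over the whole field, that field is forced to be the fraction field of
  R.\<close>

definition dvr :: "'k::field set \<Rightarrow> 'k \<Rightarrow> bool" where
  "dvr R t \<longleftrightarrow> field_subring R \<and> t \<noteq> 0 \<and> nonunits R = (*) t ` R \<and>
     (\<forall>g. g \<noteq> 0 \<longrightarrow> (\<exists>n u. u \<in> R - nonunits R \<and> g = u * t powi n))"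

text \<open>The body of \<open>ord_at\<close> with the stalk replaced by a ring R, so that
  \<open>ord_at_val\<close> holds by unfolding.\<close>

definition val :: "'k::field set \<Rightarrow> 'k \<Rightarrow> int" where
  "val R g = (THE n. \<exists>t u. nonunits R = (*) t ` R \<and> u \<in> R - nonunits R \<and> g = u * t powi n)"

locale dvr_ring =
  fixes R :: "'k::field set" and t :: 'k
  assumes dvr: "dvr R t"
begin

sublocale field_subring R
  using dvr by (simp add: dvr_def)

lemma t_nz: "t \<noteq> 0" and nonunits_eq: "nonunits R = (*) t ` R"
  and repr: "g \<noteq> 0 \<Longrightarrow> \<exists>n u. u \<in> R - nonunits R \<and> g = u * t powi n"
  using dvr by (auto simp: dvr_def)

lemma unit_iff: "u \<in> R - nonunits R \<longleftrightarrow> u \<in> R \<and> inverse u \<in> R \<and> u \<noteq> 0"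
  by (auto simp: nonunits_def)

lemma unit_mult: "u \<in> R - nonunits R \<Longrightarrow> v \<in> R - nonunits R \<Longrightarrow> u * v \<in> R - nonunits R"
  by (simp only: unit_iff) (auto intro: mult_in)

lemma unit_inverse: "u \<in> R - nonunits R \<Longrightarrow> inverse u \<in> R - nonunits R"
  by (simp only: unit_iff) auto

lemma unit_one: "1 \<in> R - nonunits R"
  by (simp add: nonunits_def)

lemma unit_power: "u \<in> R - nonunits R \<Longrightarrow> u ^ n \<in> R - nonunits R"
proof (induction n)
  case (Suc n)
  then show ?case unfolding power_Suc using unit_mult by blast
qed (use unit_one in simp)

lemma unit_powi: "u \<in> R - nonunits R \<Longrightarrow> u powi n \<in> R - nonunits R"
  unfolding power_int_def using unit_power unit_inverse by presburger

lemma t_in: "t \<in> R" and t_inverse: "inverse t \<notin> R"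
proof -
  have "t \<in> nonunits R" unfolding nonunits_eq by (intro image_eqI[of _ _ 1]) auto
  then show "t \<in> R" "inverse t \<notin> R" using t_nz by (auto simp: nonunits_def)
qed

lemma powi_unit_iff: "t powi n \<in> R - nonunits R \<longleftrightarrow> n = 0"
proof
  assume n: "t powi n \<in> R - nonunits R"
  have "\<not> (m > 0 \<and> t powi m \<in> R - nonunits R)" for m
  proof
    assume m: "m > 0 \<and> t powi m \<in> R - nonunits R"
    then obtain k where k: "m = int (Suc k)"
      by (metis Suc_pred' zero_less_imp_eq_int of_nat_0_less_iff)
    have "inverse t = t ^ k * inverse (t powi m)"
      unfolding k power_int_of_nat using t_nz by (simp add: field_simps)
    moreover have "t ^ k \<in> R" "inverse (t powi m) \<in> R"
      using m power_in[OF t_in] unit_iff by auto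
    ultimately show False using t_inverse mult_in by metis
  qed
  from this[of n] this[of "- n"] show "n = 0"
    using n unit_inverse[OF n] by (auto simp: power_int_minus)
qed (simp add: unit_one del: Diff_iff)

text \<open>Two generators t and s of the maximal ideal divide each other, so s = t b with a unit b.
  Comparing the two representations makes t^(n-m) a unit, and a nonzero power of t is never
  one.\<close>

lemma val_eqI:
  assumes "u \<in> R - nonunits R" "g = u * t powi n"
  shows "val R g = n"
  unfolding val_def
proof (rule the_equality)
  show "\<exists>t u. nonunits R = (*) t ` R \<and> u \<in> R - nonunits R \<and> g = u * t powi n"
    using assms nonunits_eq by blast
  fix m assume "\<exists>t u. nonunits R = (*) t ` R \<and> u \<in> R - nonunits R \<and> g = u * t powi m"
  then obtain s v where s: "nonunits R = (*) s ` R" "v \<in> R - nonunits R" "g = v * s powi m"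
    by blast
  have "t \<in> nonunits R" unfolding nonunits_eq by (intro image_eqI[of _ _ 1]) auto
  then obtain a where a: "a \<in> R" "t = s * a" using s by auto
  have "s \<in> nonunits R" unfolding s(1) by (intro image_eqI[of _ _ 1]) auto
  then obtain b where b: "b \<in> R" "s = t * b" using nonunits_eq by auto
  have "a * b = 1" using a b t_nz by (metis mult.assoc mult_cancel_left2)
  then have b1: "b \<in> R - nonunits R"
    using a b unfolding unit_iff by (metis inverse_unique mult.commute mult_zero_right zero_neq_one)
  have nz: "u \<noteq> 0" "v \<noteq> 0" "b \<noteq> 0" using assms s(2) b1 unit_iff by auto
  have "u * t powi n = v * (b powi m * t powi m)"
    using assms s b by (simp add: power_int_mult_distrib mult.commute)
  then have "t powi (n - m) = v * b powi m * inverse u"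
    using t_nz nz by (simp add: power_int_diff field_simps)
  moreover have "v * b powi m * inverse u \<in> R - nonunits R"
    using s(2) unit_powi[OF b1] unit_inverse[OF assms(1)] unit_mult by blast
  ultimately show "m = n" using powi_unit_iff[of "n - m"] by simp
qed

lemma val_repr:
  assumes "g \<noteq> 0"
  shows "g * t powi (- val R g) \<in> R - nonunits R"
proof -
  obtain n u where u: "u \<in> R - nonunits R" "g = u * t powi n"
    using repr[OF assms] by blast
  have "val R g = n" using u by (rule val_eqI)
  then have "g * t powi (- val R g) = u" unfolding u(2) using t_nz by (simp add: power_int_minus)
  then show ?thesis using u(1) by (simp only:)
qed

lemma val_mult: "a \<noteq> 0 \<Longrightarrow> b \<noteq> 0 \<Longrightarrow> val R (a * b) = val R a + val R b"
proof (rule val_eqI)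
  assume nz: "a \<noteq> 0" "b \<noteq> 0"
  show "(a * t powi (- val R a)) * (b * t powi (- val R b)) \<in> R - nonunits R"
    using nz val_repr unit_mult by blast
  show "a * b = (a * t powi (- val R a)) * (b * t powi (- val R b)) * t powi (val R a + val R b)"
    using t_nz by (simp add: power_int_minus power_int_add field_simps)
qed

lemma val_t_powi: "val R (t powi n) = n"
  by (rule val_eqI[of 1]) (use unit_one in auto)

lemma val_one [simp]: "val R 1 = 0"
  using val_t_powi[of 0] by simp

lemma val_inverse: "a \<noteq> 0 \<Longrightarrow> val R (inverse a) = - val R a"
  using val_mult[of a "inverse a"] by simp

lemma val_divide: "a \<noteq> 0 \<Longrightarrow> b \<noteq> 0 \<Longrightarrow> val R (a / b) = val R a - val R b"
  by (simp add: divide_inverse val_mult val_inverse)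

lemma val_power: "a \<noteq> 0 \<Longrightarrow> val R (a ^ n) = int n * val R a"
  by (induction n) (auto simp: val_mult algebra_simps)

lemma unit_iff_val: "a \<noteq> 0 \<Longrightarrow> a \<in> R - nonunits R \<longleftrightarrow> val R a = 0"
proof
  assume "a \<noteq> 0" "a \<in> R - nonunits R"
  then show "val R a = 0" using val_eqI[of a a 0] by simp
next
  assume "a \<noteq> 0" "val R a = 0"
  then show "a \<in> R - nonunits R" using val_repr[of a] by simp
qed

lemma mem_iff_val: "a \<noteq> 0 \<Longrightarrow> a \<in> R \<longleftrightarrow> val R a \<ge> 0"
proof
  assume nz: "a \<noteq> 0" and a: "a \<in> R"
  show "val R a \<ge> 0"
  proof (rule ccontr)
    assume neg: "\<not> val R a \<ge> 0"
    then obtain k where k: "- val R a = int (Suc k)"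
      by (metis Suc_pred' zero_less_imp_eq_int of_nat_0_less_iff neg_0_less_iff_less not_le)
    define u where "u = a * t powi (- val R a)"
    have u: "u \<in> R - nonunits R" using val_repr[OF nz] by (simp add: u_def)
    have "inverse t = a * t ^ k * inverse u"
      unfolding u_def k power_int_of_nat using nz t_nz by (simp add: field_simps)
    moreover have "inverse u \<in> R" using u unit_iff by blast
    ultimately show False using t_inverse a power_in[OF t_in] mult_in by metis
  qed
next
  assume nz: "a \<noteq> 0" and v: "val R a \<ge> 0"
  define u where "u = a * t powi (- val R a)"
  have u: "u \<in> R" using val_repr[OF nz] by (simp add: u_def)
  have "a = u * t ^ nat (val R a)"
    unfolding u_def using v t_nz by (simp add: power_int_def field_simps)
  then show "a \<in> R" using u power_in[OF t_in] mult_in by metis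
qed

lemma nonunits_iff_val: "a \<noteq> 0 \<Longrightarrow> a \<in> nonunits R \<longleftrightarrow> val R a \<ge> 1"
  using unit_iff_val[of a] mem_iff_val[of a] by (auto simp: nonunits_def)

end

text \<open>The ideal I + A c; principal ideals are the case I = {0}.\<close>

definition ideal_adjoin :: "'k::field set \<Rightarrow> 'k set \<Rightarrow> 'k \<Rightarrow> 'k set" where
  "ideal_adjoin A I c = {m + r * c | m r. m \<in> I \<and> r \<in> A}"

lemma (in field_subring) ideal_adjoin:
  assumes I: "is_ideal A I" and c: "c \<in> A"
  shows "is_ideal A (ideal_adjoin A I c)" "I \<subseteq> ideal_adjoin A I c" "c \<in> ideal_adjoin A I c"
proof -
  have mem: "m + r * c \<in> ideal_adjoin A I c" if "m \<in> I" "r \<in> A" for m r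
    using that by (auto simp: ideal_adjoin_def)
  have I': "I \<subseteq> A" "0 \<in> I" using I by (simp_all add: is_ideal_def)
  show "I \<subseteq> ideal_adjoin A I c" using mem[OF _ zero_in] by auto
  show "c \<in> ideal_adjoin A I c" using mem[OF I'(2) one_in] by simp
  show "is_ideal A (ideal_adjoin A I c)"
    unfolding is_ideal_def
  proof (intro conjI ballI)
    show "ideal_adjoin A I c \<subseteq> A" using I'(1) c by (auto simp: ideal_adjoin_def intro!: add_in mult_in)
    show "0 \<in> ideal_adjoin A I c" using mem[OF I'(2) zero_in] by simp
    fix x assume "x \<in> ideal_adjoin A I c"
    then obtain m r where x: "x = m + r * c" "m \<in> I" "r \<in> A" by (auto simp: ideal_adjoin_def)
    show "x + z \<in> ideal_adjoin A I c" if "z \<in> ideal_adjoin A I c" for z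
    proof -
      obtain m' r' where z: "z = m' + r' * c" "m' \<in> I" "r' \<in> A"
        using \<open>z \<in> ideal_adjoin A I c\<close> by (auto simp: ideal_adjoin_def)
      have "x + z = (m + m') + (r + r') * c" using x z by (simp add: algebra_simps)
      then show ?thesis using mem[OF ideal_add[OF I x(2) z(2)] add_in[OF x(3) z(3)]] by simp
    qed
    fix d assume d: "d \<in> A"
    have "d * x = d * m + (d * r) * c" using x by (simp add: algebra_simps)
    then show "d * x \<in> ideal_adjoin A I c"
      using mem[OF ideal_mult[OF I d x(2)] mult_in[OF d x(3)]] by simp
  qed
qed

lemma (in field_subring) is_ideal_zero: "is_ideal A {0}"
  by (simp add: is_ideal_def)

lemma mem_adjoin_zero: "x \<in> ideal_adjoin A {0} c \<longleftrightarrow> (\<exists>r\<in>A. x = r * c)"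
  by (auto simp: ideal_adjoin_def)

text \<open>Dividing d by t as long as the quotient is a nonunit must stop. The ideals B d/t^n
  increase; if a maximal one among them had d/t^n = t r, its equality with the next one would put
  1/t into B.\<close>

lemma dvr_of_noeth:
  assumes B: "field_subring B" and noe: "noeth B" and t: "t \<noteq> 0" "nonunits B = (*) t ` B"
    and frac: "\<And>g. \<exists>a b. a \<in> B \<and> b \<in> B \<and> b \<noteq> 0 \<and> g = a / b"
  shows "dvr B t"
proof -
  interpret field_subring B by fact
  have tB: "t \<in> nonunits B" unfolding t by (intro image_eqI[of _ _ 1]) auto
  have rep: "\<exists>n u. u \<in> B - nonunits B \<and> d = u * t ^ n" if d: "d \<in> B" "d \<noteq> 0" for d
  proof -
    define J where "J = (\<lambda>n. ideal_adjoin B {0} (d / t ^ n))"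
    have "is_ideal B (J n)" if "d / t ^ n \<in> B" for n
      unfolding J_def by (rule ideal_adjoin(1)[OF is_ideal_zero that])
    then have id: "is_ideal B I" if "I \<in> J ` {n. d / t ^ n \<in> B}" for I
      using that by blast
    have "J ` {n. d / t ^ n \<in> B} \<noteq> {}"
      using d by (auto intro!: exI[of _ 0])
    then obtain M where M: "M \<in> J ` {n. d / t ^ n \<in> B}"
        "\<And>I. I \<in> J ` {n. d / t ^ n \<in> B} \<Longrightarrow> M \<subseteq> I \<Longrightarrow> I = M"
      using noethE[OF noe _ id] by metis
    then obtain n where n: "d / t ^ n \<in> B" "M = J n" by blast
    have "d / t ^ n \<notin> nonunits B"
    proof
      assume "d / t ^ n \<in> nonunits B"
      then obtain r where r: "r \<in> B" "d / t ^ n = t * r" using t by auto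
      then have r': "d / t ^ Suc n = r" using t by (simp add: field_simps)
      have "J n \<subseteq> J (Suc n)"
      proof
        fix x assume "x \<in> J n"
        then obtain a where a: "a \<in> B" "x = a * (d / t ^ n)" by (auto simp: J_def mem_adjoin_zero)
        then show "x \<in> J (Suc n)" unfolding J_def mem_adjoin_zero
          by (intro bexI[of _ "t * a"]) (use t tB mult_in in \<open>auto simp: nonunits_def\<close>)
      qed
      then have "J (Suc n) = J n" using M(2)[of "J (Suc n)"] r r' n by blast
      moreover have "d / t ^ Suc n \<in> J (Suc n)"
        unfolding J_def mem_adjoin_zero by (intro bexI[of _ 1]) auto
      ultimately obtain a where "a \<in> B" "d / t ^ Suc n = a * (d / t ^ n)"
        by (auto simp: J_def mem_adjoin_zero)
      moreover from this have "inverse t = a" using d t by (simp add: field_simps)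
      ultimately have "inverse t \<in> B" by simp
      then show False using tB t by (auto simp: nonunits_def)
    qed
    then show ?thesis using n t
      by (intro exI[of _ n] exI[of _ "d / t ^ n"]) auto
  qed
  show ?thesis unfolding dvr_def
  proof (intro conjI allI impI B t)
    fix g :: 'a assume g: "g \<noteq> 0"
    obtain a b where ab: "a \<in> B" "b \<in> B" "b \<noteq> 0" "g = a / b" using frac by blast
    obtain n u m v where u: "u \<in> B - nonunits B" "a = u * t ^ n"
      and v: "v \<in> B - nonunits B" "b = v * t ^ m"
      using rep[of a] rep[of b] ab g by auto
    have "g = (u * inverse v) * t powi (int n - int m)"
      using ab u v t by (simp add: power_int_diff field_simps)
    moreover have "u * inverse v \<in> B - nonunits B"
      using u v mult_in by (auto simp: nonunits_def mult_in)
    ultimately show "\<exists>n u. u \<in> B - nonunits B \<and> g = u * t powi n" by blast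
  qed
qed

section \<open>Height-one primes of a normal Noetherian domain\<close>

context field_subring
begin

text \<open>Take c \<noteq> 0 in Q and a \<noteq> 0 in P. Some power of a has at least the value of
  c, so a^n / c = u / v with v \<notin> P. Then v a^n = u c lies in Q, and v \<notin> Q leaves only
  a \<in> Q.\<close>

lemma dvr_loc_height_one:
  assumes P: "is_prime A P" and d: "dvr (loc A P) t" and Q: "is_prime A Q" "Q \<subseteq> P" "Q \<noteq> {0}"
  shows "Q = P"
proof -
  interpret D: dvr_ring "loc A P" t by unfold_locales fact
  have QI: "is_ideal A Q" and PI: "is_ideal A P" using Q P by (auto simp: is_prime_def)
  obtain c where c: "c \<in> Q" "c \<noteq> 0" using Q QI by (auto simp: is_ideal_def)
  then have cA: "c \<in> A" using QI by (auto simp: is_ideal_def)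
  have "P \<subseteq> Q"
  proof
    fix a assume a: "a \<in> P"
    then have aA: "a \<in> A" using PI by (auto simp: is_ideal_def)
    show "a \<in> Q"
    proof (cases "a = 0")
      case True
      then show ?thesis using QI by (auto simp: is_ideal_def)
    next
      case False
      have "a / 1 \<in> nonunits (loc A P)"
        unfolding nonunits_loc[OF P] using a P by (auto simp: is_prime_def) (metis one_in div_by_1)
      then have va: "val (loc A P) a \<ge> 1" using D.nonunits_iff_val False by simp
      define n where "n = nat (val (loc A P) c)"
      have "int n \<le> int n * val (loc A P) a" using va mult_left_mono[OF va, of "int n"] by simp
      moreover have "val (loc A P) c \<le> int n" by (simp add: n_def)
      ultimately have "val (loc A P) (a ^ n / c) \<ge> 0"
        using False c by (simp add: D.val_divide D.val_power)
      then have "a ^ n / c \<in> loc A P" using D.mem_iff_val[of "a ^ n / c"] False c by simp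
      then obtain u v where uv: "u \<in> A" "v \<in> A" "v \<notin> P" "a ^ n / c = u / v" by (auto simp: loc_def)
      then have "v * a ^ n = u * c"
        using c not_in_prime_nonzero[OF P] by (simp add: field_simps)
      moreover have "u * c \<in> Q" using QI uv c by (auto simp: is_ideal_def)
      ultimately have "v \<in> Q \<or> a ^ n \<in> Q" using Q(1) uv power_in[OF aA] by (auto simp: is_prime_def)
      then show "a \<in> Q" using uv Q prime_power[OF Q(1) aA] by blast
    qed
  qed
  then show ?thesis using Q by blast
qed

text \<open>
  If multiplication by \<open>y\<close> preserves a nonzero ideal, then the ideals spanned by
  \<open>m\<close>, \<open>m y\<close>, \<dots>, \<open>m y\<^sup>n\<close> stabilize, and this is an equation of integral dependence for \<open>y\<close>.
\<close>

lemma integral_of_stable_ideal: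
  assumes noe: "noeth A" and ic: "integrally_closed A"
    and P: "is_ideal A P" "m \<in> P" "m \<noteq> 0" and y: "\<And>c. c \<in> P \<Longrightarrow> c * y \<in> P"
  shows "y \<in> A"
proof -
  have my: "m * y ^ i \<in> P" for i
  proof (induction i)
    case (Suc i)
    then show ?case using y[of "m * y ^ i"] by (simp add: ac_simps)
  qed (use P in simp)
  then have myA: "m * y ^ i \<in> A" for i using P by (auto simp: is_ideal_def)
  define I where "I = (\<lambda>n. {\<Sum>i<n. c i * (m * y ^ i) | c. \<forall>i. c i \<in> A})"
  have id: "is_ideal A (I n)" for n
    unfolding is_ideal_def
  proof (intro conjI ballI)
    show "I n \<subseteq> A" by (auto simp: I_def intro!: sum_in mult_in[OF _ myA])
    show "0 \<in> I n" unfolding I_def by (intro CollectI exI[of _ "\<lambda>_. 0"]) auto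
    fix x assume "x \<in> I n"
    then obtain c where c: "x = (\<Sum>i<n. c i * (m * y ^ i))" "\<forall>i. c i \<in> A" by (auto simp: I_def)
    show "x + z \<in> I n" if "z \<in> I n" for z
    proof -
      obtain d where d: "z = (\<Sum>i<n. d i * (m * y ^ i))" "\<forall>i. d i \<in> A"
        using \<open>z \<in> I n\<close> by (auto simp: I_def)
      show ?thesis unfolding I_def
        by (intro CollectI exI[of _ "\<lambda>i. c i + d i"])
          (use c d in \<open>auto simp: sum.distrib distrib_right intro: add_in\<close>)
    qed
    fix a assume "a \<in> A"
    then show "a * x \<in> I n" unfolding I_def
      by (intro CollectI exI[of _ "\<lambda>i. a * c i"])
        (use c in \<open>auto simp: sum_distrib_left mult.assoc intro: mult_in\<close>)
  qed
  have inc: "I n \<subseteq> I (Suc n)" for n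
  proof
    fix x assume "x \<in> I n"
    then obtain c where c: "x = (\<Sum>i<n. c i * (m * y ^ i))" "\<forall>i. c i \<in> A" by (auto simp: I_def)
    show "x \<in> I (Suc n)" unfolding I_def
      by (intro CollectI exI[of _ "\<lambda>i. if i < n then c i else 0"]) (use c in auto)
  qed
  obtain n where n: "I (Suc n) = I n" using chain_stabilizes[of A I] noe id inc by blast
  have "m * y ^ n \<in> I (Suc n)"
    unfolding I_def by (intro CollectI exI[of _ "\<lambda>i. if i = n then 1 else 0"]) auto
  then obtain c where c: "m * y ^ n = (\<Sum>i<n. c i * (m * y ^ i))" "\<forall>i. c i \<in> A"
    unfolding n by (auto simp: I_def)
  have "m * y ^ n = m * (\<Sum>i<n. c i * y ^ i)"
    unfolding c by (simp add: sum_distrib_left ac_simps)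
  then have yn: "y ^ n = (\<Sum>i<n. c i * y ^ i)" using P by simp
  define q where "q = monom 1 n - (\<Sum>i<n. monom (c i) i)"
  have co: "coeff q k = (if k = n then 1 else 0) - (if k < n then c k else 0)" for k
    by (simp add: q_def coeff_sum if_distrib cong: if_cong)
  have "degree q = n"
    by (rule antisym) (auto intro!: degree_le le_degree simp: co)
  then have "lead_coeff q = 1" by (simp add: co)
  moreover have "coeff q k \<in> A" for k
    unfolding co using c by (auto intro: minus_in)
  moreover have "poly q y = 0"
    by (simp add: q_def poly_sum poly_monom yn)
  ultimately show "y \<in> A" using ic unfolding integrally_closed_def by blast
qed

text \<open>The conductors (A : y) of the multiples y = r x outside A have a maximal member P, and
  maximality makes it prime. By normality y P is not contained in P, since otherwise y would be
  integral over A. So c y \<notin> P for some c \<in> P, hence c y is a unit of the localisation at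
  P, and 1/y = c / (c y) generates the maximal ideal.\<close>

lemma exists_dvr_loc:
  assumes noe: "noeth A" and ic: "integrally_closed A"
    and frac: "\<And>g. \<exists>a b. a \<in> A \<and> b \<in> A \<and> b \<noteq> 0 \<and> g = a / b" and x: "x \<notin> A"
  obtains P t where "is_prime A P" "P \<noteq> {0}" "dvr (loc A P) t" "x \<notin> loc A P"
proof -
  obtain a b where ab: "a \<in> A" "b \<in> A" "b \<noteq> 0" "x = a / b" using frac by blast
  define C where "C = (\<lambda>y. {c \<in> A. c * y \<in> A})"
  define Y where "Y = {y. y \<notin> A \<and> (\<exists>r\<in>A. y = r * x)}"
  have id: "is_ideal A (C y)" for y
    by (auto simp: is_ideal_def C_def distrib_right mult.assoc intro: add_in mult_in)
  have "x \<in> Y" using x by (auto simp: Y_def intro!: bexI[of _ 1])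
  then have "C ` Y \<noteq> {}" by blast
  moreover have "is_ideal A I" if "I \<in> C ` Y" for I
    using that id by blast
  ultimately obtain P where P: "P \<in> C ` Y" "\<And>I. I \<in> C ` Y \<Longrightarrow> P \<subseteq> I \<Longrightarrow> I = P"
    using noethE[OF noe] by metis
  then obtain y where y: "y \<in> Y" "P = C y" by blast
  then obtain r where r: "y \<notin> A" "r \<in> A" "y = r * x" by (auto simp: Y_def)
  have Pid: "is_ideal A P" using y id by simp
  have Pp: "is_prime A P"
    unfolding is_prime_def
  proof (intro conjI ballI impI Pid)
    show "1 \<notin> P" using r by (simp add: y C_def)
    fix c d assume cd: "c \<in> A" "d \<in> A" "c * d \<in> P"
    show "c \<in> P \<or> d \<in> P"
    proof (rule disjCI, rule ccontr)
      assume "d \<notin> P" "c \<notin> P"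
      \<comment> \<open>Since c is not in the conductor of y, c y is again a multiple of x outside
        A. Its conductor contains P and also d, against maximality.\<close>
      then have "c * y \<in> Y" using cd r by (auto simp: y C_def Y_def mult_in intro!: bexI[of _ "c * r"])
      moreover have "P \<subseteq> C (c * y)"
        using mult_in[OF cd(1)] by (auto simp: y C_def mult.left_commute[of _ c])
      ultimately have "C (c * y) = P" using P(2) by blast
      moreover have "d \<in> C (c * y)" using cd by (simp add: y C_def ac_simps)
      ultimately show False using \<open>d \<notin> P\<close> by blast
    qed
  qed
  \<comment> \<open>The denominator b of x also clears y = r x. It makes P nonzero, as the
    integrality argument requires.\<close>
  have bP: "b \<in> P"
    using ab r by (auto simp: y C_def mult_in)
  have ynz: "y \<noteq> 0" using r zero_in by auto
  have "\<exists>c\<in>P. c * y \<notin> P"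
    using integral_of_stable_ideal[OF noe ic Pid bP] ab r by blast
  then obtain c where c: "c \<in> P" "c * y \<notin> P" by blast
  have cA: "c \<in> A" "c * y \<in> A" using c by (auto simp: y C_def)
  define t where "t = 1 / y"
  have t: "t = c / (c * y)" using ynz c Pid by (auto simp: t_def is_ideal_def)
  have nu: "nonunits (loc A P) = (*) t ` loc A P"
    unfolding nonunits_loc[OF Pp]
  proof (intro equalityI subsetI)
    fix z assume "z \<in> {a / b | a b. a \<in> P \<and> b \<in> A \<and> b \<notin> P}"
    then obtain u v where uv: "u \<in> P" "v \<in> A" "v \<notin> P" "z = u / v" by blast
    then have "u * y / v \<in> loc A P" by (intro loc_intro) (auto simp: y C_def)
    moreover have "z = t * (u * y / v)" using uv ynz by (simp add: t_def)
    ultimately show "z \<in> (*) t ` loc A P" by blast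
  next
    fix z assume "z \<in> (*) t ` loc A P"
    then obtain u v where uv: "u \<in> A" "v \<in> A" "v \<notin> P" "z = t * (u / v)" by (auto simp: loc_def)
    then have "z = u * c / (c * y * v)" by (simp add: t)
    moreover have "u * c \<in> P" using Pid c uv by (auto simp: is_ideal_def)
    moreover have "c * y * v \<in> A" "c * y * v \<notin> P"
      using cA uv c prime_compl_mult[OF Pp] mult_in by auto
    ultimately show "z \<in> {a / b | a b. a \<in> P \<and> b \<in> A \<and> b \<notin> P}" by blast
  qed
  have "dvr (loc A P) t"
    by (rule dvr_of_noeth[OF field_subring_loc[OF Pp] noeth_loc[OF noe Pp] _ nu])
      (use ynz frac subset_loc[OF Pp] in \<open>auto simp: t_def, blast\<close>)
  moreover have "x \<notin> loc A P"
  proof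
    assume "x \<in> loc A P"
    then obtain u v where uv: "u \<in> A" "v \<in> A" "v \<notin> P" "x = u / v" by (auto simp: loc_def)
    then have "v * y = r * u" using r not_in_prime_nonzero[OF Pp] by simp
    then have "v \<in> P" using uv r by (auto simp: y C_def mult_in)
    then show False using uv by simp
  qed
  moreover have "P \<noteq> {0}" using bP ab by auto
  ultimately show thesis using that Pp by blast
qed

text \<open>The members of S need not be minimal over I, so in the induction two such sets may
  simply be united.\<close>

definition primes_over :: "'k set \<Rightarrow> 'k set set \<Rightarrow> bool" where
  "primes_over I S \<longleftrightarrow> finite S \<and> (\<forall>P\<in>S. is_prime A P \<and> I \<subseteq> P) \<and>
    (\<forall>Q. is_prime A Q \<and> I \<subseteq> Q \<longrightarrow> (\<exists>P\<in>S. P \<subseteq> Q))"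

lemma primes_overD:
  assumes "primes_over I S"
  shows "finite S" "\<And>P. P \<in> S \<Longrightarrow> is_prime A P" "\<And>P. P \<in> S \<Longrightarrow> I \<subseteq> P"
    "\<And>Q. is_prime A Q \<Longrightarrow> I \<subseteq> Q \<Longrightarrow> \<exists>P\<in>S. P \<subseteq> Q"
  using assms by (simp_all add: primes_over_def)

text \<open>Noetherian induction. A maximal counterexample M is neither the unit ideal nor prime, so
  a b \<in> M for some a, b \<notin> M. A prime over M contains M + A a or M + A b, and these larger
  ideals are not counterexamples.\<close>

lemma finite_primes_over_ideal:
  assumes noe: "noeth A" and I: "is_ideal A I"
  shows "\<exists>S. primes_over I S"
proof (rule ccontr)
  assume "\<nexists>S. primes_over I S"
  then have "{J. is_ideal A J \<and> (\<nexists>S. primes_over J S)} \<noteq> {}" using I by blast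
  then obtain M where "M \<in> {J. is_ideal A J \<and> (\<nexists>S. primes_over J S)}"
      and max: "\<And>J. J \<in> {J. is_ideal A J \<and> (\<nexists>S. primes_over J S)} \<Longrightarrow> M \<subseteq> J \<Longrightarrow> J = M"
    by (rule noethE[OF noe]) blast+
  then have M: "is_ideal A M" "\<nexists>S. primes_over M S" by simp_all
  have "1 \<notin> M"
  proof
    assume "1 \<in> M"
    then have "primes_over M {}" by (auto simp: primes_over_def is_prime_def)
    then show False using M(2) by blast
  qed
  moreover have "\<not> is_prime A M"
  proof
    assume "is_prime A M"
    then have "primes_over M {M}" by (simp add: primes_over_def)
    then show False using M(2) by blast
  qed
  ultimately obtain a b where ab: "a \<in> A" "b \<in> A" "a * b \<in> M" "a \<notin> M" "b \<notin> M"
    using M(1) by (auto simp: is_prime_def)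
  define J where "J = ideal_adjoin A M"
  note J = ideal_adjoin[OF M(1), folded J_def]
  have good: "\<exists>S. primes_over (J c) S" if c: "c \<in> A" "c \<notin> M" for c
  proof (rule ccontr)
    assume "\<nexists>S. primes_over (J c) S"
    then have "J c \<in> {J. is_ideal A J \<and> (\<nexists>S. primes_over J S)}" using J(1)[OF c(1)] by blast
    then have "J c = M" by (rule max[OF _ J(2)[OF c(1)]])
    then show False using J(3)[OF c(1)] c(2) by blast
  qed
  obtain S where "primes_over (J a) S" using good[OF ab(1,4)] by (rule exE)
  note S = primes_overD[OF this]
  obtain T where "primes_over (J b) T" using good[OF ab(2,5)] by (rule exE)
  note T = primes_overD[OF this]
  have "\<exists>P\<in>S \<union> T. P \<subseteq> Q" if Q: "is_prime A Q" "M \<subseteq> Q" for Q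
  proof -
    note QI = prime_ideal[OF Q(1)]
    have JQ: "J c \<subseteq> Q" if "c \<in> Q" "c \<in> A" for c
      using Q(2) that by (auto simp: J_def ideal_adjoin_def intro!: ideal_add[OF QI] ideal_mult[OF QI])
    have "a \<in> Q \<or> b \<in> Q" using Q ab unfolding is_prime_def by blast
    then show ?thesis
    proof
      assume "a \<in> Q"
      from S(4)[OF Q(1) JQ[OF this ab(1)]] show ?thesis by (rule bexE) (intro bexI UnI1)
    next
      assume "b \<in> Q"
      from T(4)[OF Q(1) JQ[OF this ab(2)]] show ?thesis by (rule bexE) (intro bexI UnI2)
    qed
  qed
  moreover have "is_prime A P \<and> M \<subseteq> P" if "P \<in> S \<union> T" for P
    using that S(2,3)[of P] T(2,3)[of P] J(2)[OF ab(1)] J(2)[OF ab(2)] by blast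
  ultimately have "primes_over M (S \<union> T)"
    unfolding primes_over_def using S(1) T(1) by (intro conjI ballI allI impI finite_UnI) blast+
  then show False using M(2) by blast
qed

text \<open>The zero ideal also satisfies this; it drops out wherever a nonzero element of Q is
  required.\<close>

definition height_one :: "'k set \<Rightarrow> bool" where
  "height_one Q \<longleftrightarrow> is_prime A Q \<and> (\<forall>P. is_prime A P \<and> P \<subseteq> Q \<longrightarrow> P = {0} \<or> P = Q)"

text \<open>A height-one prime through f contains one of the finitely many primes found over A f;
  that one is nonzero and hence equal to it.\<close>

lemma finite_height_one_primes:
  assumes noe: "noeth A" and f: "f \<in> A" "f \<noteq> 0"
  shows "finite {Q. height_one Q \<and> f \<in> Q}"
proof -
  note J = ideal_adjoin[OF is_ideal_zero f(1)]
  obtain S where "primes_over (ideal_adjoin A {0} f) S"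
    using finite_primes_over_ideal[OF noe J(1)] by (rule exE)
  note S = primes_overD[OF this]
  have mem: "Q \<in> S" if Q: "height_one Q" "f \<in> Q" for Q
  proof -
    have Qp: "is_prime A Q" using Q(1) by (simp add: height_one_def)
    have "ideal_adjoin A {0} f \<subseteq> Q"
      unfolding ideal_adjoin_def using ideal_mult[OF prime_ideal[OF Qp] _ Q(2)] by auto
    from S(4)[OF Qp this] obtain P where P: "P \<in> S" "P \<subseteq> Q" by (rule bexE)
    have "P \<noteq> {0}" using S(3)[OF P(1)] J(3) f(2) by blast
    then show ?thesis using Q(1) S(2)[OF P(1)] P by (auto simp: height_one_def)
  qed
  have "{Q. height_one Q \<and> f \<in> Q} \<subseteq> S"
    by (intro subsetI mem) simp_all
  then show ?thesis using S(1) by (rule finite_subset)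
qed

end

section \<open>Local structure of a normal Noetherian integral scheme\<close>

lemma ord_at_val: "ord_at Y y g = val (stalk Y y) g"
  unfolding ord_at_def val_def ..

locale nscheme =
  fixes p :: nat and Y :: "('a, 'k::field) int_scheme"
  assumes standing: "standing p Y"
begin

abbreviation "X \<equiv> topspace (pts Y)"
abbreviation "PD \<equiv> prime_divs Y"
abbreviation "gp \<equiv> generic_point Y"
abbreviation "cl y \<equiv> (pts Y) closure_of {y}"

lemma char: "CHAR('k) = p"
  using standing by (simp add: standing_def)

lemma int: "integral_scheme Y"
  using standing by (simp add: standing_def)

lemmas int_rules = int[unfolded integral_scheme_def, THEN conjunct2]

lemma nopen_Int: "nopen Y U \<Longrightarrow> nopen Y V \<Longrightarrow> nopen Y (U \<inter> V)"
  using int_rules[THEN conjunct1, rule_format, of U V] by (auto simp: nopen_def)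

lemma reg_field_subring: "nopen Y U \<Longrightarrow> field_subring (reg Y U)"
  using int_rules[THEN conjunct2, THEN conjunct1, rule_format] by (rule field_subringI)

lemma reg_mono: "nopen Y U \<Longrightarrow> nopen Y V \<Longrightarrow> U \<subseteq> V \<Longrightarrow> reg Y V \<subseteq> reg Y U"
  using int_rules[THEN conjunct2, THEN conjunct2, THEN conjunct1] by simp

lemma glue: "C \<noteq> {} \<Longrightarrow> (\<And>U. U \<in> C \<Longrightarrow> nopen Y U) \<Longrightarrow> (\<Inter>U\<in>C. reg Y U) \<subseteq> reg Y (\<Union>C)"
  using int_rules[THEN conjunct2, THEN conjunct2, THEN conjunct2, THEN conjunct1] by simp

lemma reg_UNIV: "\<exists>U. nopen Y U \<and> g \<in> reg Y U"
proof -
  have "\<Union>{reg Y U | U. nopen Y U} = UNIV"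
    using int by (simp add: integral_scheme_def)
  then have "g \<in> \<Union>{reg Y U | U. nopen Y U}" by simp
  then show ?thesis by blast
qed

lemma affine_cover: "y \<in> X \<Longrightarrow> \<exists>U. affine_open Y U \<and> y \<in> U"
  using int by (simp add: integral_scheme_def)

lemma nopen_sub: "nopen Y U \<Longrightarrow> U \<subseteq> X"
  by (auto simp: nopen_def openin_subset)

lemma nopenI: "openin (pts Y) U \<Longrightarrow> y \<in> U \<Longrightarrow> nopen Y U"
  by (auto simp: nopen_def)

lemma affine_nopen: "affine_open Y U \<Longrightarrow> nopen Y U"
  by (simp add: affine_open_def)

lemma stalk_iff: "g \<in> stalk Y y \<longleftrightarrow> (\<exists>U. nopen Y U \<and> y \<in> U \<and> g \<in> reg Y U)"
  by (auto simp: stalk_def nopen_def)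

lemma stalkI: "nopen Y U \<Longrightarrow> y \<in> U \<Longrightarrow> g \<in> reg Y U \<Longrightarrow> g \<in> stalk Y y"
  unfolding stalk_iff by blast

lemma stalkE:
  assumes "g \<in> stalk Y y"
  obtains U where "nopen Y U" "y \<in> U" "g \<in> reg Y U"
  using assms unfolding stalk_iff by blast

lemma field_subring_stalk:
  assumes "y \<in> X"
  shows "field_subring (stalk Y y)"
proof
  have X: "nopen Y X" using assms by (intro nopenI) auto
  interpret R: field_subring "reg Y X" by (rule reg_field_subring[OF X])
  show "0 \<in> stalk Y y" "1 \<in> stalk Y y"
    by (rule stalkI[OF X assms], simp)+
  fix a b assume "a \<in> stalk Y y" "b \<in> stalk Y y"
  then obtain U V where U: "nopen Y U" "y \<in> U" "a \<in> reg Y U" and V: "nopen Y V" "y \<in> V" "b \<in> reg Y V"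
    by (elim stalkE)
  have n: "nopen Y (U \<inter> V)" by (rule nopen_Int[OF U(1) V(1)])
  have UV: "nopen Y (U \<inter> V)" "y \<in> U \<inter> V" "a \<in> reg Y (U \<inter> V)" "b \<in> reg Y (U \<inter> V)"
    using n U V reg_mono[OF n U(1)] reg_mono[OF n V(1)] by auto
  interpret S: field_subring "reg Y (U \<inter> V)" by (rule reg_field_subring[OF UV(1)])
  show "a + b \<in> stalk Y y" "a * b \<in> stalk Y y" "- a \<in> stalk Y y"
    by (rule stalkI[OF UV(1,2)], intro S.add_in S.mult_in S.minus_in UV(3,4))+
qed

lemma in_cl: "y \<in> X \<Longrightarrow> y \<in> cl z \<longleftrightarrow> (\<forall>V. openin (pts Y) V \<and> y \<in> V \<longrightarrow> z \<in> V)"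
  by (auto simp: in_closure_of)

lemma cl_open: "y \<in> cl z \<Longrightarrow> openin (pts Y) V \<Longrightarrow> y \<in> V \<Longrightarrow> z \<in> V"
  by (simp add: in_closure_of)

text \<open>A function regular at all points of U is regular on the members of a cover of U by small
  open sets, and so it glues.\<close>

lemma reg_eq:
  assumes U: "nopen Y U"
  shows "reg Y U = (\<Inter>y\<in>U. stalk Y y)"
proof
  show "reg Y U \<subseteq> (\<Inter>y\<in>U. stalk Y y)"
    by (intro subsetI INT_I) (rule stalkI[OF U])
  show "(\<Inter>y\<in>U. stalk Y y) \<subseteq> reg Y U"
  proof
    fix g assume g: "g \<in> (\<Inter>y\<in>U. stalk Y y)"
    define C where "C = {V. nopen Y V \<and> V \<subseteq> U \<and> g \<in> reg Y V}"
    have V: "\<exists>V\<in>C. y \<in> V" if y: "y \<in> U" for y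
    proof -
      obtain V where V: "nopen Y V" "y \<in> V" "g \<in> reg Y V"
        using INT_D[OF g y] by (rule stalkE)
      then have n: "nopen Y (U \<inter> V)" using nopen_Int U by blast
      then have "g \<in> reg Y (U \<inter> V)" using reg_mono[OF n V(1)] V by auto
      then show ?thesis unfolding C_def using n V y by blast
    qed
    then have "\<Union>C = U" unfolding C_def by blast
    moreover have "C \<noteq> {}" using V U by (auto simp: nopen_def)
    then have "(\<Inter>V\<in>C. reg Y V) \<subseteq> reg Y (\<Union>C)"
      by (rule glue) (simp add: C_def)
    moreover have "g \<in> (\<Inter>V\<in>C. reg Y V)" by (simp add: C_def)
    ultimately show "g \<in> reg Y U" by auto
  qed
qed

end

section \<open>The spectrum and affine charts\<close>

lemma topspace_Spec_top:
  assumes "field_subring A"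
  shows "topspace (Spec_top A) = {P. is_prime A P}"
proof -
  interpret field_subring A by fact
  have "\<Union>{basic_open A f | f. f \<in> A} = {P. is_prime A P}"
  proof
    show "{P. is_prime A P} \<subseteq> \<Union>{basic_open A f | f. f \<in> A}"
    proof
      fix P assume "P \<in> {P. is_prime A P}"
      then have "P \<in> basic_open A 1" by (auto simp: basic_open_def primeideal_ring_on is_prime_def)
      then show "P \<in> \<Union>{basic_open A f | f. f \<in> A}"
        by (rule UnionI[rotated]) (use one_in in \<open>auto simp only: mem_Collect_eq\<close>)
    qed
  qed (auto simp: basic_open_def primeideal_ring_on)
  then show ?thesis by (simp add: Spec_top_def)
qed

text \<open>Induction over the generation of the topology: D(f) \<inter> D(g) = D(f g) makes the
  generating family a basis.\<close>

lemma openin_Spec_top_basic: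
  assumes "field_subring A" and G: "openin (Spec_top A) G" and P: "P \<in> G"
  shows "\<exists>f\<in>A. f \<notin> P \<and> (\<forall>Q. is_prime A Q \<and> f \<notin> Q \<longrightarrow> Q \<in> G)"
proof -
  interpret field_subring A by fact
  have "generate_topology_on {basic_open A f | f. f \<in> A} G"
    using G unfolding Spec_top_def by (rule openin_topology_generated_by)
  moreover have Pp: "is_prime A P"
    using openin_subset[OF G] P topspace_Spec_top[OF assms(1)] by auto
  ultimately show ?thesis using P
  proof (induction rule: generate_topology_on.induct)
    case (Int a b)
    have Pab: "P \<in> a" "P \<in> b" using Int.prems by simp_all
    obtain f where f: "f \<in> A" "f \<notin> P" "\<forall>Q. is_prime A Q \<and> f \<notin> Q \<longrightarrow> Q \<in> a"
      using Int.IH(1)[OF Pp Pab(1)] by (elim bexE conjE)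
    obtain g where g: "g \<in> A" "g \<notin> P" "\<forall>Q. is_prime A Q \<and> g \<notin> Q \<longrightarrow> Q \<in> b"
      using Int.IH(2)[OF Pp Pab(2)] by (elim bexE conjE)
    have "f * g \<notin> P" by (rule prime_compl_mult[OF Pp f(1) g(1) f(2) g(2)])
    moreover have "Q \<in> a \<inter> b" if "is_prime A Q" "f * g \<notin> Q" for Q
    proof -
      have I: "is_ideal A Q" using that by (simp add: is_prime_def)
      have "f \<notin> Q" using that ideal_mult[OF I, of g f] g by (auto simp: mult.commute)
      moreover have "g \<notin> Q" using that ideal_mult[OF I, of f g] f by auto
      ultimately show ?thesis using f(3) g(3) that by simp
    qed
    ultimately show ?case by (intro bexI[of _ "f * g"] mult_in f g conjI allI impI) simp_all
  next
    case (UN K)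
    then obtain k where k: "k \<in> K" "P \<in> k" by blast
    then have "k \<subseteq> \<Union>K" by blast
    then show ?case using UN.IH[OF k(1) Pp k(2)] by (elim bexE conjE) (intro bexI conjI allI impI, auto)
  next
    case (Basis s)
    then obtain f where f: "s = basic_open A f" "f \<in> A" by (simp only: mem_Collect_eq) (elim exE conjE)
    have "f \<notin> P" using Basis.prems f(1) by (simp add: basic_open_def)
    then show ?case using f(2)
      by (intro bexI[of _ f]) (simp_all add: f(1) basic_open_def primeideal_ring_on)
  qed simp
qed

locale affine_chart = nscheme p Y for p and Y :: "('a, 'k::field) int_scheme" +
  fixes U :: "'a set"
  assumes aff: "affine_open Y U"
begin

abbreviation "A \<equiv> reg Y U"

definition pr :: "'a \<Rightarrow> 'k set" where "pr y = A \<inter> nonunits (stalk Y y)"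

lemma nopenU: "nopen Y U"
  using aff by (rule affine_nopen)

sublocale field_subring A
  by (rule reg_field_subring[OF nopenU])

lemma U_sub: "U \<subseteq> X"
  by (rule nopen_sub[OF nopenU])

lemma homeo: "homeomorphic_map (subtopology (pts Y) U) (Spec_top A) pr"
  using aff by (simp add: affine_open_def pr_def[abs_def])

lemma top_sub: "topspace (subtopology (pts Y) U) = U"
  using U_sub by auto

lemma pr_inj: "inj_on pr U"
  using homeomorphic_imp_injective_map[OF homeo] top_sub by simp

lemma pr_image: "pr ` U = {P. is_prime A P}"
  using homeomorphic_imp_surjective_map[OF homeo] topspace_Spec_top[OF field_subring_axioms] top_sub
  by simp

lemma pr_prime: "y \<in> U \<Longrightarrow> is_prime A (pr y)"
  using pr_image by blast

lemma pr_ex: "is_prime A P \<Longrightarrow> \<exists>y\<in>U. pr y = P"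
  using pr_image by (metis image_iff mem_Collect_eq)

lemma open_D:
  assumes "f \<in> A"
  shows "openin (pts Y) {z \<in> U. f \<notin> pr z}"
proof -
  have "openin (Spec_top A) (basic_open A f)"
    unfolding Spec_top_def using assms by (intro topology_generated_by_Basis) blast
  moreover have "continuous_map (subtopology (pts Y) U) (Spec_top A) pr"
    by (rule homeomorphic_imp_continuous_map[OF homeo])
  ultimately have "openin (subtopology (pts Y) U)
      {x \<in> topspace (subtopology (pts Y) U). pr x \<in> basic_open A f}"
    by (rule openin_continuous_map_preimage[rotated])
  moreover have "{x \<in> topspace (subtopology (pts Y) U). pr x \<in> basic_open A f} = {z \<in> U. f \<notin> pr z}"
    using pr_prime U_sub by (auto simp: basic_open_def primeideal_ring_on)
  ultimately show ?thesis
    using nopenU by (auto simp: nopen_def intro: openin_trans_full)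
qed

lemma ex_D:
  assumes V: "openin (pts Y) V" "y \<in> V" "y \<in> U"
  obtains f where "f \<in> A" "f \<notin> pr y" "{z \<in> U. f \<notin> pr z} \<subseteq> V"
proof -
  have "openin (subtopology (pts Y) U) (U \<inter> V)"
    using V by (simp add: openin_subtopology_Int2)
  then have "openin (Spec_top A) (pr ` (U \<inter> V))"
    using homeomorphic_imp_open_map[OF homeo] by (auto simp: open_map_def)
  moreover have "pr y \<in> pr ` (U \<inter> V)" using V by blast
  ultimately obtain f where f: "f \<in> A" "f \<notin> pr y" "\<forall>Q. is_prime A Q \<and> f \<notin> Q \<longrightarrow> Q \<in> pr ` (U \<inter> V)"
    using openin_Spec_top_basic[OF field_subring_axioms] by meson
  have "{z \<in> U. f \<notin> pr z} \<subseteq> V"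
  proof
    fix z assume z: "z \<in> {z \<in> U. f \<notin> pr z}"
    then have "pr z \<in> pr ` (U \<inter> V)" using f pr_prime by simp
    then show "z \<in> V" using pr_inj z by (auto dest: inj_onD)
  qed
  then show thesis using that f by blast
qed

lemma reg_D:
  assumes "f \<in> A" "f \<noteq> 0"
  shows "reg Y {z \<in> U. f \<notin> pr z} = {a / f ^ n | a n. a \<in> A}"
proof -
  have "{z \<in> U. f \<notin> pr z} = {z \<in> U. f \<notin> nonunits (stalk Y z)}"
    using assms by (auto simp: pr_def)
  then show ?thesis using aff assms by (simp add: affine_open_def)
qed

lemma A_sub_stalk: "y \<in> U \<Longrightarrow> A \<subseteq> stalk Y y"
  by (intro subsetI) (rule stalkI[OF nopenU])

text \<open>A germ at y is regular on some basic open set of an f \<notin> \<open>pr y\<close>,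
  where sections are fractions with denominator a power of f. Conversely, elements of A outside
  \<open>pr y\<close> are invertible in the stalk by the definition of \<open>pr\<close>.\<close>

lemma stalk_loc:
  assumes y: "y \<in> U"
  shows "stalk Y y = loc A (pr y)"
proof
  note P = pr_prime[OF y]
  show "stalk Y y \<subseteq> loc A (pr y)"
  proof
    fix a assume "a \<in> stalk Y y"
    then obtain V where V: "nopen Y V" "y \<in> V" "a \<in> reg Y V" by (rule stalkE)
    then have "openin (pts Y) V" by (simp add: nopen_def)
    from this V(2) y obtain f where f: "f \<in> A" "f \<notin> pr y" "{z \<in> U. f \<notin> pr z} \<subseteq> V" by (rule ex_D)
    have fnz: "f \<noteq> 0" using not_in_prime_nonzero[OF P f(2)] .
    have n: "nopen Y {z \<in> U. f \<notin> pr z}"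
      using open_D[OF f(1)] y f(2) by (auto simp: nopen_def)
    have "a \<in> reg Y {z \<in> U. f \<notin> pr z}" using reg_mono[OF n V(1) f(3)] V(3) by blast
    then obtain c m where c: "c \<in> A" "a = c / f ^ m" using reg_D[OF f(1) fnz] by blast
    show "a \<in> loc A (pr y)" unfolding c(2)
      by (rule loc_intro[OF c(1) power_in[OF f(1)] prime_power[OF P f(1,2)]])
  qed
  show "loc A (pr y) \<subseteq> stalk Y y"
  proof
    interpret S: field_subring "stalk Y y" by (rule field_subring_stalk) (use y U_sub in auto)
    fix x assume "x \<in> loc A (pr y)"
    then obtain a b where ab: "a \<in> A" "b \<in> A" "b \<notin> pr y" "x = a / b" by (auto simp: loc_def)
    then have "inverse b \<in> stalk Y y" using A_sub_stalk[OF y] by (auto simp: pr_def nonunits_def)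
    moreover have "a \<in> stalk Y y" using ab A_sub_stalk[OF y] by blast
    ultimately show "x \<in> stalk Y y" using S.mult_in ab by (simp add: divide_inverse)
  qed
qed

lemma cl_iff:
  assumes "y \<in> U" "z \<in> U"
  shows "y \<in> cl z \<longleftrightarrow> pr z \<subseteq> pr y"
proof
  assume yz: "y \<in> cl z"
  show "pr z \<subseteq> pr y"
  proof
    fix f assume f: "f \<in> pr z"
    then have fA: "f \<in> A" by (simp add: pr_def)
    show "f \<in> pr y"
    proof (rule ccontr)
      assume "f \<notin> pr y"
      then have "y \<in> {z \<in> U. f \<notin> pr z}" using assms by simp
      then have "z \<in> {z \<in> U. f \<notin> pr z}" by (rule cl_open[OF yz open_D[OF fA]])
      then show False using f by simp
    qed
  qed
next
  assume sub: "pr z \<subseteq> pr y"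
  have "z \<in> V" if V: "openin (pts Y) V" "y \<in> V" for V
  proof -
    obtain f where "f \<in> A" "f \<notin> pr y" "{z \<in> U. f \<notin> pr z} \<subseteq> V"
      using ex_D[OF V assms(1)] .
    then show ?thesis using sub assms by blast
  qed
  then show "y \<in> cl z" using assms U_sub by (auto simp: in_closure_of)
qed

lemma cl_in_U: "y \<in> U \<Longrightarrow> y \<in> cl z \<Longrightarrow> z \<in> U"
  using nopenU cl_open[of y z U] by (simp add: nopen_def)

lemma ex_generic:
  obtains z where "z \<in> U" "pr z = {0}" "\<forall>V. nopen Y V \<longrightarrow> z \<in> V"
    "\<forall>y. y \<in> X \<and> (\<forall>V. nopen Y V \<longrightarrow> y \<in> V) \<longrightarrow> y = z"
proof -
  obtain z where z: "z \<in> U" "pr z = {0}" using pr_ex[OF is_prime_zero] by blast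
  have 1: "z \<in> V" if V: "nopen Y V" for V
  proof -
    have "U \<inter> V \<noteq> {}" using nopen_Int[OF nopenU V] by (simp add: nopen_def)
    then obtain y where y: "y \<in> V" "y \<in> U" by blast
    have "openin (pts Y) V" using V by (simp add: nopen_def)
    then obtain f where f: "f \<in> A" "f \<notin> pr y" "{z \<in> U. f \<notin> pr z} \<subseteq> V"
      using y by (rule ex_D)
    have "f \<noteq> 0" using not_in_prime_nonzero[OF pr_prime[OF y(2)] f(2)] .
    then show ?thesis using z f by auto
  qed
  have 2: "y = z" if "y \<in> X" "\<And>V. nopen Y V \<Longrightarrow> y \<in> V" for y
  proof -
    have y: "y \<in> U" using that(2)[OF nopenU] .
    have "pr y \<subseteq> {0}"
    proof
      fix f assume f: "f \<in> pr y"
      then have fA: "f \<in> A" by (simp add: pr_def)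
      show "f \<in> {0}"
      proof (rule ccontr)
        assume "f \<notin> {0}"
        then have "nopen Y {z \<in> U. f \<notin> pr z}" using z open_D[OF fA] by (auto simp: nopen_def)
        from that(2)[OF this] show False using f by simp
      qed
    qed
    moreover have "0 \<in> pr y" using pr_prime[OF y] by (simp add: is_prime_def is_ideal_def)
    ultimately have "pr y = pr z" unfolding z(2) by blast
    then show ?thesis using inj_onD[OF pr_inj _ y z(1)] by simp
  qed
  show thesis
    by (rule that[OF z]) (use 1 2 in simp_all)
qed

end

section \<open>The generic point\<close>

context nscheme
begin

lemma chart: "affine_open Y U \<Longrightarrow> affine_chart p Y U"
  by unfold_locales

lemma X_nonempty: "X \<noteq> {}"
  using int by (simp add: integral_scheme_def)

lemma cl_univ_iff: "cl z = X \<longleftrightarrow> (\<forall>V. nopen Y V \<longrightarrow> z \<in> V)"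
proof
  assume c: "cl z = X"
  show "\<forall>V. nopen Y V \<longrightarrow> z \<in> V"
  proof (intro allI impI)
    fix V assume V: "nopen Y V"
    then obtain y where y: "y \<in> V" by (auto simp: nopen_def)
    have "y \<in> cl z" unfolding c using nopen_sub[OF V] y by (rule subsetD)
    moreover have "openin (pts Y) V" using V by (simp add: nopen_def)
    ultimately show "z \<in> V" using y by (rule cl_open)
  qed
next
  assume z: "\<forall>V. nopen Y V \<longrightarrow> z \<in> V"
  have "y \<in> cl z" if y: "y \<in> X" for y
    unfolding in_cl[OF y]
    by (intro allI impI, elim conjE, rule z[rule_format], rule nopenI)
  then show "cl z = X" by (intro subset_antisym[OF closure_of_subset_topspace] subsetI)
qed

lemma generic_unique:
  "\<exists>z. z \<in> X \<and> cl z = X \<and> (\<forall>y. y \<in> X \<and> cl y = X \<longrightarrow> y = z)"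
proof -
  obtain U where "affine_open Y U" using X_nonempty affine_cover by blast
  then interpret affine_chart p Y U by (rule chart)
  obtain z where z: "z \<in> U" "pr z = {0}" "\<forall>V. nopen Y V \<longrightarrow> z \<in> V"
    "\<forall>y. y \<in> X \<and> (\<forall>V. nopen Y V \<longrightarrow> y \<in> V) \<longrightarrow> y = z"
    by (rule ex_generic)
  show ?thesis
    unfolding cl_univ_iff
  proof (intro exI[of _ z] conjI allI impI)
    show "z \<in> X" using z(1) U_sub by blast
    show "y = z" if "y \<in> X \<and> (\<forall>V. nopen Y V \<longrightarrow> y \<in> V)" for y
      using that by (rule z(4)[THEN spec, THEN mp])
    show "z \<in> V" if "nopen Y V" for V
      using that by (rule z(3)[THEN spec, THEN mp])
  qed
qed

lemma gp_eq: "z \<in> X \<Longrightarrow> cl z = X \<Longrightarrow> gp = z"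
  unfolding generic_point_def using generic_unique by (intro the_equality conjI) metis+

lemma gp: "gp \<in> X" "cl gp = X"
proof -
  obtain z where "z \<in> X" "cl z = X" using generic_unique by (elim exE conjE)
  then show "gp \<in> X" "cl gp = X" using gp_eq by simp_all
qed

lemma gp_in: "nopen Y V \<Longrightarrow> gp \<in> V"
  using gp(2) cl_univ_iff by blast

lemma stalk_gp: "stalk Y gp = UNIV"
proof -
  have "g \<in> stalk Y gp" for g
    using reg_UNIV[of g] gp_in stalkI by metis
  then show ?thesis by blast
qed

end

section \<open>Codimension one and discrete valuation rings\<close>

context affine_chart
begin

lemma pr_gp: "pr gp = {0}"
proof -
  obtain z where z: "z \<in> U" "pr z = {0}" "\<forall>V. nopen Y V \<longrightarrow> z \<in> V"
    by (rule ex_generic)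
  have "gp = z"
  proof (rule gp_eq)
    show "z \<in> X" using z(1) U_sub by blast
    show "cl z = X" unfolding cl_univ_iff by (rule z(3))
  qed
  then show ?thesis using z by simp
qed

lemma frac: "\<exists>a b. a \<in> A \<and> b \<in> A \<and> b \<noteq> 0 \<and> g = a / b"
proof -
  have "g \<in> loc A (pr gp)"
    using stalk_loc[OF gp_in[OF nopenU]] stalk_gp by simp
  then show ?thesis unfolding pr_gp loc_def mem_Collect_eq by (elim exE conjE) (intro exI conjI, auto)
qed

lemma noeth_A: "noeth A"
  using standing aff by (intro noethI) (simp add: standing_def locally_noetherian_def)

lemma noeth_stalk: "y \<in> U \<Longrightarrow> noeth (stalk Y y)"
  by (simp add: stalk_loc noeth_loc[OF noeth_A pr_prime])

lemma normal_stalk: "y \<in> U \<Longrightarrow> integrally_closed (stalk Y y)"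
  using standing U_sub by (auto simp: standing_def normal_scheme_def)

text \<open>Normality is a condition on stalks, so \<open>exists_dvr_loc\<close> is applied to the
  stalk at y. The prime found there contracts to a prime of A inside \<open>pr y\<close>, that is,
  to a generization z of y, and localising twice gives the stalk at z.\<close>

lemma ex_dvr:
  assumes y: "y \<in> U" and g: "g \<notin> stalk Y y"
  obtains z t where "z \<in> U" "y \<in> cl z" "z \<noteq> gp" "dvr (stalk Y z) t" "g \<notin> stalk Y z"
proof -
  interpret S: field_subring "stalk Y y" by (rule field_subring_stalk) (use y U_sub in auto)
  note P = pr_prime[OF y]
  have fr: "\<exists>a b. a \<in> stalk Y y \<and> b \<in> stalk Y y \<and> b \<noteq> 0 \<and> g = a / b" for g
  proof -
    obtain a b where "a \<in> A" "b \<in> A" "b \<noteq> 0" "g = a / b" using frac[of g] by (elim exE conjE)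
    then show ?thesis using A_sub_stalk[OF y] by (intro exI[of _ a] exI[of _ b]) auto
  qed
  obtain Q t where Q: "is_prime (stalk Y y) Q" "Q \<noteq> {0}" "dvr (loc (stalk Y y) Q) t"
      "g \<notin> loc (stalk Y y) Q"
    by (rule S.exists_dvr_loc[OF noeth_stalk[OF y] normal_stalk[OF y] fr g])
  note Q' = Q(1)[unfolded stalk_loc[OF y]]
  note C = prime_contract[OF P Q']
  obtain z where z: "z \<in> U" "pr z = Q \<inter> A" using pr_ex[OF C(1)] by blast
  have sz: "stalk Y z = loc (stalk Y y) Q"
    unfolding stalk_loc[OF z(1)] z(2) C(3) stalk_loc[OF y] ..
  have "y \<in> cl z" using cl_iff[OF y z(1)] z(2) C(2) by simp
  moreover have "z \<noteq> gp"
  proof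
    assume "z = gp"
    then have "Q \<inter> A = {0}" using z pr_gp by simp
    then have "Q \<subseteq> {0}"
      using loc_contract(2)[OF P prime_ideal[OF Q']] by auto
    moreover have "0 \<in> Q" using Q(1) by (simp add: is_prime_def is_ideal_def)
    ultimately show False using Q(2) by blast
  qed
  ultimately show thesis using that[OF z(1)] Q(3,4) sz by simp
qed

lemma dvr_prime_div:
  assumes z: "z \<in> U" "z \<noteq> gp" "dvr (stalk Y z) t"
  shows "z \<in> PD"
  unfolding prime_divs_def
proof (intro CollectI conjI ballI impI z(2))
  show "z \<in> X" using z U_sub by auto
  fix w assume w: "w \<in> X" "z \<in> cl w"
  then have wU: "w \<in> U" using cl_in_U z by blast
  then have "pr w \<subseteq> pr z" using cl_iff[OF z(1)] w by blast
  then have "pr w = {0} \<or> pr w = pr z"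
    using dvr_loc_height_one[OF pr_prime[OF z(1)] z(3)[unfolded stalk_loc[OF z(1)]] pr_prime[OF wU]]
    by blast
  then show "w = z \<or> w = gp"
    using pr_inj pr_gp wU z gp_in[OF nopenU] by (auto dest: inj_onD)
qed

lemma height_one_pr:
  assumes x: "x \<in> PD" "x \<in> U"
  shows "height_one (pr x)"
  unfolding height_one_def
proof (intro conjI allI impI pr_prime[OF x(2)], elim conjE)
  fix P assume P: "is_prime A P" "P \<subseteq> pr x"
  obtain z where z: "z \<in> U" "pr z = P" using pr_ex[OF P(1)] by blast
  then have "x \<in> cl z" using cl_iff[OF x(2) z(1)] P by simp
  then have "z = x \<or> z = gp" using x(1) z U_sub by (auto simp: prime_divs_def)
  then show "P = {0} \<or> P = pr x" using z pr_gp by auto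
qed

lemma pr_nonzero:
  assumes "y \<in> U" "y \<noteq> gp"
  obtains c where "c \<in> pr y" "c \<noteq> 0"
proof -
  have "pr y \<noteq> {0}"
    using pr_inj pr_gp assms gp_in[OF nopenU] by (auto dest: inj_onD)
  moreover have "0 \<in> pr y" using pr_prime[OF assms(1)] by (simp add: is_prime_def is_ideal_def)
  ultimately show thesis using that by blast
qed

end

context nscheme
begin

lemma PD_X: "x \<in> PD \<Longrightarrow> x \<in> X"
  by (simp add: prime_divs_def)

lemma PD_cl: "x \<in> PD \<Longrightarrow> x \<in> cl z \<Longrightarrow> z \<in> X \<Longrightarrow> z = x \<or> z = gp"
  by (simp add: prime_divs_def)

text \<open>For a nonzero c in the prime of x, 1/c is not regular at x. The valuation ring that
  detects this is the stalk at a generization of x other than the generic point, which can only be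
  x.\<close>

lemma ex_dvr_at:
  assumes "x \<in> PD"
  shows "\<exists>t. dvr (stalk Y x) t"
proof -
  obtain U where U: "affine_open Y U" "x \<in> U" using affine_cover[OF PD_X[OF assms]] by (elim exE conjE)
  interpret affine_chart p Y U by (rule chart) fact
  have xg: "x \<noteq> gp" using assms by (simp add: prime_divs_def)
  obtain c where c: "c \<in> pr x" "c \<noteq> 0" using pr_nonzero[OF U(2) xg] .
  then have "inverse c \<notin> stalk Y x" by (simp add: pr_def nonunits_def)
  then obtain z t where z: "z \<in> U" "x \<in> cl z" "z \<noteq> gp" "dvr (stalk Y z) t" "inverse c \<notin> stalk Y z"
    by (rule ex_dvr[OF U(2)])
  then have "z = x" using PD_cl assms U_sub by blast
  then show ?thesis using z by blast
qed

definition unif :: "'a \<Rightarrow> 'k" where "unif x = (SOME t. dvr (stalk Y x) t)"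

lemma dvr_unif: "x \<in> PD \<Longrightarrow> dvr_ring (stalk Y x) (unif x)"
  unfolding unif_def dvr_ring_def using ex_dvr_at by (metis someI_ex)

lemma hartogs_stalk:
  assumes "y \<in> X" "g \<notin> stalk Y y"
  obtains x where "x \<in> PD" "y \<in> cl x" "g \<notin> stalk Y x"
proof -
  obtain U where U: "affine_open Y U" "y \<in> U" using affine_cover[OF assms(1)] by (elim exE conjE)
  interpret affine_chart p Y U by (rule chart) fact
  obtain z t where z: "z \<in> U" "y \<in> cl z" "z \<noteq> gp" "dvr (stalk Y z) t" "g \<notin> stalk Y z"
    using assms(2) by (rule ex_dvr[OF U(2)])
  from dvr_prime_div[OF z(1,3,4)] z(2,5) show thesis by (rule that)
qed

lemma zero_stalk: "x \<in> PD \<Longrightarrow> 0 \<in> stalk Y x"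
  using field_subring.zero_in[OF field_subring_stalk] PD_X by blast

lemma zero_reg: "nopen Y U \<Longrightarrow> 0 \<in> reg Y U"
  using field_subring.zero_in[OF reg_field_subring] by blast

text \<open>If g is not regular at y \<in> U, it is not regular at some codimension-one point
  specializing to y, and this point lies in U because U is open.\<close>

lemma reg_iff:
  assumes U: "nopen Y U"
  shows "g \<in> reg Y U \<longleftrightarrow> (\<forall>x\<in>U \<inter> PD. g \<in> stalk Y x)"
proof
  assume r: "\<forall>x\<in>U \<inter> PD. g \<in> stalk Y x"
  have "g \<in> stalk Y y" if y: "y \<in> U" for y
  proof (rule ccontr)
    assume n: "g \<notin> stalk Y y"
    have "y \<in> X" using y nopen_sub[OF U] by blast
    then obtain x where x: "x \<in> PD" "y \<in> cl x" "g \<notin> stalk Y x"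
      using n by (rule hartogs_stalk)
    moreover have "x \<in> U" using cl_open[OF x(2) _ y] U by (simp add: nopen_def)
    ultimately show False using r by simp
  qed
  then show "g \<in> reg Y U" unfolding reg_eq[OF U] by simp
qed (simp add: reg_eq[OF U])

lemma ord_mult: "x \<in> PD \<Longrightarrow> a \<noteq> 0 \<Longrightarrow> b \<noteq> 0 \<Longrightarrow> ord_at Y x (a * b) = ord_at Y x a + ord_at Y x b"
  unfolding ord_at_val using dvr_ring.val_mult[OF dvr_unif] by blast

lemma ord_one: "x \<in> PD \<Longrightarrow> ord_at Y x 1 = 0"
  unfolding ord_at_val using dvr_ring.val_one[OF dvr_unif] by blast

lemma ord_inverse: "x \<in> PD \<Longrightarrow> a \<noteq> 0 \<Longrightarrow> ord_at Y x (inverse a) = - ord_at Y x a"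
  unfolding ord_at_val using dvr_ring.val_inverse[OF dvr_unif] by blast

lemma ord_divide: "x \<in> PD \<Longrightarrow> a \<noteq> 0 \<Longrightarrow> b \<noteq> 0 \<Longrightarrow> ord_at Y x (a / b) = ord_at Y x a - ord_at Y x b"
  unfolding ord_at_val using dvr_ring.val_divide[OF dvr_unif] by blast

lemma ord_power: "x \<in> PD \<Longrightarrow> a \<noteq> 0 \<Longrightarrow> ord_at Y x (a ^ n) = int n * ord_at Y x a"
  unfolding ord_at_val using dvr_ring.val_power[OF dvr_unif] by blast

lemma ord_unif: "x \<in> PD \<Longrightarrow> ord_at Y x (unif x powi n) = n"
  unfolding ord_at_val using dvr_ring.val_t_powi[OF dvr_unif] by blast

lemma unif_nz: "x \<in> PD \<Longrightarrow> unif x powi n \<noteq> 0"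
  using dvr_ring.t_nz[OF dvr_unif] by simp

lemma stalk_iff_ord: "x \<in> PD \<Longrightarrow> a \<noteq> 0 \<Longrightarrow> a \<in> stalk Y x \<longleftrightarrow> ord_at Y x a \<ge> 0"
  unfolding ord_at_val using dvr_ring.mem_iff_val[OF dvr_unif] by blast

lemma nonunits_iff_ord: "x \<in> PD \<Longrightarrow> a \<noteq> 0 \<Longrightarrow> a \<in> nonunits (stalk Y x) \<longleftrightarrow> ord_at Y x a \<ge> 1"
  unfolding ord_at_val using dvr_ring.nonunits_iff_val[OF dvr_unif] by blast

text \<open>On a chart g = a / b, and a prime divisor at which g has nonzero order corresponds to a
  height-one prime containing a or b.\<close>

lemma locally_finite:
  assumes y: "y \<in> X" and g: "g \<noteq> 0"
  shows "\<exists>U. openin (pts Y) U \<and> y \<in> U \<and> finite {x \<in> U \<inter> PD. ord_at Y x g \<noteq> 0}"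
proof -
  obtain U where U: "affine_open Y U" "y \<in> U" using affine_cover[OF y] by (elim exE conjE)
  interpret affine_chart p Y U by (rule chart) fact
  obtain a b where ab: "a \<in> A" "b \<in> A" "b \<noteq> 0" "g = a / b" using frac[of g] by (elim exE conjE)
  then have a0: "a \<noteq> 0" using g by auto
  have fin: "finite ({Q. height_one Q \<and> a \<in> Q} \<union> {Q. height_one Q \<and> b \<in> Q})"
    using finite_height_one_primes[OF noeth_A ab(1) a0] finite_height_one_primes[OF noeth_A ab(2,3)]
    by (rule finite_UnI)
  have "pr ` {x \<in> U \<inter> PD. ord_at Y x g \<noteq> 0} \<subseteq> {Q. height_one Q \<and> a \<in> Q} \<union> {Q. height_one Q \<and> b \<in> Q}"
  proof
    fix P assume "P \<in> pr ` {x \<in> U \<inter> PD. ord_at Y x g \<noteq> 0}"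
    then obtain x where x: "P = pr x" "x \<in> U" "x \<in> PD" "ord_at Y x g \<noteq> 0" by blast
    have "ord_at Y x a \<noteq> 0 \<or> ord_at Y x b \<noteq> 0"
      using x ord_divide[OF x(3) a0 ab(3)] ab(4) by auto
    moreover have "f \<in> pr x" if "f \<in> A" "f \<noteq> 0" "ord_at Y x f \<noteq> 0" for f
    proof -
      have "f \<in> stalk Y x" using A_sub_stalk[OF x(2)] that by blast
      then have "ord_at Y x f \<ge> 1" using stalk_iff_ord[OF x(3) that(2)] that(3) by linarith
      then show ?thesis using nonunits_iff_ord[OF x(3) that(2)] that(1) by (simp add: pr_def)
    qed
    ultimately have "a \<in> pr x \<or> b \<in> pr x" using ab a0 by blast
    then show "P \<in> {Q. height_one Q \<and> a \<in> Q} \<union> {Q. height_one Q \<and> b \<in> Q}"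
      unfolding x(1) using height_one_pr[OF x(3,2)] by simp
  qed
  then have "finite (pr ` {x \<in> U \<inter> PD. ord_at Y x g \<noteq> 0})" using fin by (rule finite_subset)
  moreover have "inj_on pr {x \<in> U \<inter> PD. ord_at Y x g \<noteq> 0}"
    using pr_inj by (rule inj_on_subset) blast
  ultimately have "finite {x \<in> U \<inter> PD. ord_at Y x g \<noteq> 0}" by (rule finite_imageD)
  then show ?thesis using U nopenU by (intro exI[of _ U]) (simp add: nopen_def)
qed

lemma avoid_finite:
  assumes y: "y \<in> X" and F: "finite F" "\<And>z. z \<in> F \<Longrightarrow> y \<notin> cl z"
  obtains V where "openin (pts Y) V" "y \<in> V" "V \<inter> F \<inter> X = {}"
proof
  show "openin (pts Y) (X - (\<Union>z\<in>F. cl z))"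
    using F by (intro openin_diff closedin_Union) auto
  show "y \<in> X - (\<Union>z\<in>F. cl z)" using y F by blast
  have "z \<in> cl z" if "z \<in> X" for z using that by (simp add: in_closure_of)
  then show "(X - (\<Union>z\<in>F. cl z)) \<inter> F \<inter> X = {}" by blast
qed

lemma PD_not_cl_gp: "z \<in> PD \<Longrightarrow> gp \<notin> cl z"
proof
  assume z: "z \<in> PD" "gp \<in> cl z"
  have "z \<in> V" if "nopen Y V" for V
  proof (rule cl_open[OF z(2) _ gp_in[OF that]])
    show "openin (pts Y) V" using that by (simp add: nopen_def)
  qed
  then have "gp = z" using gp_eq[OF PD_X[OF z(1)]] cl_univ_iff by simp
  then show False using z by (auto simp: prime_divs_def)
qed

end

section \<open>Sections of divisorial sheaves\<close>

context nscheme
begin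

lemma PD_neq_cl: "x \<in> PD \<Longrightarrow> z \<in> PD \<Longrightarrow> z \<noteq> x \<Longrightarrow> x \<notin> cl z"
  using PD_cl[of x z] PD_X[of z] by (auto simp: prime_divs_def)

lemma div_sheaf_mono: "V' \<subseteq> V \<Longrightarrow> div_sheaf Y D V \<subseteq> div_sheaf Y D V'"
  unfolding div_sheaf_def by auto

lemma zero_div_sheaf: "0 \<in> div_sheaf Y D V"
  by (simp add: div_sheaf_def)

lemma div_sheaf_iff:
  "g \<noteq> 0 \<Longrightarrow> g \<in> div_sheaf Y D V \<longleftrightarrow> (\<forall>x \<in> V \<inter> PD. of_int (ord_at Y x g) + D x \<ge> 0)"
  by (simp add: div_sheaf_def)

lemma div_sheaf_zero:
  assumes "nopen Y V"
  shows "div_sheaf Y (\<lambda>_. 0) V = reg Y V"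
proof (rule Set.set_eqI)
  fix g
  show "g \<in> div_sheaf Y (\<lambda>_. 0) V \<longleftrightarrow> g \<in> reg Y V"
    using stalk_iff_ord zero_reg[OF assms]
    by (cases "g = 0") (simp_all add: reg_iff[OF assms] div_sheaf_iff zero_div_sheaf)
qed

lemma isolate:
  assumes y: "y \<in> X" and B: "B \<subseteq> PD" "\<And>z. z \<in> B \<Longrightarrow> y \<notin> cl z"
    and U: "openin (pts Y) U" "y \<in> U" "finite (U \<inter> B)"
  obtains V where "nopen Y V" "y \<in> V" "V \<subseteq> U" "V \<inter> B = {}"
proof -
  obtain V where V: "openin (pts Y) V" "y \<in> V" "V \<inter> (U \<inter> B) \<inter> X = {}"
    by (rule avoid_finite[OF y U(3)]) (use B(2) in auto)
  have "openin (pts Y) (U \<inter> V)" using U(1) V(1) by (rule openin_Int)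
  then have "nopen Y (U \<inter> V)" using U(2) V(2) by (intro nopenI) auto
  moreover have "U \<inter> V \<inter> B = {}" using V(3) B(1) PD_X by blast
  ultimately show thesis using that[of "U \<inter> V"] U(2) V(2) by simp
qed

lemma Q_divisor_PD: "Q_divisor Y D \<Longrightarrow> y \<notin> PD \<Longrightarrow> D y = 0"
  by (simp add: Q_divisor_def)

lemma Q_divisor_finite:
  "Q_divisor Y D \<Longrightarrow> y \<in> X \<Longrightarrow> \<exists>U. openin (pts Y) U \<and> y \<in> U \<and> finite {x \<in> U. D x \<noteq> 0}"
  by (simp add: Q_divisor_def)

lemma Weil_Q_divisor: "Weil_divisor Y D \<Longrightarrow> Q_divisor Y D"
  by (simp add: Weil_divisor_def)

lemma Weil_Ints: "Weil_divisor Y D \<Longrightarrow> D y \<in> \<int>"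
  by (simp add: Weil_divisor_def)

lemma Q_divisor_principal:
  assumes "g \<noteq> 0"
  shows "Q_divisor Y (principal Y g)"
  unfolding Q_divisor_def
proof (intro conjI allI impI ballI)
  fix y assume y: "y \<in> X"
  obtain U where U: "openin (pts Y) U" "y \<in> U" "finite {x \<in> U \<inter> PD. ord_at Y x g \<noteq> 0}"
    using locally_finite[OF y assms] by (elim exE conjE)
  have "{x \<in> U. principal Y g x \<noteq> 0} \<subseteq> {x \<in> U \<inter> PD. ord_at Y x g \<noteq> 0}"
    by (auto simp: principal_def split: if_splits)
  then have "finite {x \<in> U. principal Y g x \<noteq> 0}" using U(3) by (rule finite_subset)
  then show "\<exists>U. openin (pts Y) U \<and> y \<in> U \<and> finite {x \<in> U. principal Y g x \<noteq> 0}"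
    using U by (intro exI[of _ U]) simp
qed (simp add: principal_def)

lemma Q_divisor_add:
  assumes "Q_divisor Y D" "Q_divisor Y D'"
  shows "Q_divisor Y (\<lambda>y. a * D y + b * D' y)"
  unfolding Q_divisor_def
proof (intro conjI allI impI ballI)
  fix y assume y: "y \<in> X"
  obtain U where U: "openin (pts Y) U" "y \<in> U" "finite {x \<in> U. D x \<noteq> 0}"
    using Q_divisor_finite[OF assms(1) y] by (elim exE conjE)
  obtain U' where U': "openin (pts Y) U'" "y \<in> U'" "finite {x \<in> U'. D' x \<noteq> 0}"
    using Q_divisor_finite[OF assms(2) y] by (elim exE conjE)
  have "{x \<in> U \<inter> U'. a * D x + b * D' x \<noteq> 0} \<subseteq> {x \<in> U. D x \<noteq> 0} \<union> {x \<in> U'. D' x \<noteq> 0}"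
    by auto
  then have "finite {x \<in> U \<inter> U'. a * D x + b * D' x \<noteq> 0}"
    using U(3) U'(3) by (meson finite_UnI finite_subset)
  then show "\<exists>U. openin (pts Y) U \<and> y \<in> U \<and> finite {x \<in> U. a * D x + b * D' x \<noteq> 0}"
    using U U' by (intro exI[of _ "U \<inter> U'"]) (simp add: openin_Int)
qed (simp add: Q_divisor_PD assms)

text \<open>The prime divisors at which g violates the inequality are locally finite and none of
  them passes through y, so their closures can be removed from a neighbourhood.\<close>

lemma div_sheaf_nbhd:
  assumes D: "Q_divisor Y D" and g: "g \<noteq> 0" and y: "y \<in> X"
    and pos: "\<And>z. z \<in> PD \<Longrightarrow> y \<in> cl z \<Longrightarrow> of_int (ord_at Y z g) + D z \<ge> 0"
  obtains V where "nopen Y V" "y \<in> V" "g \<in> div_sheaf Y D V"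
proof -
  define B where "B = {z \<in> PD. of_int (ord_at Y z g) + D z < 0}"
  have QD: "Q_divisor Y (\<lambda>x. principal Y g x + D x)"
    using Q_divisor_add[OF Q_divisor_principal[OF g] D, of 1 1] by simp
  obtain U where U: "openin (pts Y) U" "y \<in> U" "finite {x \<in> U. principal Y g x + D x \<noteq> 0}"
    using Q_divisor_finite[OF QD y] by (elim exE conjE)
  have "U \<inter> B \<subseteq> {x \<in> U. principal Y g x + D x \<noteq> 0}"
    by (auto simp: B_def principal_def)
  then have fin: "finite (U \<inter> B)" using U(3) by (rule finite_subset)
  have nB: "y \<notin> cl z" if "z \<in> B" for z using that pos[of z] by (auto simp: B_def)
  have "B \<subseteq> PD" by (auto simp: B_def)
  then obtain V where V: "nopen Y V" "y \<in> V" "V \<inter> B = {}"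
    using isolate[OF y _ nB U(1,2) fin] by blast
  have "g \<in> div_sheaf Y D V"
    unfolding div_sheaf_iff[OF g]
  proof
    fix x assume "x \<in> V \<inter> PD"
    then have "x \<notin> B" "x \<in> PD" using V(3) by auto
    then show "0 \<le> of_int (ord_at Y x g) + D x" by (simp add: B_def)
  qed
  then show thesis using V that by simp
qed

lemma div_sheaf_nbhd_PD:
  assumes D: "Q_divisor Y D" and g: "g \<noteq> 0" and x: "x \<in> PD"
    and pos: "of_int (ord_at Y x g) + D x \<ge> 0"
  obtains V where "nopen Y V" "x \<in> V" "g \<in> div_sheaf Y D V"
proof (rule div_sheaf_nbhd[OF D g PD_X[OF x]])
  fix z assume "z \<in> PD" "x \<in> cl z"
  then have "z = x" using PD_neq_cl[OF x] by blast
  then show "of_int (ord_at Y z g) + D z \<ge> 0" using pos by simp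
qed (rule that)

text \<open>No prime divisor passes through the generic point. In this way statements about sheaves
  over open sets are carried to the whole function field.\<close>

lemma div_sheaf_nbhd_gp:
  assumes D: "Q_divisor Y D"
  obtains V where "nopen Y V" "g \<in> div_sheaf Y D V"
proof (cases "g = 0")
  case True
  have "nopen Y X" using gp(1) by (intro nopenI) auto
  then show ?thesis using that zero_div_sheaf True by simp
next
  case False
  show ?thesis
    by (rule div_sheaf_nbhd[OF D False gp(1)]) (use PD_not_cl_gp that in auto)
qed

section \<open>Orders of maps from Frobenius push-forwards\<close>

text \<open>The value a = 0 is left out because \<open>ord_at\<close> has no meaning there.\<close>

definition lower :: "'a \<Rightarrow> ('k \<Rightarrow> 'k) \<Rightarrow> int \<Rightarrow> bool" where
  "lower x \<psi> m \<longleftrightarrow> (\<forall>a. a \<noteq> 0 \<and> ord_at Y x a \<ge> - m \<longrightarrow> \<psi> a \<in> stalk Y x)"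

text \<open>A relation, since an order need not exist; the zero map has none. The value r is
  rational so that it can be compared directly with expressions in K, \<Delta> and L.\<close>

definition vord :: "'a \<Rightarrow> ('k \<Rightarrow> 'k) \<Rightarrow> rat \<Rightarrow> bool" where
  "vord x \<psi> r \<longleftrightarrow> r \<in> \<int> \<and> (\<forall>m. lower x \<psi> m \<longleftrightarrow> of_int m \<le> r)"

lemma lowerD: "lower x \<psi> m \<Longrightarrow> a \<noteq> 0 \<Longrightarrow> ord_at Y x a \<ge> - m \<Longrightarrow> \<psi> a \<in> stalk Y x"
  by (simp add: lower_def)

lemma lower_antimono: "lower x \<psi> m \<Longrightarrow> m' \<le> m \<Longrightarrow> lower x \<psi> m'"
  unfolding lower_def by (meson dual_order.trans neg_le_iff_le)

lemma vord_unique: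
  assumes "vord x \<psi> r" "vord x \<psi> s"
  shows "r = s"
proof -
  have "of_int m \<le> r \<longleftrightarrow> of_int m \<le> s" for m :: int
    using assms by (simp add: vord_def)
  moreover obtain m n :: int where "r = of_int m" "s = of_int n"
    using assms by (auto simp: vord_def elim!: Ints_cases)
  ultimately show ?thesis by (metis antisym order_refl)
qed

lemma vord_precompose:
  assumes x: "x \<in> PD" and c: "c \<noteq> 0" and r: "vord x \<psi> r"
  shows "vord x (\<lambda>a. \<psi> (c * a)) (r + of_int (ord_at Y x c))"
proof -
  have eq: "lower x (\<lambda>a. \<psi> (c * a)) m \<longleftrightarrow> lower x \<psi> (m - ord_at Y x c)" for m
  proof
    assume l: "lower x (\<lambda>a. \<psi> (c * a)) m"
    show "lower x \<psi> (m - ord_at Y x c)"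
      unfolding lower_def
    proof (intro allI impI, elim conjE)
      fix a assume a: "a \<noteq> 0" "ord_at Y x a \<ge> - (m - ord_at Y x c)"
      have "\<psi> (c * (a / c)) \<in> stalk Y x"
        using l by (rule lowerD) (use a c x in \<open>auto simp: ord_divide\<close>)
      then show "\<psi> a \<in> stalk Y x" using c by simp
    qed
  next
    assume l: "lower x \<psi> (m - ord_at Y x c)"
    show "lower x (\<lambda>a. \<psi> (c * a)) m"
      unfolding lower_def
    proof (intro allI impI, elim conjE)
      fix a assume a: "a \<noteq> 0" "ord_at Y x a \<ge> - m"
      show "\<psi> (c * a) \<in> stalk Y x"
        using l by (rule lowerD) (use a c x in \<open>auto simp: ord_mult\<close>)
    qed
  qed
  show ?thesis using r unfolding vord_def eq by (auto simp: algebra_simps)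
qed

lemma frob_linear_zero: "frob_linear p e \<psi> \<Longrightarrow> \<psi> 0 = 0"
  unfolding frob_linear_def by (metis add_cancel_right_right)

lemma frob_linear_scale: "frob_linear p e \<psi> \<Longrightarrow> \<psi> (a ^ (p ^ e) * x) = a * \<psi> x"
  by (simp add: frob_linear_def)

lemma frob_linear_comp:
  assumes "frob_linear p e \<phi>" "frob_linear p e' \<phi>'"
  shows "frob_linear p (e + e') (\<lambda>a. \<phi> (\<phi>' a))"
proof -
  have "\<phi> (\<phi>' (a ^ (p ^ (e + e')) * x)) = a * \<phi> (\<phi>' x)" for a x
  proof -
    have "a ^ (p ^ (e + e')) = (a ^ (p ^ e)) ^ (p ^ e')"
      by (simp add: power_add power_mult)
    then show ?thesis using assms by (simp add: frob_linear_scale)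
  qed
  then show ?thesis using assms unfolding frob_linear_def by simp
qed

text \<open>For u = t^n, linearity gives \<phi>'(a) = u^-1 \<phi>'(u^(p^e') a). A factor of order n
  outside \<phi>' costs order p^e' n inside, whence the weight of n.\<close>

lemma lower_comp:
  assumes x: "x \<in> PD" and \<phi>: "frob_linear p e \<phi>" "lower x \<phi> n"
    and \<phi>': "frob_linear p e' \<phi>'" "lower x \<phi>' n'"
  shows "lower x (\<lambda>a. \<phi> (\<phi>' a)) (int p ^ e' * n + n')"
  unfolding lower_def
proof (intro allI impI, elim conjE)
  fix a assume a: "a \<noteq> 0" "ord_at Y x a \<ge> - (int p ^ e' * n + n')"
  define u where "u = unif x powi n"
  have u: "u \<noteq> 0" "ord_at Y x u = n" unfolding u_def using unif_nz[OF x] ord_unif[OF x] by auto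
  define b where "b = u ^ (p ^ e') * a"
  have b: "b \<noteq> 0" "ord_at Y x b \<ge> - n'"
    using a u x by (auto simp: b_def ord_mult ord_power)
  have ab: "a = inverse u ^ (p ^ e') * b"
    using u by (simp add: b_def field_simps)
  have "\<phi>' a = inverse u * \<phi>' b"
    unfolding ab by (rule frob_linear_scale[OF \<phi>'(1)])
  moreover have "\<phi>' b \<in> stalk Y x" using lowerD[OF \<phi>'(2)] b by blast
  ultimately have "\<phi>' a = 0 \<or> (\<phi>' a \<noteq> 0 \<and> ord_at Y x (\<phi>' a) \<ge> - n)"
    using u x stalk_iff_ord[OF x, of "\<phi>' b"] by (auto simp: ord_mult ord_inverse)
  then show "\<phi> (\<phi>' a) \<in> stalk Y x"
  proof
    assume "\<phi>' a = 0"
    then show ?thesis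
      using frob_linear_zero[OF \<phi>(1)] zero_stalk[OF x]
      by simp
  next
    assume "\<phi>' a \<noteq> 0 \<and> ord_at Y x (\<phi>' a) \<ge> - n"
    then show ?thesis using lowerD[OF \<phi>(2)] by blast
  qed
qed

text \<open>To see that the bound of \<open>lower_comp\<close> is sharp, two witnesses are combined:
  if \<phi>'(b) and \<phi>(c) are not regular, b is rescaled by a p^e'-th power so that \<phi>'
  sends it to c.\<close>

lemma vord_comp:
  assumes x: "x \<in> PD" and \<phi>: "frob_linear p e \<phi>" "vord x \<phi> r"
    and \<phi>': "frob_linear p e' \<phi>'" "vord x \<phi>' r'"
  shows "vord x (\<lambda>a. \<phi> (\<phi>' a)) (of_nat p ^ e' * r + r')"
proof -
  obtain n n' where n: "r = of_int n" "r' = of_int n'"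
    using \<phi>(2) \<phi>'(2) by (auto simp: vord_def elim!: Ints_cases)
  have low: "lower x \<phi> m \<longleftrightarrow> m \<le> n" "lower x \<phi>' m \<longleftrightarrow> m \<le> n'" for m
    using \<phi>(2) \<phi>'(2) by (simp_all add: vord_def n)
  define N where "N = int p ^ e' * n + n'"
  have "lower x (\<lambda>a. \<phi> (\<phi>' a)) N"
    unfolding N_def by (rule lower_comp[OF x \<phi>(1) _ \<phi>'(1)]) (simp_all add: low)
  moreover have "\<not> lower x (\<lambda>a. \<phi> (\<phi>' a)) (N + 1)"
  proof
    assume l: "lower x (\<lambda>a. \<phi> (\<phi>' a)) (N + 1)"
    have "\<not> lower x \<phi>' (n' + 1)" "\<not> lower x \<phi> (n + 1)" by (simp_all add: low)
    then obtain b c where b: "b \<noteq> 0" "ord_at Y x b \<ge> - (n' + 1)" "\<phi>' b \<notin> stalk Y x"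
      and c: "c \<noteq> 0" "ord_at Y x c \<ge> - (n + 1)" "\<phi> c \<notin> stalk Y x"
      by (auto simp: lower_def)
    have nz: "\<phi>' b \<noteq> 0"
      using b(3) zero_stalk[OF x] by auto
    have ob: "ord_at Y x (\<phi>' b) \<le> - 1"
      using stalk_iff_ord[OF x nz] b(3) by linarith
    define d where "d = c / \<phi>' b"
    \<comment> \<open>The pole of \<phi>'(b) has order at least 1, which improves the bound -(n+1)
      for c to -n for d.\<close>
    have d: "d \<noteq> 0" "ord_at Y x d \<ge> - n"
      using nz c ob x by (auto simp: d_def ord_divide)
    have "int p ^ e' * ord_at Y x d \<ge> int p ^ e' * (- n)"
      using d(2) by (rule mult_left_mono) simp
    then have "ord_at Y x (d ^ (p ^ e') * b) \<ge> - (N + 1)"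
      using d b x by (simp add: ord_mult ord_power N_def)
    then have "\<phi> (\<phi>' (d ^ (p ^ e') * b)) \<in> stalk Y x"
      using lowerD[OF l] d b by simp
    moreover have "\<phi>' (d ^ (p ^ e') * b) = c"
      using frob_linear_scale[OF \<phi>'(1)] nz by (simp add: d_def)
    ultimately show False using c by simp
  qed
  ultimately have "lower x (\<lambda>a. \<phi> (\<phi>' a)) m \<longleftrightarrow> m \<le> N" for m
    using lower_antimono[of x "\<lambda>a. \<phi> (\<phi>' a)"] by (metis linorder_not_le zless_add1_eq not_less_iff_gr_or_eq zle_add1_eq_le)
  moreover have "of_nat p ^ e' * r + r' = of_int N" by (simp add: n N_def)
  ultimately show ?thesis by (simp add: vord_def)
qed

section \<open>Finiteness of Frobenius\<close>

lemma frob_linear_sum: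
  assumes "frob_linear p e \<psi>"
  shows "\<psi> (sum f S) = (\<Sum>s\<in>S. \<psi> (f s))"
proof (induction S rule: infinite_finite_induct)
  case (insert a S)
  then show ?case using assms by (simp add: frob_linear_def)
qed (simp_all add: frob_linear_zero[OF assms])

end

context affine_chart
begin

text \<open>S stands for generators of A as a module over its p^e-th powers. Only their effect is
  recorded: values of \<psi> on S in a ring over A force all values on A into that ring.\<close>

definition frob_test :: "nat \<Rightarrow> 'k set \<Rightarrow> bool" where
  "frob_test e S \<longleftrightarrow> (\<forall>\<psi> B. frob_linear p e \<psi> \<and> field_subring B \<and> A \<subseteq> B \<and>
    (\<forall>s\<in>S. \<psi> s \<in> B) \<longrightarrow> (\<forall>a\<in>A. \<psi> a \<in> B))"

lemma frob_testD:
  "frob_test e S \<Longrightarrow> frob_linear p e \<psi> \<Longrightarrow> field_subring B \<Longrightarrow> A \<subseteq> B \<Longrightarrow>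
    (\<And>s. s \<in> S \<Longrightarrow> \<psi> s \<in> B) \<Longrightarrow> a \<in> A \<Longrightarrow> \<psi> a \<in> B"
  by (simp add: frob_test_def)

text \<open>F-finiteness concerns exponent 1. Elements of A are sums of c^p s, and x -> \<psi>(x^p
  s) has exponent e when \<psi> has exponent e+1, additivity being the freshman's dream. So the
  products t^p s serve for the next exponent.\<close>

lemma frob_test_set:
  assumes p: "prime p"
  shows "\<exists>S. finite S \<and> S \<subseteq> A \<and> frob_test e S"
proof (induction e)
  case 0
  show ?case
    unfolding frob_test_def
  proof (intro exI[of _ "{1}"] conjI allI impI ballI)
    fix \<psi> :: "'k \<Rightarrow> 'k" and B a
    assume *: "frob_linear p 0 \<psi> \<and> field_subring B \<and> A \<subseteq> B \<and> (\<forall>s\<in>{1}. \<psi> s \<in> B)" and a: "a \<in> A"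
    have "\<psi> (a ^ (p ^ 0) * 1) = a * \<psi> 1" by (rule frob_linear_scale) (use * in simp)
    moreover have "a * \<psi> 1 \<in> B" using * a by (intro field_subring.mult_in) auto
    ultimately show "\<psi> a \<in> B" by simp
  qed auto
next
  case (Suc e)
  then obtain T where T: "finite T" "T \<subseteq> A" "frob_test e T" by (elim exE conjE)
  obtain S where S: "finite S" "S \<subseteq> A" "A = {\<Sum>s\<in>S. c s ^ p * s | c. \<forall>s\<in>S. c s \<in> A}"
    using standing aff by (simp add: standing_def F_finite_def) (elim exE conjE allE impE, auto)
  define R where "R = (\<lambda>(t, s). t ^ p * s) ` (T \<times> S)"
  show ?case
    unfolding frob_test_def
  proof (intro exI[of _ R] conjI allI impI ballI)
    show "finite R" unfolding R_def using S(1) T(1) by (intro finite_imageI finite_cartesian_product)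
    show "R \<subseteq> A" unfolding R_def using S(2) T(2) by (auto intro!: mult_in power_in)
    fix \<psi> :: "'k \<Rightarrow> 'k" and B a
    assume *: "frob_linear p (Suc e) \<psi> \<and> field_subring B \<and> A \<subseteq> B \<and> (\<forall>s\<in>R. \<psi> s \<in> B)" and a: "a \<in> A"
    have fl: "frob_linear p (Suc e) \<psi>" and B: "field_subring B" "A \<subseteq> B" and R: "\<And>s. s \<in> R \<Longrightarrow> \<psi> s \<in> B"
      using * by auto
    obtain c where c: "a = (\<Sum>s\<in>S. c s ^ p * s)" "\<forall>s\<in>S. c s \<in> A"
      using a S(3) by blast
    have "\<psi> (c s ^ p * s) \<in> B" if s: "s \<in> S" for s
    proof -
      have fl': "frob_linear p e (\<lambda>x. \<psi> (x ^ p * s))"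
        unfolding frob_linear_def
      proof (intro conjI allI)
        have "(x + y) ^ p = x ^ p + y ^ p" for x y :: 'k
          by (rule freshmans_dream) (use char p in simp_all)
        then show "\<psi> ((x + y) ^ p * s) = \<psi> (x ^ p * s) + \<psi> (y ^ p * s)" for x y
          using fl by (simp add: distrib_right frob_linear_def)
        show "\<psi> ((x ^ (p ^ e) * y) ^ p * s) = x * \<psi> (y ^ p * s)" for x y
        proof -
          have "(x ^ (p ^ e) * y) ^ p * s = x ^ (p ^ Suc e) * (y ^ p * s)"
            by (simp add: power_mult_distrib power_mult[symmetric] mult.commute[of p] mult.assoc)
          then show ?thesis by (simp only: frob_linear_scale[OF fl])
        qed
      qed
      have "\<psi> (t ^ p * s) \<in> B" if "t \<in> T" for t
        using R s that by (auto simp: R_def)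
      then show ?thesis using frob_testD[OF T(3) fl' B] c(2) s by simp
    qed
    then show "\<psi> a \<in> B"
      unfolding c(1) frob_linear_sum[OF fl] by (rule field_subring.sum_in[OF B(1)])
  qed
qed

end

context nscheme
begin

lemma frob_hom_stalk:
  assumes \<psi>: "\<psi> \<in> frob_hom p e Y (\<lambda>_. 0) V" and V: "nopen Y V" "y \<in> V" and a: "a \<in> stalk Y y"
  shows "\<psi> a \<in> stalk Y y"
proof -
  obtain U where U: "nopen Y U" "y \<in> U" "a \<in> reg Y U" using a by (rule stalkE)
  have n: "nopen Y (U \<inter> V)" by (rule nopen_Int[OF U(1) V(1)])
  have "a \<in> reg Y (U \<inter> V)" using reg_mono[OF n U(1)] U(3) by auto
  then have "\<psi> a \<in> reg Y (U \<inter> V)"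
    using \<psi> n div_sheaf_zero[OF n] by (auto simp: frob_hom_def)
  then show ?thesis using U(2) V(2) by (intro stalkI[OF n]) auto
qed

text \<open>By F-finiteness only the finitely many values \<psi>(s) have to be regular near y, and
  they are regular at y by hypothesis.\<close>

lemma frob_hom_nbhd:
  assumes p: "prime p" and fl: "frob_linear p e \<psi>" and y: "y \<in> X"
    and st: "\<And>a. a \<in> stalk Y y \<Longrightarrow> \<psi> a \<in> stalk Y y"
  obtains V where "nopen Y V" "y \<in> V" "\<psi> \<in> frob_hom p e Y (\<lambda>_. 0) V"
proof -
  obtain U where U: "affine_open Y U" "y \<in> U" using affine_cover[OF y] by (elim exE conjE)
  interpret affine_chart p Y U by (rule chart) fact
  obtain S where S: "finite S" "S \<subseteq> A" "frob_test e S"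
    using frob_test_set[OF p, of e] by (elim exE conjE)
  have "\<psi> s \<in> stalk Y y" if "s \<in> S" for s
    using st[of s] that S(2) A_sub_stalk[OF U(2)] by auto
  then have "\<exists>V. nopen Y V \<and> y \<in> V \<and> \<psi> s \<in> reg Y V" if "s \<in> S" for s
    using that unfolding stalk_iff by simp
  then obtain N where N: "nopen Y (N s)" "y \<in> N s" "\<psi> s \<in> reg Y (N s)" if "s \<in> S" for s
    by metis
  define V where "V = U \<inter> (\<Inter>s\<in>S. N s) \<inter> X"
  have "openin (pts Y) (U \<inter> (\<Inter>s\<in>S. N s) \<inter> X)"
  proof (cases "S = {}")
    case True
    then show ?thesis using nopenU by (simp add: nopen_def openin_Int)
  next
    case False
    then have "openin (pts Y) (\<Inter>s\<in>S. N s)"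
      using N(1) S(1) by (intro openin_Inter) (auto simp: nopen_def)
    then show ?thesis using nopenU by (simp add: nopen_def openin_Int)
  qed
  then have nV: "nopen Y V" and yV: "y \<in> V"
    using U(2) N(2) y by (auto simp: V_def intro!: nopenI)
  have stz: "\<psi> a \<in> stalk Y z" if z: "z \<in> V" and a: "a \<in> stalk Y z" for z a
  proof -
    have zU: "z \<in> U" using z by (simp add: V_def)
    interpret B: field_subring "stalk Y z" by (rule field_subring_stalk) (use z in \<open>simp add: V_def\<close>)
    have "\<psi> s \<in> stalk Y z" if s: "s \<in> S" for s
      by (rule stalkI[OF N(1)[OF s] _ N(3)[OF s]]) (use z s in \<open>simp add: V_def\<close>)
    note * = frob_testD[OF S(3) fl B.field_subring_axioms A_sub_stalk[OF zU] this]
    obtain c b where cb: "c \<in> A" "b \<in> A" "b \<notin> pr z" "a = c / b"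
      using a unfolding stalk_loc[OF zU] loc_def mem_Collect_eq by (elim exE conjE)
    have b0: "b \<noteq> 0" using not_in_prime_nonzero[OF pr_prime[OF zU] cb(3)] .
    have q: "p ^ e = Suc (p ^ e - 1)" using prime_gt_0_nat[OF p] by simp
    \<comment> \<open>Only p^e-th powers can be pulled out of \<psi>, so c / b is expanded to the
      denominator b^(p^e).\<close>
    have "a = inverse b ^ (p ^ e) * (c * b ^ (p ^ e - 1))"
      unfolding cb(4) using b0 by (subst (1) q) (simp add: field_simps)
    then have "\<psi> a = inverse b * \<psi> (c * b ^ (p ^ e - 1))"
      using frob_linear_scale[OF fl] by simp
    moreover have "inverse b \<in> stalk Y z"
      using cb(2,3) A_sub_stalk[OF zU] by (auto simp: pr_def nonunits_def)
    moreover have "\<psi> (c * b ^ (p ^ e - 1)) \<in> stalk Y z"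
      using * cb(1,2) by (simp add: mult_in power_in)
    ultimately show ?thesis using B.mult_in by simp
  qed
  have "\<psi> \<in> frob_hom p e Y (\<lambda>_. 0) V"
    unfolding frob_hom_def
  proof (intro CollectI conjI fl allI impI, elim conjE)
    fix V' assume V': "nopen Y V'" "V' \<subseteq> V"
    show "\<psi> ` div_sheaf Y (\<lambda>_. 0) V' \<subseteq> reg Y V'"
      unfolding div_sheaf_zero[OF V'(1)] reg_eq[OF V'(1)] using stz V'(2) by fast
  qed
  then show thesis using that nV yV by simp
qed

end

section \<open>Duality and the divisor of a map\<close>

locale dscheme = nscheme p Y for p and Y :: "('a, 'k::field) int_scheme" +
  fixes K :: "'a \<Rightarrow> rat"
  assumes p: "prime p" and canonical: "canonical_divisor p Y K"
begin

lemma WeilK: "Weil_divisor Y K"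
  using canonical by (simp add: canonical_divisor_def)

lemma duality_ex: "e > 0 \<Longrightarrow> \<exists>T. frob_duality p e Y K T"
  using canonical by (simp add: canonical_divisor_def)

end

locale duality = dscheme p Y K for p and Y :: "('a, 'k::field) int_scheme" and K +
  fixes e :: nat and T :: "'k \<Rightarrow> 'k \<Rightarrow> 'k"
  assumes dual: "frob_duality p e Y K T"
begin

abbreviation "KK \<equiv> (\<lambda>y. (1 - of_nat p ^ e) * K y)"

lemma KK_div: "Q_divisor Y KK"
  using Q_divisor_add[OF Weil_Q_divisor[OF WeilK] Weil_Q_divisor[OF WeilK], of _ 0] by simp

lemma T_mult: "T (a * g) x = T g (a * x)"
  using dual by (simp add: frob_duality_def)

lemma T_bij: "nopen Y U \<Longrightarrow> bij_betw T (div_sheaf Y KK U) (frob_hom p e Y (\<lambda>_. 0) U)"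
  using dual by (simp add: frob_duality_def)

lemma T_hom: "nopen Y U \<Longrightarrow> g \<in> div_sheaf Y KK U \<Longrightarrow> T g \<in> frob_hom p e Y (\<lambda>_. 0) U"
  using T_bij bij_betwE by blast

lemma T_frob_linear: "frob_linear p e (T g)"
proof -
  obtain V where "nopen Y V" "g \<in> div_sheaf Y KK V" by (rule div_sheaf_nbhd_gp[OF KK_div])
  then have "T g \<in> frob_hom p e Y (\<lambda>_. 0) V" by (rule T_hom)
  then show ?thesis by (simp add: frob_hom_def)
qed

lemma T_inj:
  assumes "T g = T g'"
  shows "g = g'"
proof -
  obtain V where V: "nopen Y V" "g \<in> div_sheaf Y KK V" by (rule div_sheaf_nbhd_gp[OF KK_div])
  obtain V' where V': "nopen Y V'" "g' \<in> div_sheaf Y KK V'" by (rule div_sheaf_nbhd_gp[OF KK_div])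
  have n: "nopen Y (V \<inter> V')" by (rule nopen_Int[OF V(1) V'(1)])
  have inj: "inj_on T (div_sheaf Y KK (V \<inter> V'))" using T_bij[OF n] by (rule bij_betw_imp_inj_on)
  have "g \<in> div_sheaf Y KK (V \<inter> V')" "g' \<in> div_sheaf Y KK (V \<inter> V')"
    using V(2) V'(2) div_sheaf_mono[of "V \<inter> V'" V KK] div_sheaf_mono[of "V \<inter> V'" V' KK] by auto
  then show ?thesis by (rule inj_onD[OF inj assms])
qed

text \<open>At the generic point the stalk is the whole field, so every p^-e-linear map preserves
  regular functions over some nonempty open set, where duality applies.\<close>

lemma T_surj:
  assumes "frob_linear p e \<psi>"
  obtains g where "T g = \<psi>"
proof -
  obtain V where V: "nopen Y V" "gp \<in> V" "\<psi> \<in> frob_hom p e Y (\<lambda>_. 0) V"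
    by (rule frob_hom_nbhd[OF p assms gp(1)]) (simp_all add: stalk_gp)
  have "\<psi> \<in> T ` div_sheaf Y KK V"
    using T_bij[OF V(1)] V(3) by (simp add: bij_betw_def)
  then show thesis using that by blast
qed

text \<open>In one direction T(g)(a) = T(a g)(1), where a g is a section of O((1-p^e)K) near x. In
  the other, u = t^-m makes T(u g) preserve the stalk at x; it is then a section of the Hom sheaf
  near x, and bijectivity of T returns u g as a section of O((1-p^e)K).\<close>

lemma lower_T:
  assumes x: "x \<in> PD" and g: "g \<noteq> 0"
  shows "lower x (T g) m \<longleftrightarrow> of_int m \<le> of_int (ord_at Y x g) + (1 - of_nat p ^ e) * K x"
proof
  note fs = field_subring_stalk[OF PD_X[OF x]]
  assume m: "of_int m \<le> of_int (ord_at Y x g) + (1 - of_nat p ^ e) * K x"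
  show "lower x (T g) m"
    unfolding lower_def
  proof (intro allI impI, elim conjE)
    fix a assume a: "a \<noteq> 0" "ord_at Y x a \<ge> - m"
    have "of_int (ord_at Y x (a * g)) + KK x \<ge> 0"
    proof -
      have "of_int (ord_at Y x a) \<ge> (- of_int m :: rat)" using a(2) by linarith
      then show ?thesis using m a g x by (simp add: ord_mult)
    qed
    then obtain V where V: "nopen Y V" "x \<in> V" "a * g \<in> div_sheaf Y KK V"
      using a g by (elim div_sheaf_nbhd_PD[OF KK_div _ x, rotated]) auto
    have "T (a * g) 1 \<in> stalk Y x"
      by (rule frob_hom_stalk[OF T_hom[OF V(1,3)] V(1,2)]) (rule field_subring.one_in[OF fs])
    then show "T g a \<in> stalk Y x" by (simp add: T_mult)
  qed
next
  note fs = field_subring_stalk[OF PD_X[OF x]]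
  assume l: "lower x (T g) m"
  define u where "u = unif x powi (- m)"
  have u: "u \<noteq> 0" "ord_at Y x u = - m" unfolding u_def using unif_nz[OF x] ord_unif[OF x] by auto
  have st: "T (u * g) a \<in> stalk Y x" if a: "a \<in> stalk Y x" for a
  proof (cases "a = 0")
    case True
    then show ?thesis using frob_linear_zero[OF T_frob_linear] zero_stalk[OF x] by simp
  next
    case False
    then have "ord_at Y x a \<ge> 0" using stalk_iff_ord[OF x] a by simp
    then have "T g (u * a) \<in> stalk Y x" using False u x by (intro lowerD[OF l]) (auto simp: ord_mult)
    then show ?thesis by (simp add: T_mult)
  qed
  obtain V where V: "nopen Y V" "x \<in> V" "T (u * g) \<in> frob_hom p e Y (\<lambda>_. 0) V"
    by (rule frob_hom_nbhd[OF p T_frob_linear PD_X[OF x] st])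
  have "T (u * g) \<in> T ` div_sheaf Y KK V"
    using T_bij[OF V(1)] V(3) by (simp add: bij_betw_def)
  then have "u * g \<in> div_sheaf Y KK V" using T_inj by (metis imageE)
  then have "of_int (ord_at Y x (u * g)) + KK x \<ge> 0"
    using u g x V(2) by (simp add: div_sheaf_iff)
  then show "of_int m \<le> of_int (ord_at Y x g) + (1 - of_nat p ^ e) * K x"
    using u g x by (simp add: ord_mult)
qed

lemma vord_T:
  assumes x: "x \<in> PD" and g: "g \<noteq> 0"
  shows "vord x (T g) (of_int (ord_at Y x g) + (1 - of_nat p ^ e) * K x)"
  unfolding vord_def using lower_T[OF assms] Weil_Ints[OF WeilK, of x]
  by (auto intro!: Ints_add Ints_mult Ints_diff Ints_power)

lemma T_zero: "T 0 = (\<lambda>_. 0)"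
proof
  fix x
  show "T 0 x = 0" using T_mult[of 0 0 x] frob_linear_zero[OF T_frob_linear] by simp
qed

lemma T_nonzero:
  assumes "frob_linear p e \<psi>" "\<psi> z \<noteq> 0"
  obtains g where "g \<noteq> 0" "T g = \<psi>"
proof -
  obtain g where g: "T g = \<psi>" using assms(1) by (rule T_surj)
  moreover have "g \<noteq> 0" using g T_zero assms(2) by auto
  ultimately show thesis using that by blast
qed

end

section \<open>Iterates, auxiliary effective divisors, isomorphisms of divisorial sheaves\<close>

context nscheme
begin

lemma lower_id: "x \<in> PD \<Longrightarrow> lower x (\<lambda>a. a) m \<longleftrightarrow> m \<le> 0"
proof
  assume x: "x \<in> PD" and l: "lower x (\<lambda>a. a) m"
  have "unif x powi (- m) \<in> stalk Y x"
    using l by (rule lowerD) (use unif_nz[OF x] ord_unif[OF x] in auto)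
  then show "m \<le> 0"
    using stalk_iff_ord[OF x unif_nz[OF x]] ord_unif[OF x] by simp
next
  assume x: "x \<in> PD" and m: "m \<le> 0"
  show "lower x (\<lambda>a. a) m"
    unfolding lower_def using m stalk_iff_ord[OF x] by simp
qed

lemma vord_id: "x \<in> PD \<Longrightarrow> vord x (\<lambda>a. a) 0"
  by (simp add: vord_def lower_id)

lemma frob_linear_funpow:
  assumes "frob_linear p e \<phi>"
  shows "frob_linear p (e * k) (\<phi> ^^ k)"
proof (induction k)
  case 0
  then show ?case by (simp add: frob_linear_def)
next
  case (Suc k)
  then show ?case using frob_linear_comp[OF assms Suc.IH] by (simp add: comp_def)
qed

text \<open>A nonzero value of a p^-e-linear map can be rescaled to any prescribed value, here to
  z.\<close>

lemma frob_linear_funpow_nonzero: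
  assumes "frob_linear p e \<phi>" "\<phi> z \<noteq> 0"
  shows "\<exists>w. (\<phi> ^^ k) w \<noteq> 0"
proof (induction k)
  case 0
  then show ?case by (auto intro: exI[of _ 1])
next
  case (Suc k)
  then obtain w where w: "(\<phi> ^^ k) w \<noteq> 0" by blast
  define d where "d = z / (\<phi> ^^ k) w"
  have "(\<phi> ^^ k) (d ^ (p ^ (e * k)) * w) = z"
    using frob_linear_scale[OF frob_linear_funpow[OF assms(1), of k]] w by (simp add: d_def)
  then show ?case using assms(2) by (intro exI[of _ "d ^ (p ^ (e * k)) * w"]) simp
qed

lemma vord_funpow:
  assumes x: "x \<in> PD" and \<phi>: "frob_linear p e \<phi>" "vord x \<phi> r"
  shows "vord x (\<phi> ^^ k) (r * (\<Sum>i<k. (of_nat p ^ e) ^ i))"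
proof (induction k)
  case 0
  then show ?case using vord_id[OF x] by (simp add: id_def)
next
  case (Suc k)
  have "vord x (\<lambda>a. \<phi> ((\<phi> ^^ k) a))
      (of_nat p ^ (e * k) * r + r * (\<Sum>i<k. (of_nat p ^ e) ^ i))"
    by (rule vord_comp[OF x \<phi> frob_linear_funpow[OF \<phi>(1)] Suc.IH])
  then show ?case by (simp add: comp_def power_mult algebra_simps)
qed

text \<open>The counterpart of \<open>vord_funpow\<close> for maps of which only a lower bound is
  known, such as the splitting of the generic fibre.\<close>

lemma lower_funpow:
  assumes x: "x \<in> PD" and \<phi>: "frob_linear p e \<phi>" "lower x \<phi> n"
  shows "lower x (\<phi> ^^ k) (n * (\<Sum>i<k. (int p ^ e) ^ i))"
proof (induction k)
  case 0
  then show ?case using lower_id[OF x] by (simp add: id_def)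
next
  case (Suc k)
  have "lower x (\<lambda>a. \<phi> ((\<phi> ^^ k) a)) (int p ^ (e * k) * n + n * (\<Sum>i<k. (int p ^ e) ^ i))"
    by (rule lower_comp[OF x \<phi> frob_linear_funpow[OF \<phi>(1)] Suc.IH])
  then show ?case by (simp add: comp_def power_mult algebra_simps)
qed

text \<open>Supplies the auxiliary divisor G_0 in the definition of \<Delta>_\<phi>: near y, div(g)
  and div(g) + \<Delta> are effective.\<close>

lemma ex_effective:
  assumes \<Delta>: "Q_divisor Y \<Delta>" and y: "y \<in> X"
  obtains U g where "nopen Y U" "y \<in> U" "g \<noteq> 0"
    "\<forall>x\<in>U \<inter> PD. ord_at Y x g \<ge> 0 \<and> of_int (ord_at Y x g) \<ge> - \<Delta> x"
proof -
  obtain U where U: "affine_open Y U" "y \<in> U" using affine_cover[OF y] by (elim exE conjE)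
  interpret affine_chart p Y U by (rule chart) fact
  obtain V where V: "openin (pts Y) V" "y \<in> V" "finite {x \<in> V. \<Delta> x \<noteq> 0}"
    using Q_divisor_finite[OF \<Delta> y] by (elim exE conjE)
  define F where "F = {x \<in> V. \<Delta> x \<noteq> 0} \<inter> U"
  have F: "finite F" unfolding F_def using V(3) by blast
  have FPD: "x \<in> PD" if "x \<in> F" for x using that Q_divisor_PD[OF \<Delta>] by (auto simp: F_def)
  have "\<exists>c. c \<in> A \<and> c \<noteq> 0 \<and> ord_at Y x c \<ge> 1" if x: "x \<in> F" for x
  proof -
    have xU: "x \<in> U" using x by (simp add: F_def)
    have "x \<noteq> gp" using FPD[OF x] by (simp add: prime_divs_def)
    then obtain c where c: "c \<in> pr x" "c \<noteq> 0" by (rule pr_nonzero[OF xU])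
    then have "ord_at Y x c \<ge> 1" using nonunits_iff_ord[OF FPD[OF x]] by (simp add: pr_def)
    then show ?thesis using c by (intro exI[of _ c]) (simp add: pr_def)
  qed
  note pos = this
  have UV: "nopen Y (U \<inter> V)"
    using nopenU V(1,2) U(2) by (intro nopenI[of _ y]) (auto simp: nopen_def openin_Int)
  obtain g where "g \<in> A" "g \<noteq> 0"
    "\<forall>x\<in>U \<inter> V \<inter> PD. ord_at Y x g \<ge> 0 \<and> of_int (ord_at Y x g) \<ge> - \<Delta> x"
  proof (rule ex_bounded_below[OF F])
    show "F \<subseteq> U \<inter> V \<inter> PD" using FPD by (auto simp: F_def)
    show "\<Delta> x \<ge> 0" if "x \<in> U \<inter> V \<inter> PD" "x \<notin> F" for x using that by (simp add: F_def)
    show "ord_at Y x a \<ge> 0" if "x \<in> U \<inter> V \<inter> PD" "a \<in> A" "a \<noteq> 0" for x a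
      using stalk_iff_ord[of x a] A_sub_stalk[of x] that by auto
  qed (use pos ord_mult in auto)
  then show thesis using that[OF UV] U(2) V(2) by simp
qed

lemma eff_Cartier_principal:
  assumes "g \<noteq> 0" "openin (pts Y) U" "\<And>x. x \<in> U \<inter> PD \<Longrightarrow> ord_at Y x g \<ge> 0"
  shows "eff_Cartier_on Y U (principal Y g)"
  unfolding eff_Cartier_on_def Cartier_on_def local_equation_def
  using assms by (auto simp: principal_def)

text \<open>The inclusion is tested on t^(-D x), a generator of O(D) at x.\<close>

lemma div_sheaf_le:
  assumes D: "Weil_divisor Y D" and s: "s \<noteq> 0" and x: "x \<in> PD"
    and sub: "\<And>U a. nopen Y U \<Longrightarrow> a \<in> div_sheaf Y D U \<Longrightarrow> s * a \<in> div_sheaf Y D' U"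
  shows "D x \<le> of_int (ord_at Y x s) + D' x"
proof -
  obtain d where d: "D x = of_int d" using Weil_Ints[OF D] by (auto elim: Ints_cases)
  define u where "u = unif x powi (- d)"
  have u: "u \<noteq> 0" "ord_at Y x u = - d" unfolding u_def using unif_nz[OF x] ord_unif[OF x] by auto
  obtain V where V: "nopen Y V" "x \<in> V" "u \<in> div_sheaf Y D V"
    by (rule div_sheaf_nbhd_PD[OF Weil_Q_divisor[OF D] u(1) x]) (simp_all add: u d)
  have "of_int (ord_at Y x (s * u)) + D' x \<ge> 0"
    using sub[OF V(1,3)] s u x V(2) by (simp add: div_sheaf_iff)
  then show ?thesis using s u x by (simp add: ord_mult d)
qed

lemma div_sheaf_iso_iff:
  assumes D: "Weil_divisor Y D" and D': "Weil_divisor Y D'"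
  shows "div_sheaf_iso Y s D D' \<longleftrightarrow> s \<noteq> 0 \<and> (\<forall>x\<in>PD. D' x = D x - of_int (ord_at Y x s))"
proof (intro iffI conjI ballI; (elim conjE)?)
  assume iso: "div_sheaf_iso Y s D D'"
  then show s: "s \<noteq> 0" by (simp add: div_sheaf_iso_def)
  have im: "div_sheaf Y D' U = (*) s ` div_sheaf Y D U" if "nopen Y U" for U
    using iso that by (simp add: div_sheaf_iso_def)
  fix x assume x: "x \<in> PD"
  have "D x \<le> of_int (ord_at Y x s) + D' x"
    by (rule div_sheaf_le[OF D s x]) (auto simp: im)
  moreover have "D' x \<le> of_int (ord_at Y x (inverse s)) + D x"
    by (rule div_sheaf_le[OF D' _ x]) (use s in \<open>auto simp: im mult.assoc[symmetric]\<close>)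
  ultimately show "D' x = D x - of_int (ord_at Y x s)" using ord_inverse[OF x s] by simp
next
  assume s: "s \<noteq> 0" and eq: "\<forall>x\<in>PD. D' x = D x - of_int (ord_at Y x s)"
  have mem: "s * a \<in> div_sheaf Y D' U \<longleftrightarrow> a \<in> div_sheaf Y D U" for a U
    using s eq by (cases "a = 0") (simp_all add: zero_div_sheaf div_sheaf_iff ord_mult)
  have "(*) s ` div_sheaf Y D U = div_sheaf Y D' U" for U
  proof (intro subset_antisym subsetI)
    fix b assume "b \<in> div_sheaf Y D' U"
    then show "b \<in> (*) s ` div_sheaf Y D U"
      using s mem[of "b / s" U] by (intro image_eqI[of _ _ "b / s"]) auto
  qed (auto simp: mem)
  then show "div_sheaf_iso Y s D D'" using s by (simp add: div_sheaf_iso_def)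
qed

end

text \<open>The auxiliary divisor cancels: M contains (1-p^e) G, and division by p^e - 1 returns
  exactly the G that is then subtracted. The lemma stands outside the locales because it is also
  applied to the generic fibre, for which \<open>standing\<close> is not established. The point y
  gives access to the local condition, which contains the linearity of \<phi>.\<close>

lemma has_divisorE:
  assumes hd: "has_divisor p e Y K L \<phi> \<Delta>" and q: "(of_nat p ^ e :: rat) \<noteq> 1"
    and y: "y \<in> topspace (pts Y)"
  obtains T g where "frob_duality p e Y K T" "g \<noteq> 0" "\<phi> = T g" "frob_linear p e \<phi>"
    "\<forall>x\<in>prime_divs Y.
      (of_nat p ^ e - 1) * \<Delta> x + L x = of_int (ord_at Y x g) + (1 - of_nat p ^ e) * K x"
proof -
  obtain T g where T: "frob_duality p e Y K T" and g: "g \<noteq> 0" "\<phi> = T g"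
    and loc: "\<forall>y\<in>topspace (pts Y). \<exists>U G. openin (pts Y) U \<and> y \<in> U \<and> eff_Cartier_on Y U G \<and>
          (let M = (\<lambda>x. L x + (1 - of_nat p ^ e) * G x);
               D = (\<lambda>x. principal Y g x + (1 - of_nat p ^ e) * K x - M x)
           in \<phi> \<in> frob_hom p e Y M U \<and>
              (\<forall>x \<in> U \<inter> prime_divs Y. \<Delta> x = D x / (of_nat p ^ e - 1) - G x))"
    using hd unfolding has_divisor_def by (elim exE conjE)
  have fl: "frob_linear p e \<phi>" using loc[rule_format, OF y] by (auto simp: Let_def frob_hom_def)
  have "(of_nat p ^ e - 1) * \<Delta> x + L x = of_int (ord_at Y x g) + (1 - of_nat p ^ e) * K x"
    if x: "x \<in> prime_divs Y" for x
  proof -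
    define r :: rat where "r = of_nat p ^ e"
    have "x \<in> topspace (pts Y)" using x by (simp add: prime_divs_def)
    then obtain U G where UG: "x \<in> U" "\<forall>z \<in> U \<inter> prime_divs Y. \<Delta> z =
        (principal Y g z + (1 - r) * K z - (L z + (1 - r) * G z)) / (r - 1) - G z"
      using loc unfolding Let_def r_def by meson
    have "\<Delta> x = (of_int (ord_at Y x g) + (1 - r) * K x - (L x + (1 - r) * G x)) / (r - 1) - G x"
      using UG(2)[rule_format, of x] UG(1) x by (simp add: principal_def)
    then have "(r - 1) * \<Delta> x = (r - 1) * ((of_int (ord_at Y x g) + (1 - r) * K x - (L x + (1 - r) * G x)) / (r - 1) - G x)"
      by (rule arg_cong)
    also have "\<dots> = of_int (ord_at Y x g) + (1 - r) * K x - (L x + (1 - r) * G x) - (r - 1) * G x"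
      unfolding right_diff_distrib[of "r - 1" "_ / _"] using q by (simp add: r_def)
    finally have "(r - 1) * \<Delta> x = of_int (ord_at Y x g) + (1 - r) * K x - (L x + (1 - r) * G x) - (r - 1) * G x" .
    then show ?thesis by (simp add: algebra_simps r_def)
  qed
  then show thesis using that T g fl by blast
qed

section \<open>Divisors of maps expressed by orders\<close>

context dscheme
begin

lemma p_ge_2: "p \<ge> 2"
  using p by (rule prime_ge_2_nat)

lemma q_gt_1: "e > 0 \<Longrightarrow> (of_nat p :: rat) ^ e > 1"
  using p_ge_2 by (intro one_less_power) auto

lemma ex_duality: "e > 0 \<Longrightarrow> \<exists>T. duality p Y K e T"
  using duality_ex[of e] by (auto simp: duality_def duality_axioms_def dscheme_axioms)

text \<open>Both maps are values of T, at g and g', and T(g') is T(g) premultiplied by g'/g.\<close>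

lemma frob_transitive:
  fixes \<phi> \<psi> :: "'k \<Rightarrow> 'k"
  assumes "e > 0" and \<phi>: "frob_linear p e \<phi>" "\<phi> z \<noteq> 0" and \<psi>: "frob_linear p e \<psi>" "\<psi> w \<noteq> 0"
  obtains c where "c \<noteq> 0" "\<psi> = (\<lambda>a. \<phi> (c * a))"
proof -
  obtain T where "duality p Y K e T" using ex_duality[OF assms(1)] by blast
  then interpret duality p Y K e T .
  obtain g where g: "g \<noteq> 0" "T g = \<phi>" using \<phi> by (rule T_nonzero)
  obtain g' where g': "g' \<noteq> 0" "T g' = \<psi>" using \<psi> by (rule T_nonzero)
  have "\<psi> = (\<lambda>a. \<phi> (g' / g * a))"
  proof
    show "\<psi> a = \<phi> (g' / g * a)" for a
      using T_mult[of "g' / g" g a] g g' by simp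
  qed
  then show thesis using that[of "g' / g"] g g' by simp
qed

lemma has_divisorD:
  assumes e: "e > 0" and hd: "has_divisor p e Y K L \<phi> \<Delta>"
  shows "frob_linear p e \<phi>" "\<exists>z. \<phi> z \<noteq> 0" "Q_divisor Y \<Delta>"
    "\<And>x. x \<in> PD \<Longrightarrow> vord x \<phi> ((of_nat p ^ e - 1) * \<Delta> x + L x)"
proof -
  have q: "(of_nat p ^ e :: rat) \<noteq> 1" using q_gt_1[OF e] by simp
  obtain T g where T: "frob_duality p e Y K T" and g: "g \<noteq> 0" "\<phi> = T g"
    and fl: "frob_linear p e \<phi>"
    and eq: "\<forall>x\<in>PD.
      (of_nat p ^ e - 1) * \<Delta> x + L x = of_int (ord_at Y x g) + (1 - of_nat p ^ e) * K x"
    by (rule has_divisorE[OF hd q gp(1)])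
  interpret duality p Y K e T by unfold_locales (rule T)
  show "frob_linear p e \<phi>" by (rule fl)
  show "\<exists>z. \<phi> z \<noteq> 0"
  proof (rule ccontr)
    assume "\<not> ?thesis"
    then have "T g = T 0" unfolding T_zero g(2) by auto
    then show False using T_inj g(1) by blast
  qed
  show "Q_divisor Y \<Delta>" using hd by (simp add: has_divisor_def)
  show "vord x \<phi> ((of_nat p ^ e - 1) * \<Delta> x + L x)" if "x \<in> PD" for x
    using vord_T[OF that g(1)] by (simp add: eq[rule_format, OF that] g(2))
qed

text \<open>The order of \<phi> = T(g) determines div(g), and this gives the formula for \<Delta>.
  Integrality on the twisted sheaf comes from \<Delta> + G \<ge> 0.\<close>

lemma has_divisorI:
  assumes e: "e > 0" and \<phi>: "frob_linear p e \<phi>" "\<phi> z \<noteq> 0" and \<Delta>: "Q_divisor Y \<Delta>"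
    and v: "\<And>x. x \<in> PD \<Longrightarrow> vord x \<phi> ((of_nat p ^ e - 1) * \<Delta> x + L x)"
  shows "has_divisor p e Y K L \<phi> \<Delta>"
proof -
  obtain T where "duality p Y K e T" using ex_duality[OF assms(1)] by blast
  then interpret duality p Y K e T .
  obtain g where g: "g \<noteq> 0" "T g = \<phi>" using \<phi> by (rule T_nonzero)
  define q :: rat where "q = of_nat p ^ e"
  have q: "q - 1 > 0" using q_gt_1[OF e] by (simp add: q_def)
  have og: "of_int (ord_at Y x g) + (1 - q) * K x = (q - 1) * \<Delta> x + L x" if x: "x \<in> PD" for x
    using vord_unique[OF vord_T[OF x g(1), unfolded g(2)] v[OF x]] by (simp add: q_def)
  have loc: "\<exists>U G. openin (pts Y) U \<and> y \<in> U \<and> eff_Cartier_on Y U G \<and>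
          \<phi> \<in> frob_hom p e Y (\<lambda>x. L x + (1 - q) * G x) U \<and>
          (\<forall>x \<in> U \<inter> PD. \<Delta> x = (principal Y g x + (1 - q) * K x - (L x + (1 - q) * G x)) / (q - 1) - G x)"
    if y: "y \<in> X" for y
  proof -
    obtain U c where U: "nopen Y U" "y \<in> U" and c: "c \<noteq> 0"
      and oc: "\<forall>x\<in>U \<inter> PD. ord_at Y x c \<ge> 0 \<and> of_int (ord_at Y x c) \<ge> - \<Delta> x"
      by (rule ex_effective[OF \<Delta> y])
    define G where "G = principal Y c"
    have oU: "openin (pts Y) U" using U(1) by (simp add: nopen_def)
    have eff: "eff_Cartier_on Y U G"
      unfolding G_def by (rule eff_Cartier_principal[OF c oU]) (use oc in simp)
    have hom: "\<phi> \<in> frob_hom p e Y (\<lambda>x. L x + (1 - q) * G x) U"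
      unfolding frob_hom_def
    proof (intro CollectI conjI \<phi>(1) allI impI subsetI, elim conjE)
      fix V b assume V: "nopen Y V" "V \<subseteq> U" and "b \<in> \<phi> ` div_sheaf Y (\<lambda>x. L x + (1 - q) * G x) V"
      then obtain a where a: "b = \<phi> a" "a \<in> div_sheaf Y (\<lambda>x. L x + (1 - q) * G x) V" by blast
      show "b \<in> reg Y V"
      proof (cases "a = 0")
        case True
        then show ?thesis
          using frob_linear_zero[OF \<phi>(1)] zero_reg[OF V(1)] a(1)
          by simp
      next
        case False
        show ?thesis unfolding reg_iff[OF V(1)]
        proof
          fix x assume xV: "x \<in> V \<inter> PD"
          then have x: "x \<in> PD" "x \<in> U \<inter> PD" using V(2) by auto
          obtain m where m: "(q - 1) * \<Delta> x + L x = of_int m"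
            using v[OF x(1)] by (auto simp: vord_def q_def elim: Ints_cases)
          have low: "lower x \<phi> m" using v[OF x(1)] m by (simp add: vord_def q_def)
          have "of_int (ord_at Y x a) + (L x + (1 - q) * of_int (ord_at Y x c)) \<ge> 0"
            using a(2) xV False x(1) by (simp add: div_sheaf_iff G_def principal_def)
          moreover have "(q - 1) * of_int (ord_at Y x c) \<ge> (q - 1) * (- \<Delta> x)"
            using oc x(2) q by (intro mult_left_mono) auto
          ultimately have "(of_int (ord_at Y x a) :: rat) \<ge> - of_int m"
            unfolding m[symmetric] by (simp add: algebra_simps)
          then have "ord_at Y x a \<ge> - m" by linarith
          then show "b \<in> stalk Y x" unfolding a(1) by (rule lowerD[OF low False])
        qed
      qed
    qed
    have "\<Delta> x = (principal Y g x + (1 - q) * K x - (L x + (1 - q) * G x)) / (q - 1) - G x"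
      if x: "x \<in> U \<inter> PD" for x
    proof -
      have "principal Y g x + (1 - q) * K x - (L x + (1 - q) * G x) = (q - 1) * (\<Delta> x + G x)"
        using og[of x] x by (simp add: principal_def algebra_simps)
      then show ?thesis using q by simp
    qed
    then show ?thesis using oU U(2) eff hom by (intro exI[of _ U] exI[of _ G]) simp
  qed
  show ?thesis
    unfolding has_divisor_def Let_def
    using \<Delta> dual g loc[unfolded q_def] by (intro conjI exI[of _ T] exI[of _ g]) auto
qed

text \<open>With \<phi> = T(g), the equation is solved for \<Delta>. It is kept in the conclusion
  because it shows K + \<Delta> to be Q-Cartier once L is Cartier.\<close>

lemma has_divisor_ex:
  assumes e: "e > 0" and \<phi>: "frob_linear p e \<phi>" "\<phi> z \<noteq> 0" and L: "Weil_divisor Y L"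
  shows "\<exists>\<Delta> g. g \<noteq> 0 \<and> has_divisor p e Y K L \<phi> \<Delta> \<and>
    (\<forall>y. (of_nat p ^ e - 1) * (K y + \<Delta> y) = principal Y g y - L y)"
proof -
  obtain T where "duality p Y K e T" using ex_duality[OF assms(1)] by blast
  then interpret duality p Y K e T .
  obtain g where g: "g \<noteq> 0" "T g = \<phi>" using \<phi> by (rule T_nonzero)
  define q :: rat where "q = of_nat p ^ e"
  have q: "q - 1 \<noteq> 0" using q_gt_1[OF e] by (simp add: q_def)
  define \<Delta> where "\<Delta> = (\<lambda>x. (1 / (q - 1)) * (1 * principal Y g x + (- 1) * L x) + (- 1) * K x)"
  have "Q_divisor Y \<Delta>"
    unfolding \<Delta>_def
    by (intro Q_divisor_add Q_divisor_principal[OF g(1)] Weil_Q_divisor[OF L] Weil_Q_divisor[OF WeilK])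
  moreover have eq: "(q - 1) * (K y + \<Delta> y) = principal Y g y - L y" for y
    using q by (simp add: \<Delta>_def field_simps)
  have "vord x \<phi> ((of_nat p ^ e - 1) * \<Delta> x + L x)" if x: "x \<in> PD" for x
  proof -
    have "(q - 1) * \<Delta> x + L x = of_int (ord_at Y x g) + (1 - q) * K x"
      using eq[of x] x by (simp add: principal_def algebra_simps)
    then show ?thesis using vord_T[OF x g(1)] g(2) by (simp add: q_def)
  qed
  ultimately have "has_divisor p e Y K L \<phi> \<Delta>" by (intro has_divisorI[OF e \<phi>])
  then show ?thesis using g(1) eq unfolding q_def by blast
qed

text \<open>\<Delta> drops out of the order: (p^e-1)\<Delta> + (1-p^e)(K+\<Delta>) = (1-p^e)K, which
  is the order of T(1).\<close>

lemma phi_DeltaD: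
  assumes e: "e > 0" and pd: "phi_Delta p e Y K \<Delta> \<phi>"
  shows "frob_linear p e \<phi>" "\<exists>z. \<phi> z \<noteq> 0" "Cartier_divisor Y (log_bundle p e K \<Delta>)"
    "\<And>x. x \<in> PD \<Longrightarrow> vord x \<phi> ((1 - of_nat p ^ e) * K x)"
proof -
  have hd: "has_divisor p e Y K (log_bundle p e K \<Delta>) \<phi> \<Delta>"
    and "Cartier_divisor Y (log_bundle p e K \<Delta>)"
    using pd by (simp_all add: phi_Delta_def)
  then show "Cartier_divisor Y (log_bundle p e K \<Delta>)" by simp
  show "frob_linear p e \<phi>" "\<exists>z. \<phi> z \<noteq> 0" using has_divisorD[OF e hd] by blast+
  show "vord x \<phi> ((1 - of_nat p ^ e) * K x)" if "x \<in> PD" for x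
    using has_divisorD(4)[OF e hd that] by (simp add: log_bundle_def algebra_simps)
qed

text \<open>T(1) serves for every \<Delta>; the divisor enters through the sheaf on which the map is
  considered.\<close>

lemma phi_Delta_ex:
  assumes e: "e > 0" and \<Delta>: "Q_divisor Y \<Delta>" and C: "Cartier_divisor Y (log_bundle p e K \<Delta>)"
  shows "\<exists>\<phi>. phi_Delta p e Y K \<Delta> \<phi>"
proof -
  obtain T where "duality p Y K e T" using ex_duality[OF e] by blast
  then interpret duality p Y K e T .
  obtain z where z: "T 1 z \<noteq> 0"
    using T_inj[of 1 0] T_zero by auto
  have "has_divisor p e Y K (log_bundle p e K \<Delta>) (T 1) \<Delta>"
  proof (rule has_divisorI[OF e T_frob_linear z \<Delta>])
    fix x assume x: "x \<in> PD"
    show "vord x (T 1) ((of_nat p ^ e - 1) * \<Delta> x + log_bundle p e K \<Delta> x)"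
      using vord_T[OF x, of 1] ord_one[OF x] by (simp add: log_bundle_def algebra_simps)
  qed
  then show ?thesis using C by (auto simp: phi_Delta_def)
qed

end

section \<open>Pull-back of divisors\<close>

context nscheme
begin

lemma local_equationE:
  assumes "local_equation Y D y g"
  obtains V where "nopen Y V" "y \<in> V" "g \<noteq> 0" "\<forall>x\<in>V \<inter> PD. D x = of_int (ord_at Y x g)"
proof -
  obtain V where V: "g \<noteq> 0" "openin (pts Y) V" "y \<in> V" "\<forall>x\<in>V \<inter> PD. D x = principal Y g x"
    using assms unfolding local_equation_def by (elim exE conjE)
  have "nopen Y V" using V(2,3) by (rule nopenI)
  moreover have "\<forall>x\<in>V \<inter> PD. D x = of_int (ord_at Y x g)" using V(4) by (simp add: principal_def)
  ultimately show thesis using that V(1,3) by blast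
qed

lemma local_equationI:
  assumes "g \<noteq> 0" "nopen Y V" "y \<in> V" "\<And>x. x \<in> V \<inter> PD \<Longrightarrow> D x = of_int (ord_at Y x g)"
  shows "local_equation Y D y g"
  unfolding local_equation_def using assms by (auto simp: nopen_def principal_def)

lemma local_equation_power:
  assumes "local_equation Y D y g"
  shows "local_equation Y (\<lambda>y. of_nat n * D y) y (g ^ n)"
proof -
  obtain V where V: "nopen Y V" "y \<in> V" "g \<noteq> 0" "\<forall>x\<in>V \<inter> PD. D x = of_int (ord_at Y x g)"
    using assms by (rule local_equationE)
  show ?thesis by (rule local_equationI[OF _ V(1,2)]) (use V(3,4) in \<open>auto simp: ord_power\<close>)
qed

text \<open>By symmetry the quotient is a unit at y. Hence \<open>pullback\<close>, which picks a
  local equation arbitrarily, is well defined.\<close>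

lemma local_equation_quotient:
  assumes "local_equation Y D y g" "local_equation Y D y g'"
  shows "g / g' \<in> stalk Y y"
proof -
  obtain V where V: "nopen Y V" "y \<in> V" "g \<noteq> 0" "\<forall>x\<in>V \<inter> PD. D x = of_int (ord_at Y x g)"
    using assms(1) by (rule local_equationE)
  obtain V' where V': "nopen Y V'" "y \<in> V'" "g' \<noteq> 0" "\<forall>x\<in>V' \<inter> PD. D x = of_int (ord_at Y x g')"
    using assms(2) by (rule local_equationE)
  have n: "nopen Y (V \<inter> V')" by (rule nopen_Int[OF V(1) V'(1)])
  have "g / g' \<in> stalk Y x" if x: "x \<in> V \<inter> V' \<inter> PD" for x
  proof -
    have "(of_int (ord_at Y x g) :: rat) = of_int (ord_at Y x g')" using V(4) V'(4) x by (metis IntE IntI)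
    then have "ord_at Y x g = ord_at Y x g'" by simp
    then have "ord_at Y x (g / g') = 0" using x V(3) V'(3) by (simp add: ord_divide)
    then show ?thesis using stalk_iff_ord[of x "g / g'"] x V(3) V'(3) by simp
  qed
  then have "g / g' \<in> reg Y (V \<inter> V')" unfolding reg_iff[OF n] by blast
  then show ?thesis using V(2) V'(2) by (intro stalkI[OF n]) auto
qed

lemma div_sheaf_iff_reg:
  assumes U: "nopen Y U" and b: "b \<noteq> 0" "\<And>x. x \<in> U \<inter> PD \<Longrightarrow> D x = of_int (ord_at Y x b)"
  shows "y \<in> div_sheaf Y D U \<longleftrightarrow> b * y \<in> reg Y U"
proof (cases "y = 0")
  case True
  then show ?thesis using zero_reg[OF U] by (simp add: zero_div_sheaf)
next
  case False
  have "0 \<le> of_int (ord_at Y x y) + D x \<longleftrightarrow> b * y \<in> stalk Y x" if x: "x \<in> U \<inter> PD" for x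
    using x b(1) False stalk_iff_ord[of x "b * y"]
    by (simp add: b(2) ord_mult add.commute flip: of_int_add)
  then show ?thesis by (simp add: reg_iff[OF U] div_sheaf_iff[OF False])
qed

lemma Cartier_local: "Cartier_divisor Y D \<Longrightarrow> y \<in> X \<Longrightarrow> \<exists>g. local_equation Y D y g"
  by (simp add: Cartier_divisor_def Cartier_on_def)

lemma Cartier_localE:
  assumes "Cartier_divisor Y D" "y \<in> X"
  obtains V g where "nopen Y V" "y \<in> V" "g \<noteq> 0" "\<forall>x\<in>V \<inter> PD. D x = of_int (ord_at Y x g)"
  using Cartier_local[OF assms] local_equationE by metis

lemma Cartier_Weil: "Cartier_divisor Y D \<Longrightarrow> Weil_divisor Y D"
  by (simp add: Cartier_divisor_def)

end

section \<open>Functions and divisors pulled back along the fibration\<close>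

locale fibration = E: dscheme p E KE + W: dscheme p W KW
  for p :: nat and E :: "('a, 'k::field) int_scheme" and KE and W :: "('b, 'l::field) int_scheme" and KW +
  fixes f :: "'a \<Rightarrow> 'b" and h :: "'l \<Rightarrow> 'k" and \<Delta> :: "'a \<Rightarrow> rat"
  assumes dom: "dominant_morphism E W f h" and ft: "finite_type E W f h"
    and conn: "\<forall>V. nopen W V \<longrightarrow> h ` reg W V = reg E (preim E f V)"
    and Q\<Delta>: "Q_divisor E \<Delta>"
    and hor: "\<forall>x\<in>prime_divs E. horizontal E W f x \<longrightarrow> \<Delta> x \<ge> 0"
begin

abbreviation "\<pi>D \<equiv> pullback E W f h"

lemma h_hom: "h \<in> ring_hom (ring_on UNIV) (ring_on UNIV)"
  using dom by (simp add: dominant_morphism_def)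

lemma h_add: "h (a + b) = h a + h b" and h_mult: "h (a * b) = h a * h b" and h_one [simp]: "h 1 = 1"
  using h_hom by (auto simp: ring_hom_def ring_on_def)

lemma h_zero [simp]: "h 0 = 0"
  by (metis h_add add_0_right add_cancel_left_right)

lemma h_eq_zero [simp]: "h a = 0 \<longleftrightarrow> a = 0"
proof
  assume "h a = 0"
  then have "h (a * inverse a) = 0" by (simp add: h_mult)
  then show "a = 0" by (cases "a = 0") auto
qed simp

lemma h_inverse: "h (inverse a) = inverse (h a)"
proof (cases "a = 0")
  case False
  then have "h a * h (inverse a) = 1" by (simp flip: h_mult)
  then show ?thesis by (rule inverse_unique[symmetric])
qed simp

lemma h_divide: "h (a / b) = h a / h b"
  by (simp add: divide_inverse h_mult h_inverse)

lemma h_power: "h (a ^ n) = h a ^ n"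
  by (induction n) (auto simp: h_mult)

lemma h_diff: "h (a - b) = h a - h b"
  using h_add[of "a - b" b] by simp

lemma h_inj: "h a = h b \<Longrightarrow> a = b"
  using h_diff[of a b] h_eq_zero[of "a - b"] by simp

lemma cont: "continuous_map (pts E) (pts W) f"
  using dom by (simp add: dominant_morphism_def)

lemma f_in: "x \<in> E.X \<Longrightarrow> f x \<in> W.X"
  using cont by (auto simp: continuous_map_def)

lemma preim_iff: "x \<in> preim E f V \<longleftrightarrow> x \<in> E.X \<and> f x \<in> V"
  by (simp add: preim_def)

lemma preim_nopen:
  assumes V: "nopen W V"
  shows "nopen E (preim E f V)"
proof -
  have oV: "openin (pts W) V" using V by (simp add: nopen_def)
  have o: "openin (pts E) (preim E f V)"
    unfolding preim_def by (rule openin_continuous_map_preimage[OF cont oV])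
  obtain v where v: "v \<in> V" using V by (auto simp: nopen_def)
  then have "v \<in> (pts W) closure_of (f ` E.X)"
    using W.nopen_sub[OF V] dom by (auto simp: dominant_morphism_def)
  then obtain x where "x \<in> E.X" "f x \<in> V"
    using oV v by (auto simp: in_closure_of)
  then show ?thesis using o by (intro E.nopenI[of _ x]) (simp_all add: preim_iff)
qed

lemma preim_reg: "nopen W V \<Longrightarrow> h ` reg W V = reg E (preim E f V)"
  using conn by simp

lemma f_gp: "f E.gp = W.gp"
proof (rule W.gp_eq[symmetric])
  show "f E.gp \<in> W.X" by (rule f_in[OF E.gp(1)])
  show "W.cl (f E.gp) = W.X"
    unfolding W.cl_univ_iff using E.gp_in[OF preim_nopen] by (simp add: preim_iff)
qed

lemma h_stalk:
  assumes "x \<in> E.X" "a \<in> stalk W (f x)"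
  shows "h a \<in> stalk E x"
proof -
  obtain V where V: "nopen W V" "f x \<in> V" "a \<in> reg W V" using assms(2) by (rule W.stalkE)
  then have "h a \<in> reg E (preim E f V)" using preim_reg[OF V(1)] by blast
  then show ?thesis using assms(1) V(2) by (intro E.stalkI[OF preim_nopen[OF V(1)]]) (simp_all add: preim_iff)
qed

lemma h_nonunits: "x \<in> E.X \<Longrightarrow> a \<in> nonunits (stalk W (f x)) \<Longrightarrow> h a \<in> nonunits (stalk E x)"
  using dom by (simp add: dominant_morphism_def image_subset_iff)

lemma ord_h_unit:
  assumes x: "x \<in> E.PD" and a: "a \<noteq> 0" "a \<in> stalk W (f x)" "inverse a \<in> stalk W (f x)"
  shows "ord_at E x (h a) = 0"
proof -
  have "ord_at E x (h a) \<ge> 0"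
    using h_stalk[OF E.PD_X[OF x] a(2)] E.stalk_iff_ord[OF x, of "h a"] a(1) by simp
  moreover have "ord_at E x (inverse (h a)) \<ge> 0"
    using h_stalk[OF E.PD_X[OF x] a(3)] E.stalk_iff_ord[OF x, of "inverse (h a)"] a(1)
    by (simp add: h_inverse)
  ultimately show ?thesis using E.ord_inverse[OF x, of "h a"] a(1) by simp
qed

lemma ord_local_equation:
  assumes x: "x \<in> E.PD" and g: "local_equation W D (f x) g" "local_equation W D (f x) g'"
  shows "ord_at E x (h g) = ord_at E x (h g')"
proof -
  have nz: "g \<noteq> 0" "g' \<noteq> 0" using g by (simp_all add: local_equation_def)
  have "ord_at E x (h (g / g')) = 0"
  proof (rule ord_h_unit[OF x])
    show "g / g' \<in> stalk W (f x)" by (rule W.local_equation_quotient[OF g])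
    show "inverse (g / g') \<in> stalk W (f x)" using W.local_equation_quotient[OF g(2,1)] by simp
  qed (use nz in simp)
  then show ?thesis using nz x by (simp add: h_divide E.ord_divide)
qed

lemma pullback_eq:
  assumes x: "x \<in> E.PD" and g: "local_equation W D (f x) g"
  shows "\<pi>D D x = of_int (ord_at E x (h g))"
proof -
  have "local_equation W D (f x) (SOME g. local_equation W D (f x) g)"
    using g by (rule someI)
  from ord_local_equation[OF x this g] show ?thesis
    using x by (simp add: pullback_def principal_def)
qed

lemma pullback_PD: "x \<notin> E.PD \<Longrightarrow> \<pi>D D x = 0"
  by (simp add: pullback_def principal_def)

lemma pullback_nbhd:
  assumes g: "g \<noteq> 0" and V: "nopen W V" "\<forall>w\<in>V \<inter> W.PD. D w = of_int (ord_at W w g)"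
    and x: "x \<in> E.PD" "x \<in> preim E f V"
  shows "\<pi>D D x = of_int (ord_at E x (h g))"
  by (rule pullback_eq[OF x(1)]) (rule W.local_equationI[OF g V(1)], use x V(2) in \<open>simp_all add: preim_iff\<close>)

lemma pullback_Weil:
  assumes D: "Cartier_divisor W D"
  shows "Weil_divisor E (\<pi>D D)"
  unfolding Weil_divisor_def Q_divisor_def
proof (intro conjI allI ballI impI)
  show "\<pi>D D y \<in> \<int>" for y by (simp add: pullback_def principal_def)
  show "\<pi>D D y = 0" if "y \<notin> E.PD" for y using pullback_PD[OF that] .
  fix y assume y: "y \<in> E.X"
  obtain V g where V: "nopen W V" "f y \<in> V" "g \<noteq> 0" "\<forall>w\<in>V \<inter> W.PD. D w = of_int (ord_at W w g)"
    by (rule W.Cartier_localE[OF D f_in[OF y]])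
  have "h g \<noteq> 0" using V(3) by simp
  from E.Q_divisor_finite[OF E.Q_divisor_principal[OF this] y]
  obtain U where U: "openin (pts E) U" "y \<in> U" "finite {x \<in> U. principal E (h g) x \<noteq> 0}"
    by (elim exE conjE)
  have "{x \<in> U \<inter> preim E f V. \<pi>D D x \<noteq> 0} \<subseteq> {x \<in> U. principal E (h g) x \<noteq> 0}"
  proof
    fix x assume x: "x \<in> {x \<in> U \<inter> preim E f V. \<pi>D D x \<noteq> 0}"
    then have xP: "x \<in> E.PD" using pullback_PD by auto
    then show "x \<in> {x \<in> U. principal E (h g) x \<noteq> 0}"
      using x pullback_nbhd[OF V(3,1,4) xP] by (simp add: principal_def)
  qed
  then have "finite {x \<in> U \<inter> preim E f V. \<pi>D D x \<noteq> 0}" using U(3) by (rule finite_subset)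
  moreover have "openin (pts E) (U \<inter> preim E f V)"
    using U(1) preim_nopen[OF V(1)] by (simp add: nopen_def openin_Int)
  moreover have "y \<in> U \<inter> preim E f V" using U(2) V(2) y by (simp add: preim_iff)
  ultimately show "\<exists>U. openin (pts E) U \<and> y \<in> U \<and> finite {x \<in> U. \<pi>D D x \<noteq> 0}" by blast
qed

text \<open>\<open>Q_pullback\<close> picks an arbitrary Cartier multiple. Suitable powers of local
  equations of m D and n D are equations of the same divisor m n D, so the choice does not
  matter.\<close>

lemma pullback_scale:
  assumes D: "Cartier_divisor W (\<lambda>w. of_nat m * D w)" "Cartier_divisor W (\<lambda>w. of_nat n * D w)"
  shows "of_nat n * \<pi>D (\<lambda>w. of_nat m * D w) x = of_nat m * \<pi>D (\<lambda>w. of_nat n * D w) x"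
proof (cases "x \<in> E.PD")
  case x: True
  have fx: "f x \<in> W.X" by (rule f_in[OF E.PD_X[OF x]])
  obtain a where a: "local_equation W (\<lambda>w. of_nat m * D w) (f x) a"
    using W.Cartier_local[OF D(1) fx] by blast
  obtain b where b: "local_equation W (\<lambda>w. of_nat n * D w) (f x) b"
    using W.Cartier_local[OF D(2) fx] by blast
  have nz: "a \<noteq> 0" "b \<noteq> 0" using a b by (simp_all add: local_equation_def)
  have "local_equation W (\<lambda>w. of_nat n * (of_nat m * D w)) (f x) (a ^ n)"
    using W.local_equation_power[OF a] .
  moreover have "local_equation W (\<lambda>w. of_nat n * (of_nat m * D w)) (f x) (b ^ m)"
    using W.local_equation_power[OF b, of m] by (simp add: mult.left_commute)
  ultimately have "ord_at E x (h (a ^ n)) = ord_at E x (h (b ^ m))"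
    by (rule ord_local_equation[OF x])
  then have "int n * ord_at E x (h a) = int m * ord_at E x (h b)"
    using nz x by (simp add: h_power E.ord_power)
  then have "(of_int (int n * ord_at E x (h a)) :: rat) = of_int (int m * ord_at E x (h b))" by simp
  then show ?thesis using pullback_eq[OF x a] pullback_eq[OF x b] by simp
qed (simp add: pullback_PD)

text \<open>The preimage of V is quasi-compact, so it is covered by finitely many open sets each
  meeting the support of D in finitely many points.\<close>

lemma quasi_compact_finite:
  assumes V: "affine_open W V" and D: "Q_divisor E D"
  shows "finite {x \<in> preim E f V. D x \<noteq> 0}"
proof -
  have c: "compactin (pts E) (preim E f V)" using ft V by (simp add: finite_type_def)
  define C where "C = {U. openin (pts E) U \<and> finite {x \<in> U. D x \<noteq> 0}}"
  have cov: "preim E f V \<subseteq> \<Union>C"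
  proof
    fix x assume "x \<in> preim E f V"
    then have "x \<in> E.X" by (simp add: preim_iff)
    then show "x \<in> \<Union>C" unfolding C_def using E.Q_divisor_finite[OF D] by (auto simp: Union_iff)
  qed
  have "U \<in> C \<Longrightarrow> openin (pts E) U" for U by (simp add: C_def)
  then obtain F where F: "finite F" "F \<subseteq> C" "preim E f V \<subseteq> \<Union>F"
    using compactinD[OF c _ cov] by blast
  have "{x \<in> preim E f V. D x \<noteq> 0} \<subseteq> (\<Union>U\<in>F. {x \<in> U. D x \<noteq> 0})" using F(3) by auto
  moreover have "finite (\<Union>U\<in>F. {x \<in> U. D x \<noteq> 0})"
  proof (rule finite_UN_I[OF F(1)])
    fix U assume "U \<in> F"
    then have "U \<in> C" using F(2) by blast
    then show "finite {x \<in> U. D x \<noteq> 0}" by (simp add: C_def)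
  qed
  ultimately show ?thesis by (rule finite_subset)
qed

text \<open>Over V only finitely many components of D are negative, and f sends their generic points
  away from the generic point of W. A nonzero function in the prime of such an image point vanishes
  along the component after pull-back, and a product of powers outweighs D.\<close>

lemma vertical_cover:
  assumes V: "affine_open W V" and D: "Q_divisor E D"
    and vert: "\<And>x. x \<in> E.PD \<Longrightarrow> x \<in> preim E f V \<Longrightarrow> D x < 0 \<Longrightarrow> f x \<noteq> W.gp"
  obtains b where "b \<in> reg W V" "b \<noteq> 0"
    "\<forall>x\<in>E.PD \<inter> preim E f V. ord_at E x (h b) \<ge> 0 \<and> of_int (ord_at E x (h b)) \<ge> - D x"
proof -
  interpret C: affine_chart p W V by (rule W.chart[OF V])
  define F where "F = {x \<in> preim E f V. D x < 0}"
  have "F \<subseteq> {x \<in> preim E f V. D x \<noteq> 0}" by (auto simp: F_def)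
  then have F: "finite F" using quasi_compact_finite[OF V D] by (rule finite_subset)
  have FPD: "x \<in> E.PD" if "x \<in> F" for x
  proof (rule ccontr)
    assume "x \<notin> E.PD"
    then have "D x = 0" by (rule E.Q_divisor_PD[OF D])
    then show False using that by (simp add: F_def)
  qed
  have "\<exists>c. c \<in> reg W V \<and> c \<noteq> 0 \<and> ord_at E x (h c) \<ge> 1" if x: "x \<in> F" for x
  proof -
    have fx: "f x \<in> V" "x \<in> preim E f V" "D x < 0" using x by (simp_all add: F_def preim_iff)
    obtain c where c: "c \<in> C.pr (f x)" "c \<noteq> 0"
      using C.pr_nonzero[OF fx(1) vert[OF FPD[OF x] fx(2,3)]] .
    then have "h c \<in> nonunits (stalk E x)"
      using h_nonunits[OF E.PD_X[OF FPD[OF x]]] by (simp add: C.pr_def)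
    then have "ord_at E x (h c) \<ge> 1" using E.nonunits_iff_ord[OF FPD[OF x], of "h c"] c(2) by simp
    then show ?thesis using c by (intro exI[of _ c]) (simp add: C.pr_def)
  qed
  note pos = this
  obtain b where "b \<in> reg W V" "b \<noteq> 0"
    "\<forall>x\<in>E.PD \<inter> preim E f V. ord_at E x (h b) \<ge> 0 \<and> of_int (ord_at E x (h b)) \<ge> - D x"
  proof (rule C.ex_bounded_below[OF F])
    show "F \<subseteq> E.PD \<inter> preim E f V" using FPD by (auto simp: F_def)
    show "D x \<ge> 0" if "x \<in> E.PD \<inter> preim E f V" "x \<notin> F" for x using that by (simp add: F_def)
    show "ord_at E x (h a) \<ge> 0" if "x \<in> E.PD \<inter> preim E f V" "a \<in> reg W V" "a \<noteq> 0" for x a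
    proof -
      have "h a \<in> stalk E x"
        using h_stalk[OF E.PD_X, of x a] W.stalkI[OF C.nopenU _ that(2), of "f x"] that(1)
        by (simp add: preim_iff)
      then show ?thesis using E.stalk_iff_ord[of x "h a"] that by simp
    qed
  qed (use pos in \<open>auto simp: h_mult E.ord_mult\<close>)
  then show thesis by (rule that)
qed

text \<open>Used in contrapositive form: a component with negative coefficient does not lie over the
  generic point of W.\<close>

lemma horizontal_gp:
  assumes "x \<in> E.X" "f x = W.gp"
  shows "horizontal E W f x"
proof -
  have "x \<in> E.cl x" using assms(1) by (simp add: in_closure_of)
  then have "W.gp \<in> f ` E.cl x" using assms(2) by force
  then have "W.cl W.gp \<subseteq> (pts W) closure_of (f ` E.cl x)" by (intro closure_of_mono) simp
  then show ?thesis
    unfolding horizontal_def W.gp(2) using closure_of_subset_topspace[of "pts W"] by blast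
qed

lemma ex_affine_gp: "\<exists>V. affine_open W V"
  using W.affine_cover[OF W.gp(1)] by blast

text \<open>The poles of r are vertical, so h(b) r is regular over an affine V for some b \<noteq>
  0, and functions on the preimage of V come from O_W(V). In other words, the global functions on
  the generic fibre are K(W).\<close>

lemma generic_fibre_functions:
  assumes r: "r \<noteq> 0" "\<And>x. x \<in> E.PD \<Longrightarrow> f x = W.gp \<Longrightarrow> ord_at E x r \<ge> 0"
  obtains a where "r = h a"
proof -
  obtain V where V: "affine_open W V" using ex_affine_gp by blast
  note nV = W.affine_nopen[OF V]
  obtain b where b: "b \<in> reg W V" "b \<noteq> 0"
    "\<forall>x\<in>E.PD \<inter> preim E f V. ord_at E x (h b) \<ge> 0 \<and> of_int (ord_at E x (h b)) \<ge> - principal E r x"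
    by (rule vertical_cover[OF V E.Q_divisor_principal[OF r(1)]]) (use r(2) in \<open>force simp: principal_def\<close>)+
  have "h b * r \<in> reg E (preim E f V)"
    unfolding E.reg_iff[OF preim_nopen[OF nV]]
  proof
    fix x assume x: "x \<in> preim E f V \<inter> E.PD"
    then have "rat_of_int (ord_at E x (h b)) \<ge> - of_int (ord_at E x r)"
      using b(3) by (auto simp: principal_def)
    then have "ord_at E x (h b) + ord_at E x r \<ge> 0" by linarith
    then show "h b * r \<in> stalk E x"
      using x r(1) b(2) E.stalk_iff_ord[of x "h b * r"] by (simp add: E.ord_mult)
  qed
  then obtain c where "h b * r = h c" using preim_reg[OF nV] by blast
  then have "r = h (c / b)" using b(2) by (simp add: h_divide field_simps)
  then show thesis using that by blast
qed

text \<open>Over small V both u / h(g) and its inverse are regular on the preimage, so u is h of g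
  times a unit of O_W(V). As h is injective the local descents agree, and a single v has the
  prescribed order everywhere.\<close>

lemma descend_unit:
  assumes u: "u \<noteq> 0"
    and loc: "\<And>w. w \<in> W.X \<Longrightarrow> \<exists>V g. nopen W V \<and> w \<in> V \<and> g \<noteq> 0 \<and>
      (\<forall>x\<in>E.PD \<inter> preim E f V. ord_at E x u = ord_at E x (h g)) \<and>
      (\<forall>z\<in>W.PD \<inter> V. ord_at W z g = D z)"
  obtains v where "v \<noteq> 0" "h v = u" "\<And>z. z \<in> W.PD \<Longrightarrow> ord_at W z v = D z"
proof -
  have *: "\<exists>v. v \<noteq> 0 \<and> h v = u \<and> (w \<in> W.PD \<longrightarrow> ord_at W w v = D w)" if w: "w \<in> W.X" for w
  proof -
    obtain V g where V: "nopen W V" "w \<in> V" and g: "g \<noteq> 0"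
      "\<forall>x\<in>E.PD \<inter> preim E f V. ord_at E x u = ord_at E x (h g)" "\<forall>z\<in>W.PD \<inter> V. ord_at W z g = D z"
      using loc[OF w] by (elim exE conjE)
    have "u / h g \<in> reg E (preim E f V)" "h g / u \<in> reg E (preim E f V)"
      unfolding E.reg_iff[OF preim_nopen[OF V(1)]]
      using g u by (auto simp: E.stalk_iff_ord E.ord_divide)
    then obtain a b where a: "a \<in> reg W V" "u / h g = h a" and b: "b \<in> reg W V" "h g / u = h b"
      using preim_reg[OF V(1)] by blast
    have "h (a * b) = h 1" using a(2)[symmetric] b(2)[symmetric] u g(1) by (simp add: h_mult)
    then have ab: "a * b = 1" by (rule h_inj)
    then have a0: "a \<noteq> 0" and b0: "b \<noteq> 0" by auto
    have "ord_at W w (a * g) = D w" if wP: "w \<in> W.PD"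
    proof -
      have "ord_at W w a \<ge> 0" "ord_at W w b \<ge> 0"
        using W.stalk_iff_ord[OF wP a0] W.stalk_iff_ord[OF wP b0]
          W.stalkI[OF V(1,2) a(1)] W.stalkI[OF V(1,2) b(1)] by simp_all
      moreover have "ord_at W w a + ord_at W w b = 0"
        using W.ord_mult[OF wP a0 b0] W.ord_one[OF wP] ab by simp
      ultimately show ?thesis using g(1,3) a0 wP V(2) by (simp add: W.ord_mult)
    qed
    moreover have "h (a * g) = u" using a(2)[symmetric] g(1) by (simp add: h_mult)
    ultimately show ?thesis using a0 g(1) by (intro exI[of _ "a * g"]) simp
  qed
  obtain v where v: "v \<noteq> 0" "h v = u" using *[OF W.gp(1)] by blast
  have "ord_at W z v = D z" if z: "z \<in> W.PD" for z
    using *[OF W.PD_X[OF z]] z v(2) h_inj by metis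
  then show thesis using that v by blast
qed

end

section \<open>The push-forward of a map\<close>

lemma (in nscheme) frob_funpow_power:
  assumes \<phi>: "frob_linear p e \<phi>" and x: "\<phi> x = 1"
  shows "(\<phi> ^^ k) (x ^ (\<Sum>i<k. (p ^ e) ^ i)) = 1"
proof (induction k)
  case (Suc k)
  have "x ^ (\<Sum>i<Suc k. (p ^ e) ^ i) = x ^ (p ^ (e * k)) * x ^ (\<Sum>i<k. (p ^ e) ^ i)"
    by (simp add: power_add power_mult mult.commute)
  then show ?case
    using frob_linear_scale[OF frob_linear_funpow[OF \<phi>, of k], of x "x ^ (\<Sum>i<k. (p ^ e) ^ i)"] Suc.IH x
    by simp
qed simp

text \<open>The multiple by which the bundle (1-p^e)(K+\<Delta>) has to be taken to give the one of
  exponent e k.\<close>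

lemma geometric_weight:
  "(1 - of_nat p ^ e) * of_nat (\<Sum>i<k. (p ^ e) ^ i) = (1 - of_nat p ^ (e * k) :: rat)"
  unfolding power_mult one_diff_power_eq by simp

text \<open>One complete set of choices in the construction of the divisor on W. Uniqueness compares
  two instances.\<close>

locale fib_choice = fibration p E KE W KW f h \<Delta>
  for p :: nat and E :: "('a, 'k::field) int_scheme" and KE and W :: "('b, 'l::field) int_scheme"
    and KW f h \<Delta> +
  fixes e :: nat and L :: "'b \<Rightarrow> rat" and s :: 'k and \<phi> :: "'k \<Rightarrow> 'k"
  assumes e: "e > 0" and LC: "Cartier_divisor W L"
    and iso: "div_sheaf_iso E s (pullback E W f h L) (log_bundle p e KE \<Delta>)"
    and pd: "phi_Delta p e E KE \<Delta> \<phi>"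
begin

abbreviation "M \<equiv> log_bundle p e KE \<Delta>"

lemmas phi = E.phi_DeltaD[OF e pd]

lemma s_nz: "s \<noteq> 0"
  using iso by (simp add: div_sheaf_iso_def)

lemma M_eq: "x \<in> E.PD \<Longrightarrow> M x = \<pi>D L x - of_int (ord_at E x s)"
  using iso E.div_sheaf_iso_iff[OF pullback_Weil[OF LC] E.Cartier_Weil[OF phi(3)]] by simp

text \<open>The projection formula on sections: if g is an equation of L near f x, regularity of g a
  pulls back, and h(g) / s is an equation of the log bundle.\<close>

lemma section_transfer:
  assumes V: "nopen W V" and a: "a \<in> div_sheaf W L V"
  shows "s * h a \<in> div_sheaf E M (preim E f V)"
proof (cases "a = 0")
  case False
  then have nz: "s * h a \<noteq> 0" using s_nz by simp
  show ?thesis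
    unfolding E.div_sheaf_iff[OF nz]
  proof
    fix x assume x: "x \<in> preim E f V \<inter> E.PD"
    have fx: "f x \<in> V" "f x \<in> W.X" using x f_in by (auto simp: preim_iff)
    obtain V' g where V': "nopen W V'" "f x \<in> V'" "g \<noteq> 0" "\<forall>w\<in>V' \<inter> W.PD. L w = of_int (ord_at W w g)"
      by (rule W.Cartier_localE[OF LC fx(2)])
    have n: "nopen W (V \<inter> V')" by (rule W.nopen_Int[OF V V'(1)])
    have L: "L w = of_int (ord_at W w g)" if "w \<in> V \<inter> V' \<inter> W.PD" for w using V'(4) that by simp
    have "a \<in> div_sheaf W L (V \<inter> V')" using W.div_sheaf_mono[of "V \<inter> V'" V L] a by blast
    then have "g * a \<in> reg W (V \<inter> V')" using W.div_sheaf_iff_reg[OF n V'(3) L] by simp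
    then have "h (g * a) \<in> reg E (preim E f (V \<inter> V'))" using preim_reg[OF n] by blast
    then have "h g / s * (s * h a) \<in> reg E (preim E f (V \<inter> V'))" using s_nz by (simp add: h_mult)
    moreover have "M z = of_int (ord_at E z (h g / s))" if z: "z \<in> preim E f (V \<inter> V') \<inter> E.PD" for z
      using z M_eq[of z] pullback_nbhd[OF V'(3,1,4), of z] V'(3) s_nz
      by (simp add: E.ord_divide preim_iff)
    ultimately have "s * h a \<in> div_sheaf E M (preim E f (V \<inter> V'))"
      using E.div_sheaf_iff_reg[OF preim_nopen[OF n], of "h g / s" M] V'(3) s_nz by simp
    then show "0 \<le> rat_of_int (ord_at E x (s * h a)) + M x"
      using x fx V'(2) unfolding E.div_sheaf_iff[OF nz] by (simp add: preim_iff)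
  qed
qed (simp add: E.zero_div_sheaf)

text \<open>Negative coefficients of \<Delta> are vertical, so some b on W has div(h b) + \<Delta>
  \<ge> 0 over V. Since h(b) \<phi>(z) = \<phi>(h(b)^(p^e) z), the gain inside \<phi> is p^e div(h
  b), more than the (1-p^e)\<Delta> in the twist can take away.\<close>

lemma pole_bound:
  assumes w: "w \<in> W.X"
  obtains V b where "nopen W V" "w \<in> V" "b \<in> reg W V" "b \<noteq> 0"
    "\<forall>U z. nopen E U \<and> U \<subseteq> preim E f V \<and> z \<in> div_sheaf E M U \<longrightarrow> h b * \<phi> z \<in> reg E U"
proof -
  obtain V where V: "affine_open W V" "w \<in> V" using W.affine_cover[OF w] by (elim exE conjE)
  note nV = W.affine_nopen[OF V(1)]
  obtain b where b: "b \<in> reg W V" "b \<noteq> 0"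
    "\<forall>x\<in>E.PD \<inter> preim E f V. ord_at E x (h b) \<ge> 0 \<and> of_int (ord_at E x (h b)) \<ge> - \<Delta> x"
  proof (rule vertical_cover[OF V(1) Q\<Delta>])
    fix x assume "x \<in> E.PD" "\<Delta> x < 0"
    then show "f x \<noteq> W.gp" using hor horizontal_gp[OF E.PD_X] by force
  qed
  have bound: "h b * \<phi> z \<in> reg E U" if U: "nopen E U" "U \<subseteq> preim E f V" and z: "z \<in> div_sheaf E M U" for U z
  proof (cases "z = 0")
    case True
    then show ?thesis
      using E.frob_linear_zero[OF phi(1)] E.zero_reg[OF U(1)] by simp
  next
    case False
    show ?thesis unfolding E.reg_iff[OF U(1)]
    proof
      fix x assume xU: "x \<in> U \<inter> E.PD"
      then have x: "x \<in> E.PD" "x \<in> E.PD \<inter> preim E f V" using U(2) by auto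
      define q :: rat where "q = of_nat p ^ e"
      have q: "q > 1" using E.q_gt_1[OF e] by (simp add: q_def)
      define B where "B = rat_of_int (ord_at E x (h b))"
      have B: "B \<ge> 0" "B \<ge> - \<Delta> x" using b(3) x(2) by (simp_all add: B_def)
      obtain m where m: "(1 - q) * KE x = of_int m" "E.lower x \<phi> m"
        using phi(4)[OF x(1)] by (auto simp: E.vord_def q_def elim: Ints_cases)
      have z': "of_int (ord_at E x z) + (1 - q) * (KE x + \<Delta> x) \<ge> 0"
        using z xU False by (simp add: E.div_sheaf_iff log_bundle_def q_def)
      have "q * B + (q - 1) * \<Delta> x = (q - 1) * (B + \<Delta> x) + B" by (simp add: algebra_simps)
      moreover have "(q - 1) * (B + \<Delta> x) \<ge> 0" using q B by (intro mult_nonneg_nonneg) auto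
      ultimately have "q * B + (q - 1) * \<Delta> x \<ge> 0" using B by simp
      then have "q * B + of_int (ord_at E x z) \<ge> - of_int m"
        using z' unfolding m(1)[symmetric] by (simp add: algebra_simps)
      moreover have "rat_of_int (ord_at E x (h b ^ (p ^ e) * z)) = q * B + of_int (ord_at E x z)"
        using x(1) b(2) False by (simp add: E.ord_mult E.ord_power B_def q_def)
      ultimately have "ord_at E x (h b ^ (p ^ e) * z) \<ge> - m" by linarith
      then have "\<phi> (h b ^ (p ^ e) * z) \<in> stalk E x"
        using False b(2) by (intro E.lowerD[OF m(2)]) simp
      then show "h b * \<phi> z \<in> stalk E x" by (simp add: E.frob_linear_scale[OF phi(1)])
    qed
  qed
  show thesis
    by (rule that[OF nV V(2) b(1,2)], intro allI impI, elim conjE, rule bound)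
qed

text \<open>Multiplied by the function h(b) of \<open>pole_bound\<close>, the value becomes regular
  on the preimage of an open subset of W, hence comes from W.\<close>

lemma push_ex: "\<exists>c. h c = \<phi> (s * h a)"
proof -
  obtain V where V: "nopen W V" "a \<in> div_sheaf W L V"
    by (rule W.div_sheaf_nbhd_gp[OF W.Weil_Q_divisor[OF W.Cartier_Weil[OF LC]]])
  obtain V' b where V': "nopen W V'" "b \<in> reg W V'" "b \<noteq> 0"
    "\<forall>U z. nopen E U \<and> U \<subseteq> preim E f V' \<and> z \<in> div_sheaf E M U \<longrightarrow> h b * \<phi> z \<in> reg E U"
    by (rule pole_bound[OF W.gp(1)])
  have n: "nopen W (V \<inter> V')" by (rule W.nopen_Int[OF V(1) V'(1)])
  have "a \<in> div_sheaf W L (V \<inter> V')" using V(2) W.div_sheaf_mono[of "V \<inter> V'" V L] by blast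
  then have "s * h a \<in> div_sheaf E M (preim E f (V \<inter> V'))" by (rule section_transfer[OF n])
  moreover have "preim E f (V \<inter> V') \<subseteq> preim E f V'" by (auto simp: preim_iff)
  ultimately have "h b * \<phi> (s * h a) \<in> reg E (preim E f (V \<inter> V'))"
    using V'(4) preim_nopen[OF n] by simp
  then obtain c where "h b * \<phi> (s * h a) = h c" using preim_reg[OF n] by blast
  then have "h (c / b) = \<phi> (s * h a)" using V'(3) by (simp add: h_divide field_simps)
  then show ?thesis by blast
qed

definition push :: "'l \<Rightarrow> 'l" where "push a = (SOME c. h c = \<phi> (s * h a))"

lemma h_push: "h (push a) = \<phi> (s * h a)"
  unfolding push_def using push_ex by (rule someI_ex)

lemma push_frob_linear: "frob_linear p e push"
  unfolding frob_linear_def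
proof (intro conjI allI)
  fix x y
  have "h (push (x + y)) = h (push x + push y)"
    using phi(1) by (simp add: h_push h_add distrib_left frob_linear_def)
  then show "push (x + y) = push x + push y" by (rule h_inj)
  have eq: "s * h (x ^ p ^ e * y) = h x ^ p ^ e * (s * h y)" by (simp add: h_mult h_power)
  have "h (push (x ^ p ^ e * y)) = h x * \<phi> (s * h y)"
    unfolding h_push eq by (rule E.frob_linear_scale[OF phi(1)])
  also have "\<dots> = h (x * push y)" by (simp add: h_mult h_push)
  finally show "push (x ^ p ^ e * y) = x * push y" by (rule h_inj)
qed

lemma push_pushforward_map: "pushforward_map p e E W f h KE \<Delta> L push"
  unfolding pushforward_map_def
proof (intro exI[of _ \<phi>] exI[of _ s] conjI pd iso ballI allI h_push)
  fix w assume "w \<in> W.X"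
  then obtain V b where V: "nopen W V" "w \<in> V" and b: "b \<in> reg W V" "b \<noteq> 0"
    and bd: "\<forall>U z. nopen E U \<and> U \<subseteq> preim E f V \<and> z \<in> div_sheaf E M U \<longrightarrow> h b * \<phi> z \<in> reg E U"
    by (rule pole_bound)
  \<comment> \<open>The local divisor bounding the image is that of the function which clears the
    poles.\<close>
  define D where "D = principal W b"
  have oV: "openin (pts W) V" using V(1) by (simp add: nopen_def)
  have ob: "ord_at W w' b \<ge> 0" if "w' \<in> V \<inter> W.PD" for w'
    using W.stalk_iff_ord[of w' b] W.stalkI[OF V(1) _ b(1), of w'] b(2) that by simp
  have eff: "eff_Cartier_on W V D"
    unfolding D_def by (rule W.eff_Cartier_principal[OF b(2) oV]) (rule ob)
  have D: "\<pi>D D x = of_int (ord_at E x (h b))" if x: "x \<in> E.PD" "x \<in> preim E f V" for x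
    by (rule pullback_nbhd[OF b(2) V(1) _ x]) (simp add: D_def principal_def)
  have 1: "\<phi> ` div_sheaf E M U \<subseteq> div_sheaf E (\<pi>D D) U" if U: "nopen E U" "U \<subseteq> preim E f V" for U
  proof
    fix y assume "y \<in> \<phi> ` div_sheaf E M U"
    then obtain z where z: "y = \<phi> z" "z \<in> div_sheaf E M U" by blast
    have "h b * y \<in> reg E U" using bd U z by simp
    then show "y \<in> div_sheaf E (\<pi>D D) U"
      using E.div_sheaf_iff_reg[OF U(1), of "h b" "\<pi>D D"] D U(2) b(2) by (simp add: subset_iff)
  qed
  have 2: "push ` div_sheaf W L V' \<subseteq> div_sheaf W D V'" if V': "nopen W V'" "V' \<subseteq> V" for V'
  proof
    fix c assume "c \<in> push ` div_sheaf W L V'"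
    then obtain a where a: "c = push a" "a \<in> div_sheaf W L V'" by blast
    have "preim E f V' \<subseteq> preim E f V" using V'(2) by (auto simp: preim_iff)
    then have "h b * \<phi> (s * h a) \<in> reg E (preim E f V')"
      using bd section_transfer[OF V'(1) a(2)] preim_nopen[OF V'(1)] by simp
    then have "h (b * c) \<in> h ` reg W V'" unfolding preim_reg[OF V'(1)] by (simp add: h_mult a(1) h_push)
    then have "b * c \<in> reg W V'" using h_inj by (metis imageE)
    then show "c \<in> div_sheaf W D V'"
      using W.div_sheaf_iff_reg[OF V'(1) b(2), of D] by (simp add: D_def principal_def)
  qed
  show "\<exists>V D. openin (pts W) V \<and> w \<in> V \<and> eff_Cartier_on W V D \<and>
      (\<forall>U. nopen E U \<and> U \<subseteq> preim E f V \<longrightarrow> \<phi> ` div_sheaf E M U \<subseteq> div_sheaf E (\<pi>D D) U) \<and>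
      (\<forall>V'. nopen W V' \<and> V' \<subseteq> V \<longrightarrow> push ` div_sheaf W L V' \<subseteq> div_sheaf W D V')"
    using oV V(2) eff 1 2 by (intro exI[of _ V] exI[of _ D]) simp
qed

definition wt :: "nat \<Rightarrow> nat" where "wt k = (\<Sum>i<k. (p ^ e) ^ i)"

lemma wt: "(1 - of_nat p ^ e) * of_nat (wt k) = (1 - of_nat p ^ (e * k) :: rat)"
  unfolding wt_def by (rule geometric_weight)

lemma wt_M: "of_nat (wt k) * M x = (1 - of_nat p ^ (e * k)) * (KE x + \<Delta> x)"
  by (simp add: log_bundle_def wt[symmetric])

lemma vord_iterate:
  assumes x: "x \<in> E.PD"
  shows "E.vord x (\<phi> ^^ k) ((1 - of_nat p ^ (e * k)) * KE x)"
proof -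
  have "(1 - of_nat p ^ e) * KE x * (\<Sum>i<k. (of_nat p ^ e) ^ i) = (1 - of_nat p ^ (e * k)) * KE x"
    unfolding wt[symmetric] by (simp add: wt_def)
  then show ?thesis using E.vord_funpow[OF x phi(1) phi(4)[OF x], of k] by (simp only:)
qed

lemma iterate_nonzero: "\<exists>w. (\<phi> ^^ k) w \<noteq> 0"
  using phi(2) E.frob_linear_funpow_nonzero[OF phi(1)] by blast

lemma vord_iterate_base:
  assumes hd: "has_divisor p e W KW L \<psi> D" and w: "w \<in> W.PD"
  shows "W.vord w (\<psi> ^^ k) ((of_nat p ^ (e * k) - 1) * D w + of_nat (wt k) * L w)"
proof -
  note H = W.has_divisorD[OF e hd]
  have w': "(of_nat p ^ (e * k) - 1 :: rat) = (of_nat p ^ e - 1) * of_nat (wt k)"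
    using wt[of k] by (simp add: algebra_simps)
  have "((of_nat p ^ e - 1) * D w + L w) * of_nat (wt k) = (of_nat p ^ (e * k) - 1) * D w + of_nat (wt k) * L w"
    unfolding w' by (simp add: algebra_simps)
  then show ?thesis
    using W.vord_funpow[OF w H(1) H(4)[OF w], of k] by (simp add: wt_def)
qed

text \<open>Every iteration contributes the isomorphism s under one more Frobenius; the factors
  collect to s^(wt k).\<close>

lemma h_funpow:
  assumes \<psi>: "\<And>a. h (\<psi> a) = \<phi> (s * h a)"
  shows "h ((\<psi> ^^ k) a) = (\<phi> ^^ k) (s ^ wt k * h a)"
proof (induction k arbitrary: a)
  case (Suc k)
  have "s ^ wt (Suc k) * h a = s ^ (p ^ (e * k)) * (s ^ wt k * h a)"
    by (simp add: wt_def power_add power_mult)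
  then have "(\<phi> ^^ k) (s ^ wt (Suc k) * h a) = s * (\<phi> ^^ k) (s ^ wt k * h a)"
    by (simp only: E.frob_linear_scale[OF E.frob_linear_funpow[OF phi(1)]])
  then show ?case using \<psi>[of "(\<psi> ^^ k) a"] Suc.IH[of a] by simp
qed (simp add: wt_def)

text \<open>The hypotheses are what a splitting of the generic fibre provides. At the common
  exponent e e', the e-th iterate of \<phi>' is the e'-th iterate of \<phi> premultiplied by some c,
  so the latter sends c z0 to 1. Once c z0 has the form s^(wt e') h(a'), the e'-th iterate of
  \<open>push\<close> sends a' to 1.\<close>

lemma push_nonzero:
  assumes e': "e' > 0" and \<phi>': "frob_linear p e' \<phi>'" and x0: "\<phi>' x0 = 1"
    and low: "\<And>x. x \<in> E.PD \<Longrightarrow> f x = W.gp \<Longrightarrow>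
      \<exists>n. of_int n = (1 - of_nat p ^ e') * KE x \<and> E.lower x \<phi>' n"
    and sec: "\<And>x. x \<in> E.PD \<Longrightarrow> f x = W.gp \<Longrightarrow>
      of_int (ord_at E x x0) + log_bundle p e' KE \<Delta> x \<ge> 0"
  shows "\<exists>a. push a \<noteq> 0"
proof -
  define N' where "N' = (\<Sum>i<e. (p ^ e') ^ i)"
  define Q :: rat where "Q = of_nat p ^ (e * e')"
  have N': "(1 - of_nat p ^ e') * of_nat N' = 1 - Q"
    unfolding N'_def Q_def mult.commute[of e e'] by (rule geometric_weight)
  have flA: "frob_linear p (e * e') (\<phi> ^^ e')" by (rule E.frob_linear_funpow[OF phi(1)])
  have flB: "frob_linear p (e * e') (\<phi>' ^^ e)"
    using E.frob_linear_funpow[OF \<phi>', of e] by (simp add: mult.commute)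
  obtain w where w: "(\<phi> ^^ e') w \<noteq> 0" using iterate_nonzero by blast
  define z0 where "z0 = x0 ^ N'"
  have Bz: "(\<phi>' ^^ e) z0 = 1" unfolding z0_def N'_def by (rule E.frob_funpow_power[OF \<phi>' x0])
  have x0nz: "x0 \<noteq> 0" using x0 E.frob_linear_zero[OF \<phi>'] by auto
  then have z0nz: "z0 \<noteq> 0" by (simp add: z0_def)
  have "(\<phi>' ^^ e) z0 \<noteq> 0" using Bz by simp
  moreover have "e * e' > 0" using e e' by simp
  ultimately obtain c where c: "c \<noteq> 0" "\<phi>' ^^ e = (\<lambda>a. (\<phi> ^^ e') (c * a))"
    using E.frob_transitive[OF _ flA w flB] by blast
  have f1: "(\<phi> ^^ e') (c * z0) = 1" using fun_cong[OF c(2), of z0] Bz by simp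
  obtain g where g: "local_equation W L W.gp g" using W.Cartier_local[OF LC W.gp(1)] by blast
  have g0: "g \<noteq> 0" using g by (simp add: local_equation_def)
  \<comment> \<open>Along the generic fibre h(g) / s is an equation of the log bundle, so r is c z0,
    as a section of the \<open>wt e'\<close>-fold multiple of that bundle, written as a
    function.\<close>
  define r where "r = c * z0 * h g ^ wt e' / s ^ wt e'"
  have r0: "r \<noteq> 0" using c(1) z0nz g0 s_nz by (simp add: r_def)
  have "ord_at E x r \<ge> 0" if x: "x \<in> E.PD" "f x = W.gp" for x
  proof -
    obtain n where n: "of_int n = (1 - of_nat p ^ e') * KE x" "E.lower x \<phi>' n" using low[OF x] by blast
    have lB: "E.lower x (\<phi>' ^^ e) (n * int N')"
      using E.lower_funpow[OF x(1) \<phi>' n(2), of e] by (simp add: N'_def)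
    have vB: "E.vord x (\<phi>' ^^ e) ((1 - Q) * KE x + of_int (ord_at E x c))"
      unfolding c(2) Q_def by (rule E.vord_precompose[OF x(1) c(1) vord_iterate[OF x(1)]])
    \<comment> \<open>The lower bound for the iterate of \<phi>' equals the exact order of the
      iterate of \<phi>, so premultiplication by c does not lower the order and c has no pole at
      x.\<close>
    have "of_int (n * int N') \<le> (1 - Q) * KE x + of_int (ord_at E x c)"
      using vB lB by (simp add: E.vord_def)
    moreover have "of_int (n * int N') = (1 - Q) * KE x"
      by (simp add: n(1) N'[symmetric] algebra_simps)
    ultimately have oc: "ord_at E x c \<ge> 0" by simp
    have "of_nat N' * (of_int (ord_at E x x0) + (1 - of_nat p ^ e') * (KE x + \<Delta> x)) \<ge> 0"
      using sec[OF x] by (intro mult_nonneg_nonneg) (simp_all add: log_bundle_def)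
    then have "of_nat N' * of_int (ord_at E x x0) + (1 - Q) * (KE x + \<Delta> x) \<ge> 0"
      by (simp add: N'[symmetric] algebra_simps)
    moreover have "of_nat (wt e') * M x = (1 - Q) * (KE x + \<Delta> x)" unfolding Q_def by (rule wt_M)
    moreover have "M x = of_int (ord_at E x (h g)) - of_int (ord_at E x s)"
      using M_eq[OF x(1)] pullback_eq[OF x(1), of L g] g x(2) by simp
    ultimately have "of_nat N' * of_int (ord_at E x x0)
        + of_nat (wt e') * (of_int (ord_at E x (h g)) - of_int (ord_at E x s)) \<ge> (0::rat)" by simp
    then have "of_int (int N' * ord_at E x x0 + int (wt e') * (ord_at E x (h g) - ord_at E x s)) \<ge> (0::rat)"
      by simp
    then have "int N' * ord_at E x x0 + int (wt e') * (ord_at E x (h g) - ord_at E x s) \<ge> 0"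
      by (simp only: of_int_0_le_iff)
    moreover have "ord_at E x r = ord_at E x c + int N' * ord_at E x x0 + int (wt e') * ord_at E x (h g) - int (wt e') * ord_at E x s"
      using x(1) c(1) x0nz g0 s_nz
      by (simp add: r_def z0_def E.ord_divide E.ord_mult E.ord_power)
    ultimately show ?thesis using oc by (simp add: algebra_simps)
  qed
  then obtain a where a: "r = h a" using generic_fibre_functions[OF r0] by blast
  have "s ^ wt e' * h (a / g ^ wt e') = c * z0"
    using a g0 s_nz by (simp add: h_divide h_power r_def[symmetric] flip: a) (simp add: r_def)
  then have "h ((push ^^ e') (a / g ^ wt e')) = 1"
    using h_funpow[OF h_push, of e' "a / g ^ wt e'"] f1 by simp
  then have nz: "(push ^^ e') (a / g ^ wt e') \<noteq> 0" by auto
  \<comment> \<open>As e' > 0, the nonzero value is a value of \<open>push\<close> itself.\<close>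
  show ?thesis
  proof (rule ccontr)
    assume "\<not> ?thesis"
    moreover obtain k where "e' = Suc k" using e' by (cases e') auto
    ultimately show False using nz by simp
  qed
qed

end

section \<open>Independence of the divisor on W of all choices\<close>

context fibration
begin

text \<open>
  Both choices are compared after passing to the common exponent $e_1 e_2$, where the iterates of
  the two maps differ by a unit and the two line bundles by a principal divisor on \<open>W\<close>.
\<close>

lemma divisor_unique:
  assumes c1: "fib_choice p E KE W KW f h \<Delta> e1 L1 s1 \<phi>1" and c2: "fib_choice p E KE W KW f h \<Delta> e2 L2 s2 \<phi>2"
    and h1: "\<And>a. h (\<psi>1 a) = \<phi>1 (s1 * h a)" and h2: "\<And>a. h (\<psi>2 a) = \<phi>2 (s2 * h a)"
    and d1: "has_divisor p e1 W KW L1 \<psi>1 \<Delta>1" and d2: "has_divisor p e2 W KW L2 \<psi>2 \<Delta>2"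
  shows "\<Delta>1 = \<Delta>2"
proof -
  interpret C1: fib_choice p E KE W KW f h \<Delta> e1 L1 s1 \<phi>1 by (rule c1)
  interpret C2: fib_choice p E KE W KW f h \<Delta> e2 L2 s2 \<phi>2 by (rule c2)
  note H1 = W.has_divisorD[OF C1.e d1] and H2 = W.has_divisorD[OF C2.e d2]
  define N1 where "N1 = C1.wt e2"
  define N2 where "N2 = C2.wt e1"
  define n where "n = e1 * e2"
  define Q :: rat where "Q = of_nat p ^ n"
  have n0: "n > 0" using C1.e C2.e by (simp add: n_def)
  have Q: "Q \<noteq> 1" using E.q_gt_1[OF n0] by (simp add: Q_def)
  have n': "n = e2 * e1" by (simp add: n_def)
  have flA: "frob_linear p n (\<phi>1 ^^ e2)"
    unfolding n_def by (rule E.frob_linear_funpow[OF C1.phi(1)])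
  have flB: "frob_linear p n (\<phi>2 ^^ e1)"
    unfolding n' by (rule E.frob_linear_funpow[OF C2.phi(1)])
  obtain w1 w2 where w: "(\<phi>1 ^^ e2) w1 \<noteq> 0" "(\<phi>2 ^^ e1) w2 \<noteq> 0"
    using C1.iterate_nonzero C2.iterate_nonzero by blast
  obtain c where c: "c \<noteq> 0" "\<phi>1 ^^ e2 = (\<lambda>a. (\<phi>2 ^^ e1) (c * a))"
    by (rule E.frob_transitive[OF n0 flB w(2) flA w(1)])
  \<comment> \<open>Both iterates have order (1-Q) K_E, so c is a unit in codimension one.\<close>
  have oc: "ord_at E x c = 0" if x: "x \<in> E.PD" for x
  proof -
    have "E.vord x (\<phi>1 ^^ e2) ((1 - Q) * KE x + of_int (ord_at E x c))"
      unfolding c(2) Q_def n' by (rule E.vord_precompose[OF x c(1) C2.vord_iterate[OF x]])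
    from E.vord_unique[OF C1.vord_iterate[OF x] this] show ?thesis by (simp add: Q_def n_def)
  qed
  \<comment> \<open>The factor between the accumulated isomorphisms s1^N1 and s2^N2. Both bundles
    have become the log bundle of exponent n, so div(u) is the pull-back of N1 L1 - N2 L2.\<close>
  define u where "u = c * s1 ^ N1 / s2 ^ N2"
  have u0: "u \<noteq> 0" using c(1) C1.s_nz C2.s_nz by (simp add: u_def)
  have ou: "of_int (ord_at E x u) = of_nat N1 * \<pi>D L1 x - of_nat N2 * \<pi>D L2 x" if x: "x \<in> E.PD" for x
  proof -
    have "ord_at E x u = int N1 * ord_at E x s1 - int N2 * ord_at E x s2"
      using x c(1) C1.s_nz C2.s_nz oc[OF x] by (simp add: u_def E.ord_divide E.ord_mult E.ord_power)
    then have "rat_of_int (ord_at E x u) = of_nat N1 * of_int (ord_at E x s1) - of_nat N2 * of_int (ord_at E x s2)"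
      by simp
    moreover have "of_int (ord_at E x s1) = \<pi>D L1 x - C1.M x" using C1.M_eq[OF x] by simp
    moreover have "of_int (ord_at E x s2) = \<pi>D L2 x - C2.M x" using C2.M_eq[OF x] by simp
    moreover have "of_nat N1 * C1.M x = (1 - Q) * (KE x + \<Delta> x)"
      unfolding N1_def Q_def n_def by (rule C1.wt_M)
    moreover have "of_nat N2 * C2.M x = (1 - Q) * (KE x + \<Delta> x)"
      unfolding N2_def Q_def n' by (rule C2.wt_M)
    ultimately show ?thesis by (simp add: right_diff_distrib)
  qed
  \<comment> \<open>\<open>descend_unit\<close> asks for integer values. The floor merely converts
    the type, since L1 and L2 are integral.\<close>
  define D where "D = (\<lambda>w. \<lfloor>of_nat N1 * L1 w - of_nat N2 * L2 w\<rfloor>)"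
  have loc: "\<exists>V g. nopen W V \<and> w \<in> V \<and> g \<noteq> 0 \<and>
      (\<forall>x\<in>E.PD \<inter> preim E f V. ord_at E x u = ord_at E x (h g)) \<and>
      (\<forall>z\<in>W.PD \<inter> V. ord_at W z g = D z)" if w: "w \<in> W.X" for w
  proof -
    obtain V1 g1 where V1: "nopen W V1" "w \<in> V1" "g1 \<noteq> 0" "\<forall>x\<in>V1 \<inter> W.PD. L1 x = of_int (ord_at W x g1)"
      by (rule W.Cartier_localE[OF C1.LC w])
    obtain V2 g2 where V2: "nopen W V2" "w \<in> V2" "g2 \<noteq> 0" "\<forall>x\<in>V2 \<inter> W.PD. L2 x = of_int (ord_at W x g2)"
      by (rule W.Cartier_localE[OF C2.LC w])
    define g where "g = g1 ^ N1 / g2 ^ N2"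
    have V: "nopen W (V1 \<inter> V2)" by (rule W.nopen_Int[OF V1(1) V2(1)])
    have "ord_at E x u = ord_at E x (h g)" if x: "x \<in> E.PD \<inter> preim E f (V1 \<inter> V2)" for x
    proof -
      have xV: "x \<in> E.PD" "x \<in> preim E f V1" "x \<in> preim E f V2" using x by (auto simp: preim_iff)
      have "rat_of_int (ord_at E x u) = of_int (int N1 * ord_at E x (h g1) - int N2 * ord_at E x (h g2))"
        using ou[OF xV(1)] pullback_nbhd[OF V1(3,1,4) xV(1,2)] pullback_nbhd[OF V2(3,1,4) xV(1,3)] by simp
      then show ?thesis
        using xV(1) V1(3) V2(3) by (simp only: of_int_eq_iff) (simp add: g_def h_divide h_power E.ord_divide E.ord_power)
    qed
    moreover have "ord_at W z g = D z" if z: "z \<in> W.PD \<inter> (V1 \<inter> V2)" for z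
    proof -
      have "of_nat N1 * L1 z - of_nat N2 * L2 z = of_int (int N1 * ord_at W z g1 - int N2 * ord_at W z g2)"
        using z V1(4) V2(4) by simp
      then show ?thesis
        using z V1(3) V2(3) unfolding D_def
        by (simp only: floor_of_int) (simp add: g_def W.ord_divide W.ord_power)
    qed
    ultimately show ?thesis
      using V V1(2,3) V2(2,3) by (intro exI[of _ "V1 \<inter> V2"] exI[of _ g]) (simp add: g_def)
  qed
  obtain v where v: "v \<noteq> 0" "h v = u" "\<And>z. z \<in> W.PD \<Longrightarrow> ord_at W z v = D z"
    using descend_unit[OF u0 loc] by blast
  have psi: "\<psi>1 ^^ e2 = (\<lambda>a. (\<psi>2 ^^ e1) (v * a))"
  proof (rule ext, rule h_inj)
    fix a
    have "h ((\<psi>1 ^^ e2) a) = (\<phi>2 ^^ e1) (c * (s1 ^ N1 * h a))"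
      using C1.h_funpow[OF h1, of e2 a] fun_cong[OF c(2)] by (simp add: N1_def)
    also have "c * (s1 ^ N1 * h a) = s2 ^ N2 * h (v * a)"
      using C2.s_nz v(2) by (simp add: h_mult u_def)
    also have "(\<phi>2 ^^ e1) (s2 ^ N2 * h (v * a)) = h ((\<psi>2 ^^ e1) (v * a))"
      using C2.h_funpow[OF h2, of e1 "v * a"] by (simp add: N2_def)
    finally show "h ((\<psi>1 ^^ e2) a) = h ((\<psi>2 ^^ e1) (v * a))" .
  qed
  show ?thesis
  proof
    fix w
    show "\<Delta>1 w = \<Delta>2 w"
    proof (cases "w \<in> W.PD")
      case w: True
      have "W.vord w (\<psi>1 ^^ e2) ((Q - 1) * \<Delta>1 w + of_nat N1 * L1 w)"
        unfolding Q_def n_def N1_def by (rule C1.vord_iterate_base[OF d1 w])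
      moreover have "W.vord w (\<psi>1 ^^ e2) ((Q - 1) * \<Delta>2 w + of_nat N2 * L2 w + of_int (D w))"
        unfolding psi v(3)[OF w, symmetric] Q_def n' N2_def
        by (rule W.vord_precompose[OF w v(1) C2.vord_iterate_base[OF d2 w]])
      ultimately have eq: "(Q - 1) * \<Delta>1 w + of_nat N1 * L1 w
          = (Q - 1) * \<Delta>2 w + of_nat N2 * L2 w + of_int (D w)"
        by (rule W.vord_unique)
      have "of_nat N1 * L1 w - of_nat N2 * L2 w \<in> \<int>"
        using W.Weil_Ints[OF W.Cartier_Weil[OF C1.LC], of w] W.Weil_Ints[OF W.Cartier_Weil[OF C2.LC], of w]
        by (intro Ints_diff Ints_mult) auto
      then have "of_int (D w) = of_nat N1 * L1 w - of_nat N2 * L2 w" by (auto simp: D_def elim!: Ints_cases)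
      then have "(Q - 1) * \<Delta>1 w = (Q - 1) * \<Delta>2 w" using eq by simp
      then show ?thesis using Q by simp
    next
      case False
      then show ?thesis using W.Q_divisor_PD[OF H1(3)] W.Q_divisor_PD[OF H2(3)] by simp
    qed
  qed
qed

end

section \<open>The generic fibre\<close>

lemma stalk_subscheme:
  assumes "y \<in> S"
  shows "stalk (subscheme Y S) y = stalk Y y"
proof
  show "stalk (subscheme Y S) y \<subseteq> stalk Y y"
    unfolding stalk_def[of "subscheme Y S"] by (auto simp: subscheme_def)
  show "stalk Y y \<subseteq> stalk (subscheme Y S) y"
  proof
    fix a assume "a \<in> stalk Y y"
    then obtain V where V: "openin (pts Y) V" "y \<in> V" "a \<in> reg Y V" unfolding stalk_def by blast
    have o: "openin (pts (subscheme Y S)) (V \<inter> S)"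
      using V(1) by (simp add: subscheme_def openin_subtopology_Int)
    have "a \<in> stalk Y z" if "z \<in> V" for z using V that unfolding stalk_def by blast
    then have "a \<in> reg (subscheme Y S) (V \<inter> S)" by (simp add: subscheme_def)
    then show "a \<in> stalk (subscheme Y S) y"
      unfolding stalk_def[of "subscheme Y S"] using o V(2) assms by blast
  qed
qed

context fibration
begin

definition S :: "'a set" where "S = preim E f {W.gp}"

text \<open>The fibre is cut out twice: once as the total space over the one-point base, and once
  more by \<open>globally_F_split_rel\<close>, as the preimage of an open subset of that
  base.\<close>

abbreviation "F \<equiv> subscheme (subscheme E S) S"

lemma S_iff: "x \<in> S \<longleftrightarrow> x \<in> E.X \<and> f x = W.gp"
  by (simp add: S_def preim_iff)

lemma gp_S: "E.gp \<in> S"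
  by (simp add: S_iff E.gp f_gp)

lemma S_sub: "S \<subseteq> E.X"
  by (auto simp: S_iff)

lemma pts_F: "pts F = subtopology (pts E) S"
  by (simp add: subscheme_def subtopology_subtopology)

lemma topspace_F: "topspace (pts F) = S"
  unfolding pts_F using S_sub by auto

lemma reg_F: "U \<subseteq> S \<Longrightarrow> reg F U = (\<Inter>y\<in>U. stalk E y)"
  using stalk_subscheme[of _ S E] by (auto simp: subscheme_def[of "subscheme E S"] subset_iff)

lemma stalk_F: "x \<in> S \<Longrightarrow> stalk F x = stalk E x"
  by (simp add: stalk_subscheme)

lemma ord_F: "x \<in> S \<Longrightarrow> ord_at F x g = ord_at E x g"
  by (simp add: ord_at_val stalk_F)

lemma cl_F: "z \<in> S \<Longrightarrow> (pts F) closure_of {z} = S \<inter> E.cl z"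
  unfolding pts_F by (simp add: closure_of_subtopology)

text \<open>The preimage of every nonempty open subset of W contains x and hence its generization z,
  so f z lies in all these subsets. Therefore codimension one means the same on the fibre and on
  E.\<close>

lemma generization_in_S:
  assumes x: "x \<in> S" "x \<in> E.cl z" and z: "z \<in> E.X"
  shows "z \<in> S"
proof -
  have "f z \<in> V" if V: "nopen W V" for V
  proof -
    have "x \<in> preim E f V" using x(1) W.gp_in[OF V] by (simp add: S_iff preim_iff)
    moreover have "openin (pts E) (preim E f V)" using preim_nopen[OF V] by (simp add: nopen_def)
    ultimately have "z \<in> preim E f V" using E.cl_open[OF x(2)] by blast
    then show ?thesis by (simp add: preim_iff)
  qed
  then have "W.gp = f z" using W.gp_eq[OF f_in[OF z]] W.cl_univ_iff by blast
  then show ?thesis using z by (simp add: S_iff)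
qed

lemma gp_F: "generic_point F = E.gp"
  unfolding generic_point_def[of F] topspace_F
proof (rule the_equality)
  show "E.gp \<in> S \<and> (pts F) closure_of {E.gp} = S"
    using gp_S S_sub by (auto simp: cl_F E.gp)
  fix y assume y: "y \<in> S \<and> (pts F) closure_of {y} = S"
  then have "E.gp \<in> E.cl y" using gp_S cl_F[of y] by blast
  then have "y \<in> V" if "nopen E V" for V
    using E.cl_open[of E.gp y V] E.gp_in[OF that] that by (simp add: nopen_def)
  then have "E.gp = y" using E.gp_eq[of y] E.cl_univ_iff y S_sub by blast
  then show "y = E.gp" by simp
qed

lemma PD_F: "prime_divs F = E.PD \<inter> S"
proof (intro subset_antisym subsetI)
  fix x assume x: "x \<in> prime_divs F"
  then have xS: "x \<in> S" "x \<noteq> E.gp" and min: "\<And>z. z \<in> S \<Longrightarrow> x \<in> S \<inter> E.cl z \<Longrightarrow> z = x \<or> z = E.gp"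
    using cl_F by (auto simp: prime_divs_def[of F] topspace_F gp_F)
  have "z = x \<or> z = E.gp" if "z \<in> E.X" "x \<in> E.cl z" for z
    using min[OF generization_in_S[OF xS(1) that(2,1)]] xS(1) that(2) by blast
  then show "x \<in> E.PD \<inter> S" using xS S_sub by (auto simp: prime_divs_def[of E])
next
  fix x assume x: "x \<in> E.PD \<inter> S"
  have "z = x \<or> z = E.gp" if "z \<in> S" "x \<in> (pts F) closure_of {z}" for z
    using E.PD_cl[of x z] x that S_sub by (auto simp: cl_F)
  then show "x \<in> prime_divs F"
    using x by (auto simp: prime_divs_def[of F] topspace_F gp_F prime_divs_def[of E])
qed

text \<open>The fibre is not treated as an instance of \<open>nscheme\<close>. Its duality
  isomorphism T is taken from the splitting, and the half of \<open>lower_T\<close> that needs only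
  T of a section to be a map into the structure sheaf is repeated. Hence a lower bound for \<phi>'
  instead of its order.\<close>

lemma F_split_section:
  assumes split: "globally_F_split p F (restrict_div S (restrict_div S KE)) (restrict_div S (restrict_div S \<Delta>))"
  obtains e' \<phi>' x0 where "e' > 0" "frob_linear p e' \<phi>'" "\<phi>' x0 = 1"
    "\<And>x. x \<in> E.PD \<Longrightarrow> f x = W.gp \<Longrightarrow> \<exists>n. of_int n = (1 - of_nat p ^ e') * KE x \<and> E.lower x \<phi>' n"
    "\<And>x. x \<in> E.PD \<Longrightarrow> f x = W.gp \<Longrightarrow> of_int (ord_at E x x0) + log_bundle p e' KE \<Delta> x \<ge> 0"
proof -
  define K' where "K' = restrict_div S (restrict_div S KE)"
  define \<Delta>' where "\<Delta>' = restrict_div S (restrict_div S \<Delta>)"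
  have K': "K' x = KE x" and \<Delta>': "\<Delta>' x = \<Delta> x" if "x \<in> S" for x
    using that by (simp_all add: K'_def \<Delta>'_def restrict_div_def)
  obtain e' \<phi>' where e': "e' > 0" and pd: "phi_Delta p e' F K' \<Delta>' \<phi>'"
    and surj: "\<phi>' ` div_sheaf F (log_bundle p e' K' \<Delta>') S = reg F S"
    using split unfolding globally_F_split_def K'_def[symmetric] \<Delta>'_def[symmetric] topspace_F
    by (elim exE conjE)
  define q :: rat where "q = of_nat p ^ e'"
  have q: "q - 1 \<noteq> 0" using E.q_gt_1[OF e'] by (simp add: q_def)
  have hd: "has_divisor p e' F K' (log_bundle p e' K' \<Delta>') \<phi>' \<Delta>'" using pd by (simp add: phi_Delta_def)
  obtain T g where T: "frob_duality p e' F K' T" and g: "g \<noteq> 0" "\<phi>' = T g"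
    and fl: "frob_linear p e' \<phi>'"
    and eq: "\<forall>x\<in>prime_divs F. (of_nat p ^ e' - 1) * \<Delta>' x + log_bundle p e' K' \<Delta>' x
      = of_int (ord_at F x g) + (1 - of_nat p ^ e') * K' x"
    by (rule has_divisorE[OF hd, of E.gp]) (use q gp_S topspace_F in \<open>auto simp: q_def\<close>)
  \<comment> \<open>\<Delta> cancels as in \<open>phi_DeltaD\<close>, so \<phi>' = T(g) with g of
    order 0 on the fibre.\<close>
  have og: "ord_at E x g = 0" if x: "x \<in> E.PD" "x \<in> S" for x
  proof -
    have "rat_of_int (ord_at F x g) = 0"
      using eq[rule_format, of x] x by (simp add: PD_F log_bundle_def algebra_simps)
    then show ?thesis by (simp add: ord_F[OF x(2)])
  qed
  have low: "\<exists>n. of_int n = (1 - of_nat p ^ e') * KE x \<and> E.lower x \<phi>' n" if x: "x \<in> E.PD" "f x = W.gp" for x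
  proof -
    have xS: "x \<in> S" using x E.PD_X by (simp add: S_iff)
    have "(1 - q) * KE x \<in> \<int>"
      using E.Weil_Ints[OF E.WeilK, of x] by (auto simp: q_def intro!: Ints_mult Ints_diff Ints_power)
    then obtain n where n: "(1 - q) * KE x = of_int n" by (auto elim: Ints_cases)
    define KK where "KK = (\<lambda>y. (1 - of_nat p ^ e') * KE y)"
    have KKd: "Q_divisor E KK"
      using E.Q_divisor_add[OF E.Weil_Q_divisor[OF E.WeilK] E.Weil_Q_divisor[OF E.WeilK], of _ 0]
      by (simp add: KK_def)
    have "E.lower x \<phi>' n"
      unfolding E.lower_def
    proof (intro allI impI, elim conjE)
      fix a assume a: "a \<noteq> 0" "ord_at E x a \<ge> - n"
      have ag: "a * g \<noteq> 0" using a(1) g(1) by simp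
      have "rat_of_int (ord_at E x a) \<ge> - of_int n" using a(2) by linarith
      then have "of_int (ord_at E x (a * g)) + KK x \<ge> 0"
        using a(1) g(1) x(1) og[OF x(1) xS] n by (simp add: E.ord_mult KK_def q_def)
      then obtain V where V: "nopen E V" "x \<in> V" "a * g \<in> div_sheaf E KK V"
        by (rule E.div_sheaf_nbhd_PD[OF KKd ag x(1)])
      have oV: "openin (pts F) (V \<inter> S)"
        unfolding pts_F using V(1) by (simp add: nopen_def openin_subtopology_Int)
      have nV: "nopen F (V \<inter> S)" using oV V(2) xS by (auto simp: nopen_def)
      have "a * g \<in> div_sheaf F (\<lambda>y. (1 - of_nat p ^ e') * K' y) (V \<inter> S)"
        using V(3) ag by (auto simp: div_sheaf_def PD_F ord_F K' KK_def)
      then have "T (a * g) \<in> frob_hom p e' F (\<lambda>_. 0) (V \<inter> S)"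
        using T nV unfolding frob_duality_def using bij_betwE by blast
      moreover have "1 \<in> div_sheaf F (\<lambda>_. 0) (V \<inter> S)"
        using E.ord_one by (auto simp: div_sheaf_def PD_F ord_F)
      ultimately have "T (a * g) 1 \<in> reg F (V \<inter> S)"
        using nV by (auto simp: frob_hom_def)
      then have "T (a * g) 1 \<in> stalk E x" using V(2) xS by (simp add: reg_F)
      moreover have "T (a * g) 1 = \<phi>' a" using T by (simp add: frob_duality_def g(2))
      ultimately show "\<phi>' a \<in> stalk E x" by simp
    qed
    then show ?thesis using n by (intro exI[of _ n]) (simp add: q_def)
  qed
  have "1 \<in> stalk E y" if "y \<in> S" for y
    using field_subring.one_in[OF E.field_subring_stalk] that S_sub by blast
  then have "1 \<in> \<phi>' ` div_sheaf F (log_bundle p e' K' \<Delta>') S" unfolding surj by (simp add: reg_F)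
  then obtain x0 where x0: "\<phi>' x0 = 1" "x0 \<in> div_sheaf F (log_bundle p e' K' \<Delta>') S"
    by (metis imageE)
  have x00: "x0 \<noteq> 0" using x0(1) E.frob_linear_zero[OF fl] by auto
  have "of_int (ord_at E x x0) + log_bundle p e' KE \<Delta> x \<ge> 0" if x: "x \<in> E.PD" "f x = W.gp" for x
  proof -
    have xS: "x \<in> S" using x E.PD_X by (simp add: S_iff)
    then have "x \<in> S \<inter> prime_divs F" using x by (simp add: PD_F)
    then have "of_int (ord_at F x x0) + log_bundle p e' K' \<Delta>' x \<ge> 0"
      using x0(2) x00 by (simp add: div_sheaf_def)
    then show ?thesis by (simp add: ord_F[OF xS] log_bundle_def K'[OF xS] \<Delta>'[OF xS])
  qed
  then show thesis using that[OF e' fl x0(1) low] by blast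
qed

text \<open>The base has a single point, so some member of the cover is all of it, and its preimage
  is the whole fibre.\<close>

lemma split_relD:
  assumes "globally_F_split_rel p (subscheme E S) (restrict_div S KE) (restrict_div S \<Delta>)
    (subscheme W {W.gp}) f"
  shows "globally_F_split p F (restrict_div S (restrict_div S KE)) (restrict_div S (restrict_div S \<Delta>))"
proof -
  have tW: "topspace (pts (subscheme W {W.gp})) = {W.gp}"
    using W.gp(1) by (auto simp: subscheme_def)
  have tE: "topspace (pts (subscheme E S)) = S"
    using S_sub by (auto simp: subscheme_def)
  obtain C where C: "\<forall>V\<in>C. nopen (subscheme W {W.gp}) V" "\<Union>C = {W.gp}"
    "\<forall>V\<in>C. let S' = preim (subscheme E S) f V
       in globally_F_split p (subscheme (subscheme E S) S') (restrict_div S' (restrict_div S KE))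
            (restrict_div S' (restrict_div S \<Delta>))"
    using assms unfolding globally_F_split_rel_def tW by (elim exE conjE)
  then obtain V where V: "V \<in> C" "W.gp \<in> V" by blast
  then have "V = {W.gp}" using C(2) by blast
  moreover have "preim (subscheme E S) f {W.gp} = S"
    unfolding preim_def tE by (auto simp: S_iff)
  ultimately show ?thesis using C(3)[rule_format, OF V(1)] by (simp add: Let_def)
qed

end

theorem theorem5p2:
  fixes E :: "('a, 'k::field) int_scheme" and W :: "('b, 'l::field) int_scheme"
    and f :: "'a \<Rightarrow> 'b" and h :: "'l \<Rightarrow> 'k"
    and K\<^sub>E \<Delta>\<^sub>E :: "'a \<Rightarrow> rat" and K\<^sub>W L :: "'b \<Rightarrow> rat" and p e :: nat
  assumes "prime p" and "standing p E" and "standing p W"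
    and "dominant_morphism E W f h" and "proper_morphism E W f h"
    and "\<forall>V. nopen W V \<longrightarrow> h ` reg W V = reg E (preim E f V)"
    and "canonical_divisor p E K\<^sub>E" and "canonical_divisor p W K\<^sub>W"
    and "Q_divisor E \<Delta>\<^sub>E"
    and "e > 0" and "Cartier_divisor W L"
    and "Weil_divisor E (log_bundle p e K\<^sub>E \<Delta>\<^sub>E)"
    and "\<exists>s. div_sheaf_iso E s (log_bundle p e K\<^sub>E \<Delta>\<^sub>E) (pullback E W f h L)"
    and "\<forall>x \<in> prime_divs E. horizontal E W f x \<longrightarrow> \<Delta>\<^sub>E x \<ge> 0"
    and "let \<eta> = generic_point W; S = preim E f {\<eta>}
         in globally_F_split_rel p (subscheme E S) (restrict_div S K\<^sub>E) (restrict_div S \<Delta>\<^sub>E)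
              (subscheme W {\<eta>}) f"
  shows "\<exists>\<Delta>\<^sub>W. Q_divisor W \<Delta>\<^sub>W \<and>
           (\<forall>\<Delta>. canonical_choice p E W f h K\<^sub>E K\<^sub>W \<Delta>\<^sub>E \<Delta> \<longleftrightarrow> \<Delta> = \<Delta>\<^sub>W) \<and>
           Q_Cartier W (\<lambda>w. K\<^sub>W w + \<Delta>\<^sub>W w) \<and>
           Q_lin_equiv E (Q_pullback E W f h (\<lambda>w. K\<^sub>W w + \<Delta>\<^sub>W w)) (\<lambda>x. K\<^sub>E x + \<Delta>\<^sub>E x)"
proof -
  interpret G: fibration p E K\<^sub>E W K\<^sub>W f h \<Delta>\<^sub>E
    using assms(1-9,14)
    by unfold_locales (simp_all add: proper_morphism_def)
  define M where "M = log_bundle p e K\<^sub>E \<Delta>\<^sub>E"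
  have WM: "Weil_divisor E M" using assms(12) by (simp add: M_def)
  note LC = assms(11)
  note WL = G.pullback_Weil[OF LC]
  obtain s0 where "div_sheaf_iso E s0 M (G.\<pi>D L)" using assms(13) by (auto simp: M_def)
  then have s0: "s0 \<noteq> 0" "\<forall>x\<in>G.E.PD. G.\<pi>D L x = M x - of_int (ord_at E x s0)"
    using G.E.div_sheaf_iso_iff[OF WM WL] by simp_all
  \<comment> \<open>The hypothesis maps the log bundle to the pull-back;
    \<open>pushforward_map\<close> needs the opposite direction.\<close>
  define s where "s = inverse s0"
  have s: "s \<noteq> 0" using s0(1) by (simp add: s_def)
  have M: "M x = G.\<pi>D L x - of_int (ord_at E x s)" if "x \<in> G.E.PD" for x
    using s0 that by (simp add: s_def G.E.ord_inverse)
  have iso: "div_sheaf_iso E s (G.\<pi>D L) M"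
    unfolding G.E.div_sheaf_iso_iff[OF WL WM] using s M by simp
  \<comment> \<open>Up to div(s), M is the pull-back of a Cartier divisor.\<close>
  have CM: "Cartier_divisor E M"
    unfolding Cartier_divisor_def Cartier_on_def
  proof (intro conjI WM ballI)
    fix y assume y: "y \<in> G.E.X"
    obtain V g where V: "nopen W V" "f y \<in> V" "g \<noteq> 0" "\<forall>w\<in>V \<inter> G.W.PD. L w = of_int (ord_at W w g)"
      by (rule G.W.Cartier_localE[OF LC G.f_in[OF y]])
    have "local_equation E M y (h g / s)"
    proof (rule G.E.local_equationI[OF _ G.preim_nopen[OF V(1)]])
      show "h g / s \<noteq> 0" using V(3) s by simp
      show "y \<in> preim E f V" using y V(2) by (simp add: G.preim_iff)
      fix x assume x: "x \<in> preim E f V \<inter> G.E.PD"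
      then show "M x = of_int (ord_at E x (h g / s))"
        using M[of x] G.pullback_nbhd[OF V(3,1,4), of x] V(3) s by (simp add: G.E.ord_divide)
    qed
    then show "\<exists>g. local_equation E M y g" by blast
  qed
  obtain \<phi> where \<phi>: "phi_Delta p e E K\<^sub>E \<Delta>\<^sub>E \<phi>"
    using G.E.phi_Delta_ex[OF assms(10,9)] CM by (auto simp: M_def)
  interpret C: fib_choice p E K\<^sub>E W K\<^sub>W f h \<Delta>\<^sub>E e L s \<phi>
    by unfold_locales (use assms(10) LC iso \<phi> in \<open>simp_all add: M_def\<close>)
  have "globally_F_split_rel p (subscheme E G.S) (restrict_div G.S K\<^sub>E) (restrict_div G.S \<Delta>\<^sub>E)
      (subscheme W {G.W.gp}) f"
    using assms(15) by (simp add: Let_def G.S_def)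
  then have split: "globally_F_split p G.F (restrict_div G.S (restrict_div G.S K\<^sub>E))
      (restrict_div G.S (restrict_div G.S \<Delta>\<^sub>E))"
    by (rule G.split_relD)
  have "\<exists>a. C.push a \<noteq> 0"
    by (rule G.F_split_section[OF split]) (rule C.push_nonzero)
  then obtain a where a: "C.push a \<noteq> 0" by blast
  obtain \<Delta>\<^sub>W g where g: "g \<noteq> 0" and hd: "has_divisor p e W K\<^sub>W L C.push \<Delta>\<^sub>W"
    and eq: "\<forall>w. (of_nat p ^ e - 1) * (K\<^sub>W w + \<Delta>\<^sub>W w) = principal W g w - L w"
    using G.W.has_divisor_ex[OF assms(10) C.push_frob_linear a G.W.Cartier_Weil[OF LC]]
    by (elim exE conjE)
  have QW: "Q_divisor W \<Delta>\<^sub>W" using hd by (simp add: has_divisor_def)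
  have can: "canonical_choice p E W f h K\<^sub>E K\<^sub>W \<Delta>\<^sub>E \<Delta> \<longleftrightarrow> \<Delta> = \<Delta>\<^sub>W" for \<Delta>
  proof
    assume "\<Delta> = \<Delta>\<^sub>W"
    then show "canonical_choice p E W f h K\<^sub>E K\<^sub>W \<Delta>\<^sub>E \<Delta>"
      unfolding canonical_choice_def using assms(10) LC C.push_pushforward_map hd by blast
  next
    assume "canonical_choice p E W f h K\<^sub>E K\<^sub>W \<Delta>\<^sub>E \<Delta>"
    then obtain e2 L2 \<psi>2 where 2: "e2 > 0" "Cartier_divisor W L2"
      "pushforward_map p e2 E W f h K\<^sub>E \<Delta>\<^sub>E L2 \<psi>2" "has_divisor p e2 W K\<^sub>W L2 \<psi>2 \<Delta>"
      unfolding canonical_choice_def by (elim exE conjE)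
    obtain \<phi>2 s2 where \<phi>2: "phi_Delta p e2 E K\<^sub>E \<Delta>\<^sub>E \<phi>2"
      "div_sheaf_iso E s2 (pullback E W f h L2) (log_bundle p e2 K\<^sub>E \<Delta>\<^sub>E)" "\<forall>a. h (\<psi>2 a) = \<phi>2 (s2 * h a)"
      using 2(3) unfolding pushforward_map_def by (elim exE conjE)
    have "fib_choice p E K\<^sub>E W K\<^sub>W f h \<Delta>\<^sub>E e2 L2 s2 \<phi>2"
      by unfold_locales (use 2 \<phi>2 in simp_all)
    from G.divisor_unique[OF this C.fib_choice_axioms _ C.h_push 2(4) hd] \<phi>2(3)
    show "\<Delta> = \<Delta>\<^sub>W" by simp
  qed
  \<comment> \<open>The multiple that turns K_W + \<Delta>_W into the Cartier divisor div(g) -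
    L.\<close>
  define n where "n = p ^ e - 1"
  have n: "rat_of_nat n = of_nat p ^ e - 1" and n0: "n > 0"
    using one_less_power[of p e] G.E.p_ge_2 assms(10) by (simp_all add: n_def of_nat_diff)
  define D where "D = (\<lambda>w. K\<^sub>W w + \<Delta>\<^sub>W w)"
  have nD: "of_nat n * D w = principal W g w - L w" for w
    using eq by (simp add: n D_def)
  have WnD: "Weil_divisor W (\<lambda>w. of_nat n * D w)"
    unfolding Weil_divisor_def nD
    using G.W.Q_divisor_add[OF G.W.Q_divisor_principal[OF g] G.W.Weil_Q_divisor[OF G.W.Cartier_Weil[OF LC]], of 1 "- 1"]
      G.W.Weil_Ints[OF G.W.Cartier_Weil[OF LC]]
    by (auto simp: principal_def)
  have leq: "local_equation W (\<lambda>w. of_nat n * D w) w (g / c)" if c: "local_equation W L w c" for w c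
  proof -
    obtain V where V: "nopen W V" "w \<in> V" "c \<noteq> 0" "\<forall>x\<in>V \<inter> G.W.PD. L x = of_int (ord_at W x c)"
      using c by (rule G.W.local_equationE)
    show ?thesis
      by (rule G.W.local_equationI[OF _ V(1,2)])
        (use V(3,4) g nD in \<open>auto simp: principal_def G.W.ord_divide\<close>)
  qed
  have CnD: "Cartier_divisor W (\<lambda>w. of_nat n * D w)"
    unfolding Cartier_divisor_def Cartier_on_def
    using WnD leq G.W.Cartier_local[OF LC] by blast
  \<comment> \<open>The multiple picked inside \<open>Q_pullback\<close>. It may differ from n, and
    \<open>pullback_scale\<close> passes from one to the other.\<close>
  define m where "m = (SOME m::nat. m > 0 \<and> Cartier_divisor W (\<lambda>w. of_nat m * D w))"
  have m: "m > 0 \<and> Cartier_divisor W (\<lambda>w. of_nat m * D w)"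
    unfolding m_def by (rule someI[of _ n]) (use n0 CnD in simp)
  have "Q_pullback E W f h D = (\<lambda>x. G.\<pi>D (\<lambda>w. of_nat m * D w) x / of_nat m)"
    unfolding Q_pullback_def Let_def m_def ..
  then have nQ: "of_nat n * Q_pullback E W f h D x = G.\<pi>D (\<lambda>w. of_nat n * D w) x" for x
    using G.pullback_scale[of m D n x] m CnD by (simp add: field_simps)
  have nE: "of_nat n * (K\<^sub>E x + \<Delta>\<^sub>E x) = - M x" for x
    by (simp add: n M_def log_bundle_def algebra_simps)
  \<comment> \<open>The pull-back of div(g) - L is compared with -M, which is div(s) minus the
    pull-back of L. The pull-backs of L cancel and div(h(g) / s) remains.\<close>
  have lin: "of_nat n * Q_pullback E W f h D x - of_nat n * (K\<^sub>E x + \<Delta>\<^sub>E x) = principal E (h g / s) x" for x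
  proof (cases "x \<in> G.E.PD")
    case x: True
    obtain c where c: "local_equation W L (f x) c"
      using G.W.Cartier_local[OF LC G.f_in[OF G.E.PD_X[OF x]]] by blast
    then have c0: "c \<noteq> 0" by (simp add: local_equation_def)
    have "G.\<pi>D (\<lambda>w. of_nat n * D w) x = of_int (ord_at E x (h (g / c)))"
      by (rule G.pullback_eq[OF x leq[OF c]])
    moreover have "M x = of_int (ord_at E x (h c)) - of_int (ord_at E x s)"
      using M[OF x] G.pullback_eq[OF x c] by simp
    ultimately show ?thesis
      using x g c0 s by (simp add: nQ nE principal_def G.h_divide G.E.ord_divide)
  next
    case False
    then show ?thesis
      using G.pullback_PD[OF False] G.E.Q_divisor_PD[OF G.E.Weil_Q_divisor[OF WM]]
      by (simp add: nQ nE principal_def)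
  qed
  have W1: "Weil_divisor E (\<lambda>x. of_nat n * Q_pullback E W f h D x)"
    unfolding nQ by (rule G.pullback_Weil[OF CnD])
  have W2: "Weil_divisor E (\<lambda>x. of_nat n * (K\<^sub>E x + \<Delta>\<^sub>E x))"
    unfolding nE Weil_divisor_def
    using G.E.Q_divisor_add[OF G.E.Weil_Q_divisor[OF WM] G.E.Weil_Q_divisor[OF WM], of "- 1" 0]
      G.E.Weil_Ints[OF WM] by simp
  have "h g / s \<noteq> 0" using g s by simp
  then have "Q_lin_equiv E (Q_pullback E W f h D) (\<lambda>x. K\<^sub>E x + \<Delta>\<^sub>E x)"
    unfolding Q_lin_equiv_def using n0 W1 W2 lin by blast
  moreover have "Q_Cartier W D"
    unfolding Q_Cartier_def using n0 CnD by blast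
  ultimately show ?thesis
    using QW can unfolding D_def by blast
qed

end
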